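(* Let $N$ be an infinite set of positive integers, and for each $n\in N$ let $G=G_n$ be a strongly regular graph with parameters $(v,k,\lambda,\mu)$ (all depending on $n$), let $\overline{G}$ be its complement, with valency $\overline{k}=v-k-1$, and let $r>s$ be the restricted eigenvalues of $G$. Assume that, as $n\to\infty$ in $N$, \[ \frac{k}{n}\to\kappa,\quad \frac{\overline{k}}{n}\to\overline{\kappa},\quad \frac{r}{n}\to\rho,\quad \frac{s}{n}\to\sigma, \] where $\kappa,\overline{\kappa},\rho,\sigma$ are finite real numbers, and put $\omega=\kappa+\overline{\kappa}$. Let $\nu_n$ denote the normalized joint spectral distribution of the pair $(G^{\square n},\overline{G}^{\square n})$. Then $\rho=0$ or $\sigma=0$, and exactly one of the following holds: (i) $\kappa>0$, $\overline{\kappa}=-\sigma>0$, $\rho=0$, and $\nu_n$ converges weakly to the probability measure $\nu$ on $\mathbb{R}^2$ given by \[ \nu\!\left(\frac{\kappa j-\overline{\kappa} h}{\sqrt{\kappa}},\frac{\overline{\kappa} j+\overline{\kappa} h-1}{\sqrt{\overline{\kappa}}}\right)=e^{-1/\overline{\kappa}}\left(\frac{1}{\omega}\right)^{j}\left(\frac{\kappa}{\omega\overline{\kappa}}\right)^{h}\frac{1}{j!\,h!}\qquad (j,h=0,1,2,\dots); \] in this case $G$ is a complete multipartite graph $K_{p\times q}$ for all but finitely many $n\in N$. (ii) $\kappa=\rho>0$, $\overline{\kappa}>0$, $\sigma=0$, and $\nu_n$ converges weakly to the probability measure $\nu$ given by \[ \nu\!\left(\frac{\kappa j+\kappa h-1}{\sqrt{\kappa}},\frac{\overline{\kappa}j-\kappa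 h}{\sqrt{\overline{\kappa}}}\right)=e^{-1/\kappa}\left(\frac{1}{\omega}\right)^{j}\left(\frac{\overline{\kappa}}{\omega\kappa}\right)^{h}\frac{1}{j!\,h!}\qquad (j,h=0,1,2,\dots); \] in this case $G$ is a disjoint union $pK_q$ of complete graphs for all but finitely many $n\in N$. (iii) ($\kappa>0$ or $\overline{\kappa}>0$) and $\rho=\sigma=0$, and $\nu_n$ converges weakly to the probability measure $\nu$ determined by \[ \int_{\mathbb{R}^2}\gamma(x,y)\,\nu(dx\,dy)=\sqrt{\frac{\omega}{2\pi}}\,e^{-1/\omega}\sum_{h=0}^{\infty}\left(\frac{1}{\omega}\right)^{h}\frac{1}{h!}\int_{-\infty}^{+\infty}\gamma(\mathbf{z}_{h,t})\,e^{-\omega t^2/2}\,dt \] for every Borel function $\gamma:\mathbb{R}^2\to\mathbb{R}$, where \[ \mathbf{z}_{h,t}=\left(\sqrt{\kappa}\,h+\sqrt{\overline{\kappa}}\,t-\frac{\sqrt{\kappa}}{\omega},\ \sqrt{\overline{\kappa}}\,h-\sqrt{\kappa}\,t-\frac{\sqrt{\overline{\kappa}}}{\omega}\right). \] (iv) $\kappa=\overline{\kappa}=\rho=\sigma=0$, and $\nu_n$ converges weakly to the standard bivariate Gaussian distribution on $\mathbb{R}^2$.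
   Context: All graphs are finite and simple. A graph $G$ on $v$ vertices is strongly regular with parameters $(v,k,\lambda,\mu)$ if it is $k$-regular with $0<k<v-1$, every pair of adjacent vertices has exactly $\lambda$ common neighbours, and every pair of distinct non-adjacent vertices has exactly $\mu$ common neighbours. Its complement $\overline{G}$ (same vertex set, two distinct vertices adjacent iff they are non-adjacent in $G$) is then also strongly regular. The restricted eigenvalues $r>s$ of $G$ are the two eigenvalues of its adjacency matrix $A$ on eigenvectors orthogonal to the all-ones vector (the adjacency matrix $\overline{A}=J-I-A$ of $\overline{G}$ has corresponding eigenvalues $-r-1$ and $-s-1$ on the same common eigenspaces). $pK_q$ denotes the disjoint union of $p$ complete graphs on $q$ vertices, and $K_{p\times q}$ its complement, the complete multipartite graph with $p$ parts of size $q$ ($p,q\ge 2$). The Cartesian product $G_1\square G_2$ has vertex set $V_1\times V_2$, with $(x_1,x_2)\sim(y_1,y_2)$ iff either $x_1\sim y_1$ and $x_2=y_2$, or $x_1=y_1$ and $x_2\sim y_2$; $G^{\square n}$ is the $n$-fold Cartesian power. If $G$ is $k$-regular on $v$ vertices then $G^{\square n}$ is $nk$-regular on $v^n$ vertices, and the adjacency matrices $\mathbf{A}$ of $G^{\square n}$ and $\overline{\mathbf{A}}$ of $\overline{G}^{\square n}$ commute. The normalized joint spectral distribution of $(G^{\square n},\overline{G}^{\square n})$ is the probability measure on $\mathbb{R}^2$ assigning to each point $\left(\theta/\sqrt{nk},\ \eta/\sqrt{n\overline{k}}\right)$ the mass $m_{\theta,\eta}/v^n$, where $m_{\theta,\eta}$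 is the dimension of the common eigenspace of $(\mathbf{A},\overline{\mathbf{A}})$ with eigenvalues $(\theta,\eta)$; equivalently its mixed moments are $\int x^jy^h\,\nu_n(dx\,dy)=v^{-n}\operatorname{tr}\big((\mathbf{A}/\sqrt{nk})^j(\overline{\mathbf{A}}/\sqrt{n\overline{k}})^h\big)$. *)

theory Defs
  imports
    "HOL-Probability.Probability"
    "HOL-Library.Function_Algebras"
    "Graph_Theory.Pair_Digraph"
    "Graph_Theory.Digraph_Isomorphism"
begin

section \<open>Graphs\<close>

text \<open>
  A finite simple graph is a \<^const>\<open>pair_graph\<close>: a finite vertex set \<^const>\<open>pverts\<close> together
  with a symmetric, irreflexive set \<^const>\<open>parcs\<close> of ordered pairs, each edge being represented
  by both of its orientations.
\<close>

definition nbrs :: "'a pair_pre_digraph \<Rightarrow> 'a \<Rightarrow> 'a set" where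
  "nbrs G x = {y. (x, y) \<in> parcs G}"

definition strongly_regular ::
    "'a pair_pre_digraph \<Rightarrow> nat \<Rightarrow> nat \<Rightarrow> nat \<Rightarrow> nat \<Rightarrow> bool" where
  "strongly_regular G v k l m \<longleftrightarrow>
     pair_graph G \<and> card (pverts G) = v \<and> 0 < k \<and> k + 1 < v \<and>
     (\<forall>x\<in>pverts G. card (nbrs G x) = k) \<and>
     (\<forall>x\<in>pverts G. \<forall>y\<in>pverts G. (x, y) \<in> parcs G \<longrightarrow> card (nbrs G x \<inter> nbrs G y) = l) \<and>
     (\<forall>x\<in>pverts G. \<forall>y\<in>pverts G. x \<noteq> y \<and> (x, y) \<notin> parcs G \<longrightarrow> card (nbrs G x \<inter> nbrs G y) = m)"

definition compl_graph :: "'a pair_pre_digraph \<Rightarrow> 'a pair_pre_digraph" where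
  "compl_graph G =
     \<lparr> pverts = pverts G,
       parcs = {(x, y). x \<in> pverts G \<and> y \<in> pverts G \<and> x \<noteq> y \<and> (x, y) \<notin> parcs G} \<rparr>"

text \<open>The graphs \<open>pK\<^sub>q\<close> and \<open>K\<^bsub>p\<times>q\<^esub>\<close>; the first component of a vertex is its clique (part).\<close>

definition disjoint_cliques :: "nat \<Rightarrow> nat \<Rightarrow> (nat \<times> nat) pair_pre_digraph" where
  "disjoint_cliques p q =
     \<lparr> pverts = {..<p} \<times> {..<q},
       parcs = {((a, b), (c, d)). a < p \<and> b < q \<and> c < p \<and> d < q \<and> a = c \<and> b \<noteq> d} \<rparr>"

definition complete_multipartite :: "nat \<Rightarrow> nat \<Rightarrow> (nat \<times> nat) pair_pre_digraph" where
  "complete_multipartite p q = compl_graph (disjoint_cliques p q)"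

definition cart_prod ::
    "'a pair_pre_digraph \<Rightarrow> 'b pair_pre_digraph \<Rightarrow> ('a \<times> 'b) pair_pre_digraph" where
  "cart_prod G H =
     \<lparr> pverts = pverts G \<times> pverts H,
       parcs = {((x1, x2), (y1, y2)).
         (x1, x2) \<in> pverts G \<times> pverts H \<and> (y1, y2) \<in> pverts G \<times> pverts H \<and>
         ((x1, y1) \<in> parcs G \<and> x2 = y2 \<or> x1 = y1 \<and> (x2, y2) \<in> parcs H)} \<rparr>"

text \<open>
  The \<open>n\<close>-fold Cartesian power lives on the lists of length \<open>n\<close>: it is the iterated product
  \<open>G \<box> (G \<box> (\<dots>))\<close>, a vertex \<open>(x, xs)\<close> being written \<open>x # xs\<close>; the empty product is \<open>K\<^sub>1\<close>.
\<close>

primrec cart_pow :: "'a pair_pre_digraph \<Rightarrow> nat \<Rightarrow> 'a list pair_pre_digraph" where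
  "cart_pow G 0 = \<lparr> pverts = {[]}, parcs = {} \<rparr>"
| "cart_pow G (Suc n) =
     (let P = cart_prod G (cart_pow G n); c = (\<lambda>(x, xs). x # xs)
      in \<lparr> pverts = c ` pverts P, parcs = map_prod c c ` parcs P \<rparr>)"

section \<open>Spectra\<close>

definition adj_matrix :: "'a pair_pre_digraph \<Rightarrow> 'a \<Rightarrow> 'a \<Rightarrow> real" where
  "adj_matrix G x y = (if (x, y) \<in> parcs G then 1 else 0)"

text \<open>
  Vectors indexed by the vertex set \<open>V\<close> are functions vanishing outside \<open>V\<close>, so that distinct
  functions are distinct vectors; they form a subspace of the real vector space of all functions.
\<close>

definition eigenspace :: "'a set \<Rightarrow> ('a \<Rightarrow> 'a \<Rightarrow> real) \<Rightarrow> real \<Rightarrow> ('a \<Rightarrow> real) set" where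
  "eigenspace V M \<theta> =
     {f. (\<forall>x. x \<notin> V \<longrightarrow> f x = 0) \<and> (\<forall>x\<in>V. (\<Sum>y\<in>V. M x y * f y) = \<theta> * f x)}"

definition fun_scale :: "real \<Rightarrow> ('a \<Rightarrow> real) \<Rightarrow> 'a \<Rightarrow> real" where
  "fun_scale c f = (\<lambda>x. c * f x)"

lemma vector_space_fun_scale: "vector_space fun_scale"
  by unfold_locales (auto simp: fun_scale_def fun_eq_iff algebra_simps)

definition restricted_eigenvalues :: "'a pair_pre_digraph \<Rightarrow> real set" where
  "restricted_eigenvalues G =
     {\<theta>. \<exists>f\<in>eigenspace (pverts G) (adj_matrix G) \<theta>. f \<noteq> (\<lambda>_. 0) \<and> (\<Sum>x\<in>pverts G. f x) = 0}"

definition common_eigenspace ::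
    "'a pair_pre_digraph \<Rightarrow> 'a pair_pre_digraph \<Rightarrow> real \<times> real \<Rightarrow> ('a \<Rightarrow> real) set" where
  "common_eigenspace G H = (\<lambda>(\<theta>, \<eta>).
     eigenspace (pverts G) (adj_matrix G) \<theta> \<inter> eigenspace (pverts G) (adj_matrix H) \<eta>)"

text \<open>For graphs \<open>G\<close>, \<open>H\<close> on the same vertex set, regular of valencies \<open>d\<close>, \<open>e\<close>.\<close>

definition joint_spectral_distribution ::
    "'a pair_pre_digraph \<Rightarrow> 'a pair_pre_digraph \<Rightarrow> nat \<Rightarrow> nat \<Rightarrow> (real \<times> real) measure" where
  "joint_spectral_distribution G H d e =
     distr
       (point_measure {p. common_eigenspace G H p \<noteq> {\<lambda>_. 0}}
          (\<lambda>p. ennreal (real (vector_space.dim fun_scale (common_eigenspace G H p))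
                         / real (card (pverts G)))))
       borel
       (\<lambda>(\<theta>, \<eta>). (\<theta> / sqrt (real d), \<eta> / sqrt (real e)))"

section \<open>Weak convergence and the limit laws\<close>

text \<open>The library's \<^const>\<open>weak_conv_m\<close> only covers measures on the real line.\<close>

definition weak_conv_along ::
    "('i \<Rightarrow> 'b::topological_space measure) \<Rightarrow> 'b measure \<Rightarrow> 'i filter \<Rightarrow> bool" where
  "weak_conv_along M L F \<longleftrightarrow>
     (\<forall>f::'b \<Rightarrow> real. continuous_on UNIV f \<and> bounded (range f) \<longrightarrow>
        ((\<lambda>i. \<integral>x. f x \<partial>M i) \<longlongrightarrow> (\<integral>x. f x \<partial>L)) F)"

definition borel_prob :: "'b::topological_space measure \<Rightarrow> bool" where
  "borel_prob L \<longleftrightarrow> prob_space L \<and> sets L = sets borel"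

text \<open>
  In the next two definitions the points are pairwise distinct and the masses sum to 1 (for positive
  parameters), so the law is determined.
\<close>

definition law_multipartite :: "real \<Rightarrow> real \<Rightarrow> (real \<times> real) measure \<Rightarrow> bool" where
  "law_multipartite \<kappa> \<kappa>' L \<longleftrightarrow> borel_prob L \<and>
     (let \<omega> = \<kappa> + \<kappa>' in \<forall>j h :: nat.
        measure L {((\<kappa> * real j - \<kappa>' * real h) / sqrt \<kappa>,
                    (\<kappa>' * real j + \<kappa>' * real h - 1) / sqrt \<kappa>')}
          = exp (- 1 / \<kappa>') * (1 / \<omega>) ^ j * (\<kappa> / (\<omega> * \<kappa>')) ^ h * (1 / (fact j * fact h)))"

definition law_cliques :: "real \<Rightarrow> real \<Rightarrow> (real \<times> real) measure \<Rightarrow> bool" where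
  "law_cliques \<kappa> \<kappa>' L \<longleftrightarrow> borel_prob L \<and>
     (let \<omega> = \<kappa> + \<kappa>' in \<forall>j h :: nat.
        measure L {((\<kappa> * real j + \<kappa> * real h - 1) / sqrt \<kappa>,
                    (\<kappa>' * real j - \<kappa> * real h) / sqrt \<kappa>')}
          = exp (- 1 / \<kappa>) * (1 / \<omega>) ^ j * (\<kappa>' / (\<omega> * \<kappa>)) ^ h * (1 / (fact j * fact h)))"

definition zpoint :: "real \<Rightarrow> real \<Rightarrow> nat \<Rightarrow> real \<Rightarrow> real \<times> real" where
  "zpoint \<kappa> \<kappa>' h t =
     (sqrt \<kappa> * real h + sqrt \<kappa>' * t - sqrt \<kappa> / (\<kappa> + \<kappa>'),
      sqrt \<kappa>' * real h - sqrt \<kappa> * t - sqrt \<kappa>' / (\<kappa> + \<kappa>'))"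

text \<open>
  The integral formula is required for every Borel function for which the integral makes sense:
  nonnegative ones (both sides possibly infinite) and integrable ones. The first clause, applied to
  the absolute value, shows that the integrals and the series in the second converge absolutely.
\<close>

definition law_mixed :: "real \<Rightarrow> real \<Rightarrow> (real \<times> real) measure \<Rightarrow> bool" where
  "law_mixed \<kappa> \<kappa>' L \<longleftrightarrow> borel_prob L \<and>
     (let \<omega> = \<kappa> + \<kappa>' in
       (\<forall>\<gamma> :: real \<times> real \<Rightarrow> ennreal. \<gamma> \<in> borel_measurable borel \<longrightarrow>
          (\<integral>\<^sup>+z. \<gamma> z \<partial>L) =
            ennreal (sqrt (\<omega> / (2 * pi)) * exp (- 1 / \<omega>)) *
            (\<Sum>h. ennreal ((1 / \<omega>) ^ h * (1 / fact h)) *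
                 (\<integral>\<^sup>+t. \<gamma> (zpoint \<kappa> \<kappa>' h t) * ennreal (exp (- \<omega> * t\<^sup>2 / 2)) \<partial>lborel))) \<and>
       (\<forall>\<gamma> :: real \<times> real \<Rightarrow> real. \<gamma> \<in> borel_measurable borel \<and> integrable L \<gamma> \<longrightarrow>
          (\<integral>z. \<gamma> z \<partial>L) =
            sqrt (\<omega> / (2 * pi)) * exp (- 1 / \<omega>) *
            (\<Sum>h. (1 / \<omega>) ^ h * (1 / fact h) *
                 (\<integral>t. \<gamma> (zpoint \<kappa> \<kappa>' h t) * exp (- \<omega> * t\<^sup>2 / 2) \<partial>lborel))))"

definition std_gaussian2 :: "(real \<times> real) measure" where
  "std_gaussian2 = std_normal_distribution \<Otimes>\<^sub>M std_normal_distribution"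

definition exactly_one :: "bool list \<Rightarrow> bool" where
  "exactly_one Ps \<longleftrightarrow> (\<exists>!i. i < length Ps \<and> Ps ! i)"

end

theory Submission
  imports Defs "HOL-Library.Ramsey"
begin

text \<open>
  A strongly regular graph has a basis of common eigenvectors of \<open>A\<close> and its complement, and products
  of these diagonalise the Cartesian powers. So \<open>\<nu>\<^sub>n\<close> is the law of a normalised sum of \<open>n\<close> independent
  copies of a random pair with only three values: \<open>(k, k')\<close>, \<open>(r, -1-r)\<close>, \<open>(s, -1-s)\<close>, taken with
  probabilities \<open>1/v\<close>, \<open>f/v\<close>, \<open>g/v\<close>, where \<open>f\<close>, \<open>g\<close> are the multiplicities of \<open>r\<close>, \<open>s\<close>. The pair is centred with diagonal covariance, so the logarithm of
  the characteristic function tends to the limit of \<open>(n/v) \<Sum> (exp (i\<xi>) - 1 - i\<xi>)\<close> over the spectrum: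
  a value \<open>\<xi>\<close> that stays away from 0 contributes a Poisson part, and those tending to 0 a Gaussian part.

  If \<open>\<sigma> < 0\<close>, the trace identities bound \<open>g\<close> and \<open>r\<close>, whence \<open>\<rho> = 0\<close>. The projection to the
  \<open>s\<close>-eigenspace is a Gram matrix of rank \<open>g\<close> with negative entries at edges; this bounds the cliques,
  and, if \<open>r > 0\<close>, also the cocliques. By Ramsey's theorem \<open>r = 0\<close> for large \<open>v\<close>, that is,
  non-adjacent vertices have the same neighbours. The case \<open>\<rho> > 0\<close> follows by complementation.
\<close>

section \<open>Weak convergence in the plane from characteristic functions\<close>

text \<open>Tightness comes for free: each coordinate of \<open>\<nu>\<^sub>n\<close> has second
  moment exactly 1, so Chebyshev's inequality bounds the tails uniformly and characteristic
  functions decide weak convergence. The exact variance also governs the error terms. The number of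
  eigenvalues grows with n, and \<open>n / v\<close> is unbounded when \<open>v / n\<close> tends to
  0, so remainders cannot be estimated value by value; they are compared with the total variance
  \<open>a\<^sup>2 + b\<^sup>2\<close>.

  In the structural part the trace identities leave \<open>r\<close> bounded, not zero. A bounded
  \<open>r\<close> together with \<kappa>' > 0 keeps the clique bound bounded, and cocliques are
  bounded by the rank \<open>g\<close>, while \<open>v\<close> tends to infinity; this is the
  contradiction that Ramsey's theorem produces from r > 0.

  The analytic part speaks of numerical sequences only, so that complementing is a change of
  parameters: \<open>r\<close>, \<open>s\<close> become \<open>- 1 - s\<close>,
  \<open>- 1 - r\<close>, and the multiplicities and coordinates are exchanged. Division by
  \<open>sqrt 0\<close> returns 0, which is the correct limit when \<kappa> or \<kappa>' vanishes,
  so degenerate valencies share the general formulas.\<close>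

inductive trig_poly :: "(real \<times> real \<Rightarrow> complex) \<Rightarrow> bool" where
  wave: "trig_poly (\<lambda>z. c * iexp (w \<bullet> z))"
| add: "trig_poly p \<Longrightarrow> trig_poly q \<Longrightarrow> trig_poly (\<lambda>z. p z + q z)"

lemma trig_poly_const: "trig_poly (\<lambda>z. c)"
  using trig_poly.wave[of c 0] by simp

text \<open>Frequencies add, so finite sums of waves form an algebra; this is the closure under
  products that Stone-Weierstrass asks for.\<close>

lemma trig_poly_mult:
  assumes "trig_poly p" "trig_poly q"
  shows "trig_poly (\<lambda>z. p z * q z)"
  using assms(1)
proof induction
  case (wave c w)
  from assms(2) show ?case
  proof induction
    case (wave c' w')
    have "(\<lambda>z. c * iexp (w \<bullet> z) * (c' * iexp (w' \<bullet> z))) = (\<lambda>z. (c * c') * iexp ((w + w') \<bullet> z))"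
      by (simp add: inner_add_left algebra_simps exp_add)
    then show ?case by (simp only: trig_poly.wave)
  next
    case (add p q)
    then show ?case using trig_poly.add by (simp add: algebra_simps)
  qed
next
  case (add p p')
  then show ?case using trig_poly.add by (simp add: algebra_simps)
qed

lemma trig_poly_cos: "trig_poly (\<lambda>z. complex_of_real (cos (w \<bullet> z)))"
proof -
  have "(\<lambda>z. complex_of_real (cos (w \<bullet> z))) = (\<lambda>z. (1/2) * iexp (w \<bullet> z) + (1/2) * iexp ((-w) \<bullet> z))"
    by (auto simp: fun_eq_iff complex_eq_iff Re_exp Im_exp)
  then show ?thesis by (simp only: trig_poly.intros)
qed

lemma trig_poly_sin: "trig_poly (\<lambda>z. complex_of_real (sin (w \<bullet> z)))"
proof -
  have "(\<lambda>z. complex_of_real (sin (w \<bullet> z))) = (\<lambda>z. (-\<i>/2) * iexp (w \<bullet> z) + (\<i>/2) * iexp ((-w) \<bullet> z))"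
    by (auto simp: fun_eq_iff complex_eq_iff Re_exp Im_exp)
  then show ?thesis by (simp only: trig_poly.intros)
qed

lemma iexp_inner_measurable [measurable]: "(\<lambda>z::real \<times> real. iexp (w \<bullet> z)) \<in> borel_measurable borel"
  by (intro borel_measurable_continuous_onI continuous_intros)

lemma integrable_iexp_inner:
  assumes "borel_prob M" shows "integrable M (\<lambda>z::real \<times> real. iexp (w \<bullet> z))"
proof -
  interpret prob_space M using assms by (simp add: borel_prob_def)
  have [measurable_cong]: "sets M = sets borel" using assms by (simp add: borel_prob_def)
  show ?thesis
    by (rule integrable_const_bound[where B=1]) (auto simp: norm_exp_eq_Re)
qed

lemma integrable_trig_poly:
  assumes "trig_poly p" "borel_prob M" shows "integrable M p"
  using assms(1) by induction (auto intro!: integrable_iexp_inner assms(2))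

text \<open>Linearity carries convergence from single waves to finite sums. The \<open>M i\<close>
  are assumed to be probability laws only eventually, because the measures of the theorem are
  prescribed only on the index set \<open>N\<close>.\<close>

lemma tendsto_integral_trig_poly:
  assumes "trig_poly p" and "\<forall>\<^sub>F i in F. borel_prob (M i)" "borel_prob L"
    and char: "\<And>w. ((\<lambda>i. \<integral>z. iexp (w \<bullet> z) \<partial>M i) \<longlongrightarrow> (\<integral>z. iexp (w \<bullet> z) \<partial>L)) F"
  shows "((\<lambda>i. \<integral>z. p z \<partial>M i) \<longlongrightarrow> (\<integral>z. p z \<partial>L)) F"
  using assms(1)
proof induction
  case (wave c w)
  show ?case by (simp add: tendsto_mult[OF tendsto_const char])
next
  case (add p q)
  have "\<forall>\<^sub>F i in F. (\<integral>z. p z \<partial>M i) + (\<integral>z. q z \<partial>M i) = (\<integral>z. p z + q z \<partial>M i)"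
    using assms(2) by eventually_elim (simp add: integrable_trig_poly add)
  moreover have "(\<integral>z. p z + q z \<partial>L) = (\<integral>z. p z \<partial>L) + (\<integral>z. q z \<partial>L)"
    by (simp add: integrable_trig_poly add assms)
  ultimately show ?case
    using tendsto_add[OF add.IH] by (auto intro: Lim_transform_eventually)
qed

text \<open>The ball is wrapped injectively onto a closed piece of the torus, so that the approximating
  trigonometric polynomial is bounded on the whole plane and not only on the ball.\<close>

lemma trig_poly_approx:
  fixes f :: "real \<times> real \<Rightarrow> real"
  assumes f: "continuous_on UNIV f" "\<And>z. \<bar>f z\<bar> \<le> B" and "R > 0" "e > 0"
  obtains g where "trig_poly (\<lambda>z. complex_of_real (g z))" "\<And>z. \<bar>g z\<bar> \<le> B + e"
    "\<And>z. norm z \<le> R \<Longrightarrow> \<bar>f z - g z\<bar> \<le> e"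
proof -
  \<comment> \<open>Dividing by \<open>R\<close> puts the angles of the ball into [-1, 1], strictly
    between -\<pi> and \<pi>, where \<open>Arg\<close> inverts \<open>cis\<close>; so
    \<open>h\<close> is \<open>f\<close> read off from the torus.\<close>
  define emb :: "real \<times> real \<Rightarrow> complex \<times> complex" where "emb z = (cis (fst z / R), cis (snd z / R))" for z
  define h where "h u = f (R * Arg (fst u), R * Arg (snd u))" for u :: "complex \<times> complex"
  define K where "K = emb ` cball 0 R"
  have emb: "continuous_on A emb" for A
    unfolding emb_def using \<open>R > 0\<close> by (intro continuous_intros) auto
  have "compact K" unfolding K_def by (intro compact_continuous_image emb) auto
  have le: "\<bar>fst z / R\<bar> \<le> 1" "\<bar>snd z / R\<bar> \<le> 1" if "norm z \<le> R" for z :: "real \<times> real"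
    using norm_fst_le[of "fst z" "snd z"] norm_snd_le[of "snd z" "fst z"] that \<open>R > 0\<close>
    by (auto simp: field_simps)
  have Arg: "Arg (cis (fst z / R)) = fst z / R" "Arg (cis (snd z / R)) = snd z / R"
    if "norm z \<le> R" for z
  proof -
    have "- pi < fst z / R" "fst z / R \<le> pi" "- pi < snd z / R" "snd z / R \<le> pi"
      using le[OF that] pi_gt3 by linarith+
    then show "Arg (cis (fst z / R)) = fst z / R" "Arg (cis (snd z / R)) = snd z / R"
      by (auto intro!: Arg_cis)
  qed
  have h_emb: "h (emb z) = f z" if "norm z \<le> R" for z
    using Arg[OF that] \<open>R > 0\<close> by (simp add: h_def emb_def)
  have cospos: "cos t > 0" if "\<bar>t\<bar> \<le> 1" for t :: real
    using that pi_gt3 by (intro cos_gt_zero_pi) auto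
  \<comment> \<open>Angles of modulus at most 1 have positive cosine, so \<open>K\<close> stays away
    from the negative real axis, where \<open>Arg\<close> jumps.\<close>
  have off: "fst u \<notin> \<real>\<^sub>\<le>\<^sub>0" "snd u \<notin> \<real>\<^sub>\<le>\<^sub>0" if "u \<in> K" for u
    using that le cospos unfolding K_def emb_def complex_nonpos_Reals_iff
    by (auto simp: not_le dest: order.strict_implies_not_eq)
  have "continuous_on K (\<lambda>u. Arg (fst u))" "continuous_on K (\<lambda>u. Arg (snd u))"
    by (rule continuous_on_compose2[OF continuous_on_Arg, of K]; force intro!: continuous_intros dest: off)+
  then have "continuous_on K h"
    unfolding h_def by (intro continuous_on_compose2[OF f(1)] continuous_on_Pair continuous_on_mult continuous_on_const) auto
  have "B \<ge> 0" using f(2)[of 0] by linarith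
  have "closedin (top_of_set UNIV) K" using compact_imp_closed[OF \<open>compact K\<close>] by simp
  \<comment> \<open>The Tietze extension keeps the bound \<open>B\<close> and is defined on the
    whole torus; an approximation within \<open>e\<close> there is bounded by \<open>B + e\<close>
    at every \<open>emb z\<close>, also for \<open>z\<close> outside the ball.\<close>
  obtain g0 where g0: "continuous_on UNIV g0" "\<And>u. u \<in> K \<Longrightarrow> g0 u = h u" "\<And>u. norm (g0 u) \<le> B"
    by (rule Tietze[OF \<open>continuous_on K h\<close> \<open>closedin _ K\<close> \<open>B \<ge> 0\<close>]) (auto simp: h_def f(2))
  define S where "S = sphere (0::complex) 1 \<times> sphere (0::complex) 1"
  have embS: "emb z \<in> S" for z by (simp add: S_def emb_def)
  \<comment> \<open>The algebra for Stone-Weierstrass: functions continuous on the torus that become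
    trigonometric polynomials after \<open>emb\<close>. Real and imaginary parts of the two
    components separate its points.\<close>
  define P where "P g \<longleftrightarrow> continuous_on S g \<and> trig_poly (\<lambda>z. complex_of_real (g (emb z)))" for g
  have base: "P (\<lambda>u. Re (fst u))" "P (\<lambda>u. Im (fst u))" "P (\<lambda>u. Re (snd u))" "P (\<lambda>u. Im (snd u))"
    unfolding P_def emb_def
    using trig_poly_cos[of "(1/R, 0)"] trig_poly_sin[of "(1/R, 0)"]
      trig_poly_cos[of "(0, 1/R)"] trig_poly_sin[of "(0, 1/R)"]
    by (auto intro!: continuous_intros simp: inner_prod_def)
  have "\<exists>g. P g \<and> (\<forall>u\<in>S. \<bar>g0 u - g u\<bar> < e)"
  proof (rule Stone_Weierstrass_HOL)
    show "compact S" unfolding S_def by (intro compact_Times) auto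
    show "P (\<lambda>u. c)" for c by (simp add: P_def trig_poly_const)
    show "\<exists>f. P f \<and> f x \<noteq> f y" if "x \<in> S \<and> y \<in> S \<and> x \<noteq> y" for x y
      using that base by (metis complex_eq_iff prod_eq_iff)
  qed (use g0 \<open>e > 0\<close> in \<open>auto simp: P_def intro: trig_poly.add trig_poly_mult continuous_intros continuous_on_subset\<close>)
  then obtain g1 where g1: "P g1" "\<And>u. u \<in> S \<Longrightarrow> \<bar>g0 u - g1 u\<bar> < e" by blast
  show thesis
  proof (rule that[of "\<lambda>z. g1 (emb z)"])
    show "trig_poly (\<lambda>z. complex_of_real (g1 (emb z)))" using g1 by (simp add: P_def)
    show "\<bar>g1 (emb z)\<bar> \<le> B + e" for z
      using g1(2)[OF embS[of z]] g0(3)[of "emb z"] by simp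
    show "\<bar>f z - g1 (emb z)\<bar> \<le> e" if "norm z \<le> R" for z
    proof -
      have "g0 (emb z) = f z" using that h_emb g0(2)[of "emb z"] by (simp add: K_def)
      then show ?thesis using g1(2)[OF embS[of z]] by simp
    qed
  qed
qed

lemma borel_prob_tight:
  fixes L :: "(real \<times> real) measure"
  assumes "borel_prob L" "e > 0"
  obtains R where "R > 0" "measure L {z. norm z > R} \<le> e"
proof -
  interpret prob_space L using assms by (simp add: borel_prob_def)
  have [measurable_cong]: "sets L = sets borel" using assms by (simp add: borel_prob_def)
  have "(\<lambda>n. measure L {z. norm z > real n}) \<longlonglongrightarrow> measure L (\<Inter>n. {z. norm z > real n})"
    by (intro finite_Lim_measure_decseq) (auto simp: decseq_def intro: le_less_trans)
  moreover have "(\<Inter>n. {z::real \<times> real. norm z > real n}) = {}"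
    by auto (meson linorder_not_le real_arch_simple)
  ultimately have "(\<lambda>n. measure L {z. norm z > real n}) \<longlonglongrightarrow> 0" by simp
  then have "\<forall>\<^sub>F n in sequentially. measure L {z. norm z > real n} < e"
    using \<open>e > 0\<close> by (rule order_tendstoD(2))
  then have "\<forall>\<^sub>F n in sequentially. measure L {z. norm z > real n} < e \<and> n > 0"
    using eventually_gt_at_top[of 0] by eventually_elim auto
  then obtain n where "measure L {z. norm z > real n} < e" "n > 0"
    using eventually_happens by fastforce
  then show thesis by (intro that[of "real n"]) auto
qed

text \<open>On the ball the difference is at most \<open>e\<close>; outside, the two global bounds
  add up to \<open>2 * B + e\<close>, which is weighted only by the tail.\<close>

lemma integral_approx:
  fixes f g :: "real \<times> real \<Rightarrow> real"
  assumes M: "borel_prob M" and f: "continuous_on UNIV f" "\<And>z. \<bar>f z\<bar> \<le> B"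
    and g: "trig_poly (\<lambda>z. complex_of_real (g z))" "\<And>z. \<bar>g z\<bar> \<le> B + e"
      "\<And>z. norm z \<le> R \<Longrightarrow> \<bar>f z - g z\<bar> \<le> e" and "e > 0"
  shows "\<bar>(\<integral>z. f z \<partial>M) - (\<integral>z. g z \<partial>M)\<bar> \<le> e + (2 * B + e) * measure M {z. norm z > R}"
proof -
  interpret prob_space M using M by (simp add: borel_prob_def)
  have [measurable_cong]: "sets M = sets borel" using M by (simp add: borel_prob_def)
  have sp: "space M = UNIV" using sets_eq_imp_space_eq[OF \<open>sets M = sets borel\<close>] by simp
  have [measurable]: "f \<in> borel_measurable borel" by (rule borel_measurable_continuous_onI[OF f(1)])
  have if_: "integrable M f" by (rule integrable_const_bound[where B=B]) (auto simp: f)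
  have ig: "integrable M g" using integrable_bounded_linear[OF bounded_linear_Re integrable_trig_poly[OF g(1) M]] by simp
  have "\<bar>(\<integral>z. f z \<partial>M) - (\<integral>z. g z \<partial>M)\<bar> = \<bar>\<integral>z. f z - g z \<partial>M\<bar>" using if_ ig by simp
  also have "\<dots> \<le> (\<integral>z. \<bar>f z - g z\<bar> \<partial>M)" by (rule integral_abs_bound)
  also have "\<dots> \<le> (\<integral>z. e + (2 * B + e) * indicator {z. norm z > R} z \<partial>M)"
  proof (rule integral_mono)
    show "\<bar>f z - g z\<bar> \<le> e + (2 * B + e) * indicator {z. norm z > R} z" for z
      using f(2)[of z] g(2)[of z] g(3)[of z] \<open>e > 0\<close> by (auto simp: indicator_def)
  qed (use if_ ig in \<open>auto simp: emeasure_eq_measure\<close>)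
  also have "\<dots> = e + (2 * B + e) * measure M {z. norm z > R}"
    using prob_space unfolding sp by (simp add: emeasure_eq_measure sp)
  finally show ?thesis .
qed

text \<open>The part of Levy's continuity theorem for the plane in which the limit law is known:
  convergence holds for trigonometric polynomials by linearity, and tightness allows a bounded
  continuous \<open>f\<close> to be replaced by one of them.\<close>

lemma weak_conv_alongI_char:
  fixes M :: "'i \<Rightarrow> (real \<times> real) measure"
  assumes M: "\<forall>\<^sub>F i in F. borel_prob (M i)" and L: "borel_prob L"
    and tight: "\<And>e. e > 0 \<Longrightarrow> \<exists>R. \<forall>\<^sub>F i in F. measure (M i) {z. norm z > R} \<le> e"
    and char: "\<And>w. ((\<lambda>i. \<integral>z. iexp (w \<bullet> z) \<partial>M i) \<longlongrightarrow> (\<integral>z. iexp (w \<bullet> z) \<partial>L)) F"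
  shows "weak_conv_along M L F"
  unfolding weak_conv_along_def
proof (intro allI impI tendstoI)
  fix f :: "real \<times> real \<Rightarrow> real" and \<epsilon> :: real
  assume f: "continuous_on UNIV f \<and> bounded (range f)" and "\<epsilon> > 0"
  from f obtain B where B: "\<And>z. \<bar>f z\<bar> \<le> B" by (auto simp: bounded_iff)
  have "B \<ge> 0" using B[of 0] by linarith
  \<comment> \<open>Replacing \<open>f\<close> by \<open>g\<close> costs \<open>2 * e\<close> on
    each side and the convergence for \<open>g\<close> costs \<open>e\<close>, five sixths of
    \<epsilon> in total. Below, \<open>d\<close> is the tail mass whose weighted contribution is
    exactly \<open>e\<close>.\<close>
  define e where "e = \<epsilon> / 6"
  have "e > 0" using \<open>\<epsilon> > 0\<close> by (simp add: e_def)
  define d where "d = e / (2 * B + e)"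
  have "d > 0" and d: "(2 * B + e) * d = e" using \<open>e > 0\<close> \<open>B \<ge> 0\<close> by (auto simp: d_def)
  obtain R1 where R1: "\<forall>\<^sub>F i in F. measure (M i) {z. norm z > R1} \<le> d"
    using tight[OF \<open>d > 0\<close>] by blast
  obtain R2 where R2: "R2 > 0" "measure L {z. norm z > R2} \<le> d"
    by (rule borel_prob_tight[OF L \<open>d > 0\<close>])
  define R where "R = max R1 R2"
  have "R > 0" using R2 by (simp add: R_def)
  have mono: "measure A {z. norm z > R} \<le> measure A {z. norm z > R'}"
    if "borel_prob A" "R' \<le> R" for A :: "(real \<times> real) measure" and R'
  proof -
    interpret prob_space A using that by (simp add: borel_prob_def)
    have [measurable_cong]: "sets A = sets borel" using that by (simp add: borel_prob_def)
    have "{z. norm z > R'} \<in> sets A" unfolding \<open>sets A = sets borel\<close>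
      by (intro borel_open open_Collect_less continuous_intros)
    then show ?thesis using that by (intro finite_measure_mono) auto
  qed
  obtain g where g: "trig_poly (\<lambda>z. complex_of_real (g z))" "\<And>z. \<bar>g z\<bar> \<le> B + e"
    "\<And>z. norm z \<le> R \<Longrightarrow> \<bar>f z - g z\<bar> \<le> e"
    using trig_poly_approx[of f B R e] f B \<open>R > 0\<close> \<open>e > 0\<close> by blast
  have bound: "\<bar>(\<integral>z. f z \<partial>A) - (\<integral>z. g z \<partial>A)\<bar> \<le> 2 * e"
    if "borel_prob A" "measure A {z. norm z > R} \<le> d" for A
  proof -
    have "\<bar>(\<integral>z. f z \<partial>A) - (\<integral>z. g z \<partial>A)\<bar> \<le> e + (2 * B + e) * measure A {z. norm z > R}"
      by (rule integral_approx[OF that(1) _ B g \<open>e > 0\<close>]) (use f in auto)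
    also have "(2 * B + e) * measure A {z. norm z > R} \<le> (2 * B + e) * d"
      using \<open>B \<ge> 0\<close> \<open>e > 0\<close> by (intro mult_left_mono that) auto
    finally show ?thesis using d by simp
  qed
  have "((\<lambda>i. \<integral>z. complex_of_real (g z) \<partial>M i) \<longlongrightarrow> (\<integral>z. complex_of_real (g z) \<partial>L)) F"
    by (rule tendsto_integral_trig_poly[OF g(1) M L char])
  then have "((\<lambda>i. \<integral>z. g z \<partial>M i) \<longlongrightarrow> (\<integral>z. g z \<partial>L)) F"
    by (simp add: tendsto_of_real_iff)
  then have "\<forall>\<^sub>F i in F. dist (\<integral>z. g z \<partial>M i) (\<integral>z. g z \<partial>L) < e"
    using \<open>e > 0\<close> by (rule tendstoD)
  then show "\<forall>\<^sub>F i in F. dist (\<integral>z. f z \<partial>M i) (\<integral>z. f z \<partial>L) < \<epsilon>"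
    using M R1
  proof eventually_elim
    case (elim i)
    have "\<bar>(\<integral>z. f z \<partial>M i) - (\<integral>z. g z \<partial>M i)\<bar> \<le> 2 * e"
      using elim mono[of "M i" R1] by (intro bound) (auto simp: R_def)
    moreover have "\<bar>(\<integral>z. f z \<partial>L) - (\<integral>z. g z \<partial>L)\<bar> \<le> 2 * e"
      using R2 L mono[of L R2] by (intro bound) (auto simp: R_def)
    ultimately show ?case using elim unfolding dist_real_def e_def by linarith
  qed
qed

section \<open>The limit laws\<close>

text \<open>\<open>\<phi> n\<close> is compared with \<open>exp (\<phi> n - 1)\<close>. Both lie in
  the closed unit disc, so their n-th powers differ by at most n times their distance, which is
  quadratic in \<open>\<phi> n - 1\<close> and hence of order \<open>1 / n\<^sup>2\<close>. No
  branch of the logarithm has to be chosen.\<close>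

lemma tendsto_power_exp:
  fixes \<phi> :: "nat \<Rightarrow> complex"
  assumes F: "filterlim real at_top F" and le: "\<forall>\<^sub>F n in F. norm (\<phi> n) \<le> 1"
    and lim: "((\<lambda>n. of_nat n * (\<phi> n - 1)) \<longlongrightarrow> z) F"
  shows "((\<lambda>n. \<phi> n ^ n) \<longlongrightarrow> exp z) F"
proof -
  define c where "c n = of_nat n * (\<phi> n - 1)" for n
  have c: "(c \<longlongrightarrow> z) F" using lim by (simp add: c_def[abs_def])
  have pos: "\<forall>\<^sub>F n in F. n > 0"
    using filterlim_at_top_dense[THEN iffD1, OF F, rule_format, of 0] by eventually_elim simp
  have small: "((\<lambda>n. norm (c n) ^ 2 / real n) \<longlongrightarrow> 0) F"
    by (intro real_tendsto_divide_at_top[where c="norm z ^ 2"] F tendsto_intros c)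
  have "((\<lambda>n. norm (c n) / real n) \<longlongrightarrow> 0) F"
    by (intro real_tendsto_divide_at_top[where c="norm z"] F tendsto_intros c)
  then have "\<forall>\<^sub>F n in F. norm (c n) / real n < 1" by (rule order_tendstoD) simp
  then have "\<forall>\<^sub>F n in F. norm (\<phi> n ^ n - exp (c n)) \<le> exp 1 * (norm (c n) ^ 2 / real n)"
    using pos le
  proof eventually_elim
    case (elim n)
    define w where "w = c n / of_nat n"
    have \<phi>: "\<phi> n = 1 + w" and cw: "c n = of_nat n * w"
      using elim by (simp_all add: w_def c_def)
    have nw: "norm w = norm (c n) / real n" by (simp add: w_def norm_divide)
    have "\<bar>Re w\<bar> \<le> 1" using abs_Re_le_cmod[of w] elim(1) nw by linarith
    \<comment> \<open>\<open>1 + w\<close> lies in the unit disc, so its real part is at most 1;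
      this places \<open>exp w\<close> in the unit disc as well.\<close>
    have "Re w \<le> 0" using elim(3) \<phi> complex_Re_le_cmod[of "1 + w"] by simp
    have "norm (\<phi> n ^ n - exp w ^ n) \<le> real n * norm (\<phi> n - exp w)"
      using \<open>Re w \<le> 0\<close> elim by (intro norm_power_diff) auto
    also have "norm (\<phi> n - exp w) = norm (exp w - (\<Sum>k\<le>1. w ^ k / fact k))"
      by (subst norm_minus_commute) (simp add: \<phi>)
    also have "\<dots> \<le> exp \<bar>Re w\<bar> * norm w ^ 2"
      using Taylor_exp[of w 1] by (simp add: power2_eq_square)
    also have "\<dots> \<le> exp 1 * norm w ^ 2"
      using \<open>\<bar>Re w\<bar> \<le> 1\<close> by (intro mult_right_mono) auto
    also have "real n * (exp 1 * norm w ^ 2) = exp 1 * (norm (c n) ^ 2 / real n)"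
      using elim by (simp add: nw power2_eq_square field_simps)
    finally show ?case by (simp add: cw exp_of_nat_mult mult_left_mono)
  qed
  moreover have "((\<lambda>n. exp 1 * (norm (c n) ^ 2 / real n)) \<longlongrightarrow> 0) F"
    using tendsto_mult_right_zero[OF small] by simp
  ultimately have "((\<lambda>n. \<phi> n ^ n - exp (c n)) \<longlongrightarrow> 0) F"
    by (rule Lim_null_comparison)
  from tendsto_add[OF this tendsto_exp[OF c]] show ?thesis by simp
qed

lemma borel_prob_distr:
  assumes "prob_space M" "f \<in> borel_measurable M"
  shows "borel_prob (distr M borel f)"
  using assms by (simp add: borel_prob_def prob_space.prob_space_distr)

text \<open>Each limit law is, up to a swap of the coordinates, the image of two independent real
  variables laid along directions \<open>p\<close> and \<open>q\<close> and shifted by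
  \<open>c\<close>; independence factors the transform.\<close>

lemma char_affine_pair:
  fixes p q c w :: "real \<times> real"
  assumes "prob_space M1" "prob_space M2"
    and [measurable]: "X \<in> borel_measurable M1" "Y \<in> borel_measurable M2"
  shows "(\<integral>z. iexp (w \<bullet> z) \<partial>distr (M1 \<Otimes>\<^sub>M M2) borel (\<lambda>(x, y). X x *\<^sub>R p + Y y *\<^sub>R q + c)) =
    (\<integral>x. iexp ((w \<bullet> p) * X x) \<partial>M1) * (\<integral>y. iexp ((w \<bullet> q) * Y y) \<partial>M2) * iexp (w \<bullet> c)"
proof -
  interpret M1: prob_space M1 by fact
  interpret M2: prob_space M2 by fact
  interpret pair_prob_space M1 M2 ..
  have "(\<integral>z. iexp (w \<bullet> z) \<partial>distr (M1 \<Otimes>\<^sub>M M2) borel (\<lambda>(x, y). X x *\<^sub>R p + Y y *\<^sub>R q + c)) =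
    (\<integral>u. iexp ((w \<bullet> p) * X (fst u)) * iexp ((w \<bullet> q) * Y (snd u)) * iexp (w \<bullet> c) \<partial>(M1 \<Otimes>\<^sub>M M2))"
    by (subst integral_distr)
       (auto intro!: Bochner_Integration.integral_cong simp: inner_add_right exp_add algebra_simps split_beta)
  also have "\<dots> = (\<integral>u. iexp ((w \<bullet> p) * X (fst u)) * iexp ((w \<bullet> q) * Y (snd u)) \<partial>(M1 \<Otimes>\<^sub>M M2)) * iexp (w \<bullet> c)"
    by simp
  also have "(\<integral>u. iexp ((w \<bullet> p) * X (fst u)) * iexp ((w \<bullet> q) * Y (snd u)) \<partial>(M1 \<Otimes>\<^sub>M M2)) =
    (\<integral>x. \<integral>y. iexp ((w \<bullet> p) * X x) * iexp ((w \<bullet> q) * Y y) \<partial>M2 \<partial>M1)"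
    by (subst integral_fst'[symmetric])
       (auto intro!: P.integrable_const_bound[where B=1] simp: norm_mult)
  also have "\<dots> = (\<integral>x. iexp ((w \<bullet> p) * X x) \<partial>M1) * (\<integral>y. iexp ((w \<bullet> q) * Y y) \<partial>M2)"
    by simp
  finally show ?thesis .
qed

lemma integral_measure_pmf_nat_sums:
  fixes f :: "nat \<Rightarrow> 'b::{banach, second_countable_topology}"
  assumes "integrable (measure_pmf p) f"
  shows "(\<lambda>j. pmf p j *\<^sub>R f j) sums (\<integral>j. f j \<partial>measure_pmf p)"
  using assms sums_integral_count_space_nat[of "\<lambda>j. pmf p j *\<^sub>R f j"]
  by (simp add: measure_pmf_eq_density integrable_density integral_density)

lemma char_poisson:
  assumes "r > 0"
  shows "(\<integral>j. iexp (t * real j) \<partial>measure_pmf (poisson_pmf r)) = exp (r * (iexp t - 1))"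
proof -
  have e: "complex_of_real (exp (- r)) = exp (- of_real r)"
    by (metis exp_of_real of_real_minus)
  have "(\<lambda>j. pmf (poisson_pmf r) j *\<^sub>R iexp (t * real j)) sums
      (\<integral>j. iexp (t * real j) \<partial>measure_pmf (poisson_pmf r))"
    by (intro integral_measure_pmf_nat_sums measure_pmf.integrable_const_bound[where B=1]) auto
  moreover have "pmf (poisson_pmf r) j *\<^sub>R iexp (t * real j) = exp (- of_real r) * ((r * iexp t) ^ j /\<^sub>R fact j)" for j
    using assms by (simp add: scaleR_conv_of_real power_mult_distrib exp_of_nat_mult[symmetric] field_simps
        e)
  moreover have "(\<lambda>j. exp (- of_real r) * ((r * iexp t) ^ j /\<^sub>R fact j)) sums (exp (- of_real r) * exp (r * iexp t))"
    by (intro sums_mult exp_converges)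
  ultimately have "(\<integral>j. iexp (t * real j) \<partial>measure_pmf (poisson_pmf r)) = exp (- of_real r) * exp (r * iexp t)"
    by (auto intro: sums_unique2)
  also have "\<dots> = exp (r * (iexp t - 1))"
    by (simp add: e mult_exp_exp algebra_simps)
  finally show ?thesis .
qed

section \<open>The limit laws realised by independent Poisson and normal variables\<close>

text \<open>Transform of a sum of two independent Poisson variables: intensity 1/\<omega> along
  (sqrt \<kappa>, sqrt \<kappa>'), stemming from the valency, and intensity \<kappa>/(\<omega>
  \<kappa>') along (-\<kappa>'/sqrt \<kappa>, sqrt \<kappa>'), stemming from \<open>s\<close>. The
  last term removes the mean, which lies on the second axis.\<close>

definition multipartite_char :: "real \<Rightarrow> real \<Rightarrow> real \<Rightarrow> real \<Rightarrow> complex" where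
  "multipartite_char \<kappa> \<kappa>' a b =
     exp ((1 / (\<kappa> + \<kappa>')) * (iexp (a * sqrt \<kappa> + b * sqrt \<kappa>') - 1) +
            (\<kappa> / ((\<kappa> + \<kappa>') * \<kappa>')) * (iexp (b * sqrt \<kappa>' - a * \<kappa>' / sqrt \<kappa>) - 1) - \<i> * (b / sqrt \<kappa>'))"

text \<open>The same first Poisson variable, now centred by itself, plus an independent centred
  Gaussian of variance 1/\<omega> along the orthogonal direction (sqrt \<kappa>', - sqrt
  \<kappa>).\<close>

definition mixed_char :: "real \<Rightarrow> real \<Rightarrow> real \<Rightarrow> real \<Rightarrow> complex" where
  "mixed_char \<kappa> \<kappa>' a b =
     exp ((1 / (\<kappa> + \<kappa>')) * (iexp (a * sqrt \<kappa> + b * sqrt \<kappa>') - 1)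
            - (a * sqrt \<kappa>' - b * sqrt \<kappa>)\<^sup>2 / (2 * (\<kappa> + \<kappa>'))
            - \<i> * ((a * sqrt \<kappa> + b * sqrt \<kappa>') / (\<kappa> + \<kappa>')))"

text \<open>\<open>L\<close> is the image of a product of two Poisson laws under an affine map that
  is injective on pairs of naturals, so each listed point carries exactly the product of two
  atoms.\<close>

lemma multipartite_law_exists:
  fixes \<kappa> \<kappa>' :: real
  assumes pos: "\<kappa> > 0" "\<kappa>' > 0"
  obtains L where "law_multipartite \<kappa> \<kappa>' L"
    "\<And>a b. (\<integral>z. iexp ((a, b) \<bullet> z) \<partial>L) = multipartite_char \<kappa> \<kappa>' a b"
proof -
  define \<omega> where "\<omega> = \<kappa> + \<kappa>'"
  have "\<omega> > 0" using pos by (simp add: \<omega>_def)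
  define A B where "A = measure_pmf (poisson_pmf (1 / \<omega>))" and "B = measure_pmf (poisson_pmf (\<kappa> / (\<omega> * \<kappa>')))"
  interpret A: prob_space A by (simp add: A_def measure_pmf.prob_space_axioms)
  interpret B: prob_space B by (simp add: B_def measure_pmf.prob_space_axioms)
  interpret pair_prob_space A B ..
  define X where "X = (\<lambda>(j::nat, h::nat). real j *\<^sub>R (sqrt \<kappa>, sqrt \<kappa>') +
     real h *\<^sub>R (- \<kappa>' / sqrt \<kappa>, sqrt \<kappa>') + (0, - 1 / sqrt \<kappa>'))"
  have X: "X (j, h) = ((\<kappa> * real j - \<kappa>' * real h) / sqrt \<kappa>, (\<kappa>' * real j + \<kappa>' * real h - 1) / sqrt \<kappa>')" for j h
    using pos by (auto simp: X_def field_simps real_sqrt_mult_self)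
  have [measurable]: "X \<in> borel_measurable (A \<Otimes>\<^sub>M B)"
    unfolding X_def A_def B_def by measurable
  have inj: "X p = X p' \<longleftrightarrow> p = p'" for p p'
  proof
    assume eq: "X p = X p'"
    obtain j h j' h' where p: "p = (j, h)" "p' = (j', h')" by (cases p, cases p')
    have 1: "\<kappa> * real j - \<kappa>' * real h = \<kappa> * real j' - \<kappa>' * real h'"
      and "\<kappa>' * real j + \<kappa>' * real h = \<kappa>' * real j' + \<kappa>' * real h'"
      using eq pos by (auto simp: p X)
    then have 2: "real j + real h = real j' + real h'"
      using pos by (simp flip: distrib_left)
    have "\<omega> * (real j - real j') = 0"
      \<comment> \<open>The first relation plus \<kappa>' times the second eliminates
        \<open>h\<close> and \<open>h'\<close>.\<close>
      using 1 2 unfolding \<omega>_def by algebra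
    then show "p = p'" using 2 \<open>\<omega> > 0\<close> by (simp add: p)
  qed simp
  define L where "L = distr (A \<Otimes>\<^sub>M B) borel X"
  have L: "borel_prob L"
    unfolding L_def by (intro borel_prob_distr) (auto intro: prob_space_axioms)
  show thesis
  proof (rule that[of L])
    show "law_multipartite \<kappa> \<kappa>' L"
      unfolding law_multipartite_def Let_def
    proof (intro conjI L allI)
      fix j h :: nat
      have vim: "X -` {X (j, h)} \<inter> space (A \<Otimes>\<^sub>M B) = {j} \<times> {h}"
        by (auto simp: inj space_pair_measure A_def B_def)
      have "measure L {X (j, h)} = measure (A \<Otimes>\<^sub>M B) ({j} \<times> {h})"
        unfolding L_def by (subst measure_distr) (auto simp: vim)
      also have "\<dots> = measure A {j} * measure B {h}"
        unfolding measure_def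
        by (subst B.emeasure_pair_measure_Times) (auto simp: A_def B_def enn2real_mult)
      also have "\<dots> = (exp (- (1 / \<omega>)) * exp (- (\<kappa> / (\<omega> * \<kappa>')))) * (1 / \<omega>) ^ j * (\<kappa> / (\<omega> * \<kappa>')) ^ h * (1 / (fact j * fact h))"
        using pos \<open>\<omega> > 0\<close> by (simp add: A_def B_def measure_pmf_single ac_simps)
      \<comment> \<open>The two intensities add up to 1/\<kappa>', because \<kappa>' + \<kappa> =
        \<omega>.\<close>
      also have "exp (- (1 / \<omega>)) * exp (- (\<kappa> / (\<omega> * \<kappa>'))) = exp (- 1 / \<kappa>')"
      proof -
        have "- (1 / \<omega>) + - (\<kappa> / (\<omega> * \<kappa>')) = - 1 / \<kappa>'"
          using pos \<open>\<omega> > 0\<close> by (simp add: divide_simps) (simp add: \<omega>_def)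
        then show ?thesis by (simp only: mult_exp_exp)
      qed
      finally show "measure L {((\<kappa> * real j - \<kappa>' * real h) / sqrt \<kappa>, (\<kappa>' * real j + \<kappa>' * real h - 1) / sqrt \<kappa>')} =
          exp (- 1 / \<kappa>') * (1 / (\<kappa> + \<kappa>')) ^ j * (\<kappa> / ((\<kappa> + \<kappa>') * \<kappa>')) ^ h * (1 / (fact j * fact h))"
        unfolding X \<omega>_def .
    qed
    fix a b
    have "(\<integral>z. iexp ((a, b) \<bullet> z) \<partial>L) =
      (\<integral>j. iexp (((a, b) \<bullet> (sqrt \<kappa>, sqrt \<kappa>')) * real j) \<partial>A) *
      (\<integral>h. iexp (((a, b) \<bullet> (- \<kappa>' / sqrt \<kappa>, sqrt \<kappa>')) * real h) \<partial>B) * iexp ((a, b) \<bullet> (0, - 1 / sqrt \<kappa>'))"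
      unfolding L_def X_def
      by (rule char_affine_pair) (auto simp: A_def B_def measure_pmf.prob_space_axioms)
    also have "\<dots> = exp ((1 / \<omega>) * (iexp (a * sqrt \<kappa> + b * sqrt \<kappa>') - 1)) *
       exp ((\<kappa> / (\<omega> * \<kappa>')) * (iexp (b * sqrt \<kappa>' - a * \<kappa>' / sqrt \<kappa>) - 1)) * exp (- \<i> * (b / sqrt \<kappa>'))"
      unfolding A_def B_def using pos \<open>\<omega> > 0\<close>
      by (subst (1 2) char_poisson) (auto simp: algebra_simps)
    finally show "(\<integral>z. iexp ((a, b) \<bullet> z) \<partial>L) = multipartite_char \<kappa> \<kappa>' a b"
      by (simp add: mult_exp_exp \<omega>_def multipartite_char_def)
  qed
qed

text \<open>Complementing exchanges \<kappa> with \<kappa>' and the two coordinates, so this law is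
  the swapped image of the multipartite one.\<close>

lemma cliques_law_exists:
  fixes \<kappa> \<kappa>' :: real
  assumes pos: "\<kappa> > 0" "\<kappa>' > 0"
  obtains L where "law_cliques \<kappa> \<kappa>' L"
    "\<And>a b. (\<integral>z. iexp ((a, b) \<bullet> z) \<partial>L) = multipartite_char \<kappa>' \<kappa> b a"
proof -
  obtain L where L: "law_multipartite \<kappa>' \<kappa> L"
    and char: "\<And>a b. (\<integral>z. iexp ((a, b) \<bullet> z) \<partial>L) = multipartite_char \<kappa>' \<kappa> a b"
    using multipartite_law_exists[OF pos(2,1)] by blast
  interpret prob_space L using L by (simp add: law_multipartite_def borel_prob_def)
  have setsL: "sets L = sets borel" using L by (simp add: law_multipartite_def borel_prob_def)
  have spL: "space L = UNIV" using sets_eq_imp_space_eq[OF setsL] by simp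
  have "(prod.swap :: real \<times> real \<Rightarrow> _) \<in> borel_measurable borel"
    by (intro borel_measurable_continuous_onI continuous_on_swap)
  then have swap[measurable]: "prod.swap \<in> borel_measurable L"
    using measurable_cong_sets[OF setsL refl] by blast
  define L' where "L' = distr L borel prod.swap"
  have "measure L' {z} = measure L {prod.swap z}" for z
  proof -
    have "prod.swap -` {z} = {prod.swap z}" by (auto simp: prod_eq_iff)
    then show ?thesis unfolding L'_def by (subst measure_distr) (auto simp: spL)
  qed
  moreover have "borel_prob L'"
    unfolding L'_def by (intro borel_prob_distr prob_space_axioms swap)
  ultimately have "law_cliques \<kappa> \<kappa>' L'"
    using L by (simp add: law_cliques_def law_multipartite_def Let_def add.commute)
  moreover have "(\<integral>z. iexp ((a, b) \<bullet> z) \<partial>L') = (\<integral>z. iexp ((b, a) \<bullet> z) \<partial>L)" for a b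
    unfolding L'_def by (subst integral_distr[OF swap iexp_inner_measurable]) (simp add: inner_prod_def add.commute)
  ultimately show thesis
    by (intro that[of L']) (auto simp: char)
qed

text \<open>\<open>L\<close> is the image under \<open>zpoint\<close> of a Poisson variable and an
  independent normal variable of variance 1/\<omega>. The nonnegative clause is Tonelli's theorem
  and the integrable clause Fubini's. One of \<kappa>, \<kappa>' may be zero, as only \<omega> is
  divided by.\<close>

lemma mixed_law_exists:
  fixes \<kappa> \<kappa>' :: real
  assumes pos: "\<kappa> \<ge> 0" "\<kappa>' \<ge> 0" "\<kappa> + \<kappa>' > 0"
  obtains L where "law_mixed \<kappa> \<kappa>' L"
    "\<And>a b. (\<integral>z. iexp ((a, b) \<bullet> z) \<partial>L) = mixed_char \<kappa> \<kappa>' a b"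
proof -
  define \<omega> where "\<omega> = \<kappa> + \<kappa>'"
  have "\<omega> > 0" using pos by (simp add: \<omega>_def)
  define A where "A = measure_pmf (poisson_pmf (1 / \<omega>))"
  define B where "B = density lborel (\<lambda>t. ennreal (normal_density 0 (1 / sqrt \<omega>) t))"
  interpret A: prob_space A by (simp add: A_def measure_pmf.prob_space_axioms)
  interpret B: prob_space B unfolding B_def using \<open>\<omega> > 0\<close> by (intro prob_space_normal_density) auto
  interpret pair_prob_space A B ..
  have [measurable_cong]: "sets B = sets borel" by (simp add: B_def)
  have nd: "normal_density 0 (1 / sqrt \<omega>) t = sqrt (\<omega> / (2 * pi)) * exp (- \<omega> * t\<^sup>2 / 2)" for t
    using \<open>\<omega> > 0\<close> by (simp add: normal_density_def power_divide real_sqrt_divide field_simps real_sqrt_mult)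
  have mA[measurable]: "real \<in> borel_measurable A" by (simp add: A_def)
  have mB: "(\<lambda>t. t) \<in> borel_measurable B" by measurable
  define X where "X = (\<lambda>(h, t). zpoint \<kappa> \<kappa>' h t)"
  have X: "X = (\<lambda>(h, t). real h *\<^sub>R (sqrt \<kappa>, sqrt \<kappa>') + t *\<^sub>R (sqrt \<kappa>', - sqrt \<kappa>) + (- sqrt \<kappa> / \<omega>, - sqrt \<kappa>' / \<omega>))"
    by (auto simp: X_def zpoint_def \<omega>_def fun_eq_iff)
  have mX[measurable]: "X \<in> borel_measurable (A \<Otimes>\<^sub>M B)"
    unfolding X by measurable
  define L where "L = distr (A \<Otimes>\<^sub>M B) borel X"
  have L: "borel_prob L"
    unfolding L_def by (intro borel_prob_distr) (auto intro: prob_space_axioms)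
  have mz: "(\<lambda>t. zpoint \<kappa> \<kappa>' h t) \<in> borel_measurable borel" for h
    unfolding zpoint_def by measurable
  show thesis
  proof (rule that[of L])
    show "law_mixed \<kappa> \<kappa>' L"
      unfolding law_mixed_def Let_def \<omega>_def[symmetric]
    proof (intro conjI L allI impI)
      fix \<gamma> :: "real \<times> real \<Rightarrow> ennreal" assume [measurable]: "\<gamma> \<in> borel_measurable borel"
      define I where "I h = (\<integral>\<^sup>+t. \<gamma> (zpoint \<kappa> \<kappa>' h t) * ennreal (exp (- \<omega> * t\<^sup>2 / 2)) \<partial>lborel)" for h
      have inner: "(\<integral>\<^sup>+t. \<gamma> (X (h, t)) \<partial>B) = ennreal (sqrt (\<omega> / (2 * pi))) * I h" for h
      proof -
        note [measurable] = mz[of h]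
        have "(\<integral>\<^sup>+t. \<gamma> (X (h, t)) \<partial>B) =
          (\<integral>\<^sup>+t. ennreal (sqrt (\<omega> / (2 * pi))) * (\<gamma> (zpoint \<kappa> \<kappa>' h t) * ennreal (exp (- \<omega> * t\<^sup>2 / 2))) \<partial>lborel)"
          unfolding B_def using \<open>\<omega> > 0\<close>
          by (subst nn_integral_density)
             (auto simp: X_def nd ennreal_mult ac_simps intro!: nn_integral_cong)
        also have "\<dots> = ennreal (sqrt (\<omega> / (2 * pi))) * I h"
          unfolding I_def by (intro nn_integral_cmult) measurable
        finally show ?thesis .
      qed
      have "(\<integral>\<^sup>+z. \<gamma> z \<partial>L) = (\<integral>\<^sup>+u. \<gamma> (X u) \<partial>(A \<Otimes>\<^sub>M B))"
        unfolding L_def by (rule nn_integral_distr) auto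
      also have "\<dots> = (\<integral>\<^sup>+h. \<integral>\<^sup>+t. \<gamma> (X (h, t)) \<partial>B \<partial>A)"
        by (rule B.nn_integral_fst[symmetric]) measurable
      also have "\<dots> = (\<Sum>h. ennreal (pmf (poisson_pmf (1 / \<omega>)) h) * (ennreal (sqrt (\<omega> / (2 * pi))) * I h))"
        unfolding inner A_def nn_integral_measure_pmf nn_integral_count_space_nat ..
      also have "\<dots> = (\<Sum>h. ennreal (sqrt (\<omega> / (2 * pi)) * exp (- 1 / \<omega>)) * (ennreal ((1 / \<omega>) ^ h * (1 / fact h)) * I h))"
      proof (intro suminf_cong)
        fix h
        have "pmf (poisson_pmf (1 / \<omega>)) h = exp (- 1 / \<omega>) * ((1 / \<omega>) ^ h * (1 / fact h))"
          using \<open>\<omega> > 0\<close> by (simp add: ac_simps)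
        moreover have "(1 / \<omega>) ^ h * (1 / fact h) \<ge> 0" using \<open>\<omega> > 0\<close> by simp
        ultimately have "ennreal (pmf (poisson_pmf (1 / \<omega>)) h) =
            ennreal (exp (- 1 / \<omega>)) * ennreal ((1 / \<omega>) ^ h * (1 / fact h))"
          by (metis ennreal_mult exp_ge_zero)
        moreover have "ennreal (sqrt (\<omega> / (2 * pi)) * exp (- 1 / \<omega>)) =
            ennreal (sqrt (\<omega> / (2 * pi))) * ennreal (exp (- 1 / \<omega>))"
          using \<open>\<omega> > 0\<close> by (intro ennreal_mult) auto
        ultimately show "ennreal (pmf (poisson_pmf (1 / \<omega>)) h) * (ennreal (sqrt (\<omega> / (2 * pi))) * I h) =
          ennreal (sqrt (\<omega> / (2 * pi)) * exp (- 1 / \<omega>)) * (ennreal ((1 / \<omega>) ^ h * (1 / fact h)) * I h)"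
          by (simp only: mult.commute mult.left_commute mult.assoc)
      qed
      finally show "(\<integral>\<^sup>+z. \<gamma> z \<partial>L) = ennreal (sqrt (\<omega> / (2 * pi)) * exp (- 1 / \<omega>)) *
            (\<Sum>h. ennreal ((1 / \<omega>) ^ h * (1 / fact h)) *
                 (\<integral>\<^sup>+t. \<gamma> (zpoint \<kappa> \<kappa>' h t) * ennreal (exp (- \<omega> * t\<^sup>2 / 2)) \<partial>lborel))"
        unfolding I_def by (simp only: ennreal_suminf_cmult)
    next
      fix \<gamma> :: "real \<times> real \<Rightarrow> real" assume \<gamma>: "\<gamma> \<in> borel_measurable borel \<and> integrable L \<gamma>"
      then have [measurable]: "\<gamma> \<in> borel_measurable borel" by simp
      define I where "I h = (\<integral>t. \<gamma> (zpoint \<kappa> \<kappa>' h t) * exp (- \<omega> * t\<^sup>2 / 2) \<partial>lborel)" for h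
      have inner: "(\<integral>t. \<gamma> (X (h, t)) \<partial>B) = sqrt (\<omega> / (2 * pi)) * I h" for h
      proof -
        note [measurable] = mz[of h]
        have "(\<integral>t. \<gamma> (X (h, t)) \<partial>B) =
          (\<integral>t. sqrt (\<omega> / (2 * pi)) * (\<gamma> (zpoint \<kappa> \<kappa>' h t) * exp (- \<omega> * t\<^sup>2 / 2)) \<partial>lborel)"
          unfolding B_def using \<open>\<omega> > 0\<close>
          by (subst integral_density)
             (auto simp: X_def nd ac_simps intro!: Bochner_Integration.integral_cong)
        then show ?thesis by (simp add: I_def)
      qed
      have int: "integrable (A \<Otimes>\<^sub>M B) (\<lambda>u. \<gamma> (X u))"
        using \<gamma> unfolding L_def by (subst (asm) integrable_distr_eq) auto
      have "integrable A (\<lambda>h. \<integral>t. \<gamma> (X (h, t)) \<partial>B)" by (rule integrable_fst'[OF int])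
      then have "(\<lambda>h. pmf (poisson_pmf (1 / \<omega>)) h *\<^sub>R (sqrt (\<omega> / (2 * pi)) * I h)) sums (\<integral>h. \<integral>t. \<gamma> (X (h, t)) \<partial>B \<partial>A)"
        unfolding A_def inner by (rule integral_measure_pmf_nat_sums)
      moreover have "(\<integral>h. \<integral>t. \<gamma> (X (h, t)) \<partial>B \<partial>A) = (\<integral>z. \<gamma> z \<partial>L)"
        unfolding L_def by (subst integral_fst'[OF int]) (rule integral_distr[symmetric], auto)
      ultimately have "(\<lambda>h. sqrt (\<omega> / (2 * pi)) * exp (- 1 / \<omega>) * ((1 / \<omega>) ^ h * (1 / fact h) * I h)) sums (\<integral>z. \<gamma> z \<partial>L)"
        using \<open>\<omega> > 0\<close> by (simp add: ac_simps)
      then have "(\<lambda>h. (1 / \<omega>) ^ h * (1 / fact h) * I h) sums ((\<integral>z. \<gamma> z \<partial>L) / (sqrt (\<omega> / (2 * pi)) * exp (- 1 / \<omega>)))"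
        by (rule sums_mult_D) (use \<open>\<omega> > 0\<close> in auto)
      then show "(\<integral>z. \<gamma> z \<partial>L) = sqrt (\<omega> / (2 * pi)) * exp (- 1 / \<omega>) *
            (\<Sum>h. (1 / \<omega>) ^ h * (1 / fact h) *
                 (\<integral>t. \<gamma> (zpoint \<kappa> \<kappa>' h t) * exp (- \<omega> * t\<^sup>2 / 2) \<partial>lborel))"
        using \<open>\<omega> > 0\<close> unfolding I_def by (simp add: sums_iff field_simps)
    qed
    \<comment> \<open>\<open>B\<close> is the law of a standard normal variable divided by sqrt
      \<omega>.\<close>
    have charB: "(\<integral>y. iexp (t * y) \<partial>B) = exp (of_real (- (t\<^sup>2) / (2 * \<omega>)))" for t
    proof -
      interpret N: real_distribution std_normal_distribution by (rule real_dist_normal_dist)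
      have "distributed std_normal_distribution lborel (\<lambda>x. 0 + (1 / sqrt \<omega>) * x)
          (\<lambda>x. ennreal (normal_density (0 + (1 / sqrt \<omega>) * 0) (\<bar>1 / sqrt \<omega>\<bar> * 1) x))"
        using \<open>\<omega> > 0\<close> by (intro N.normal_density_affine) (auto simp: distributed_def distr_id2)
      then have "B = distr std_normal_distribution lborel (\<lambda>x. x / sqrt \<omega>)"
        using \<open>\<omega> > 0\<close> by (simp add: distributed_def B_def)
      then have "(\<integral>y. iexp (t * y) \<partial>B) = char std_normal_distribution (t / sqrt \<omega>)"
        by (simp add: integral_distr char_def)
      moreover have "- ((t / sqrt \<omega>)\<^sup>2) / 2 = - (t\<^sup>2) / (2 * \<omega>)"
        using \<open>\<omega> > 0\<close> by (simp add: power_divide)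
      ultimately show ?thesis by (simp only: char_std_normal_distribution exp_of_real)
    qed
    fix a b
    have "(\<integral>z. iexp ((a, b) \<bullet> z) \<partial>L) =
      (\<integral>j. iexp (((a, b) \<bullet> (sqrt \<kappa>, sqrt \<kappa>')) * real j) \<partial>A) *
      (\<integral>t. iexp (((a, b) \<bullet> (sqrt \<kappa>', - sqrt \<kappa>)) * t) \<partial>B) * iexp ((a, b) \<bullet> (- sqrt \<kappa> / \<omega>, - sqrt \<kappa>' / \<omega>))"
      unfolding L_def X
      by (rule char_affine_pair) (auto simp: A.prob_space_axioms B.prob_space_axioms mA mB)
    also have "\<dots> = exp ((1 / \<omega>) * (iexp (a * sqrt \<kappa> + b * sqrt \<kappa>') - 1)) *
       exp (of_real (- ((a * sqrt \<kappa>' - b * sqrt \<kappa>)\<^sup>2) / (2 * \<omega>))) * exp (- \<i> * ((a * sqrt \<kappa> + b * sqrt \<kappa>') / \<omega>))"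
      unfolding charB unfolding A_def using \<open>\<omega> > 0\<close>
      by (subst char_poisson) (auto simp: add_divide_distrib algebra_simps)
    finally show "(\<integral>z. iexp ((a, b) \<bullet> z) \<partial>L) = mixed_char \<kappa> \<kappa>' a b"
      by (simp add: mult_exp_exp \<omega>_def mixed_char_def)
  qed
qed

lemma borel_prob_std_gaussian2: "borel_prob std_gaussian2"
  and char_std_gaussian2: "(\<integral>z. iexp ((a, b) \<bullet> z) \<partial>std_gaussian2) = exp (- ((a\<^sup>2 + b\<^sup>2) / 2))"
proof -
  interpret N: real_distribution std_normal_distribution by (rule real_dist_normal_dist)
  interpret pair_prob_space std_normal_distribution std_normal_distribution ..
  have s: "sets std_gaussian2 = sets borel"
    unfolding std_gaussian2_def borel_prod[symmetric] by (intro sets_pair_measure_cong) auto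
  then show "borel_prob std_gaussian2"
    unfolding borel_prob_def by (simp add: std_gaussian2_def prob_space_axioms)
  have "std_gaussian2 = distr std_gaussian2 borel (\<lambda>z. z)"
    by (rule distr_id2[symmetric]) (simp add: s)
  also have "\<dots> = distr (std_normal_distribution \<Otimes>\<^sub>M std_normal_distribution) borel
      (\<lambda>(x, y). x *\<^sub>R (1, 0) + y *\<^sub>R (0, 1) + 0)"
    unfolding std_gaussian2_def by (intro distr_cong) auto
  finally have eq: "std_gaussian2 = \<dots>" .
  have "(\<integral>z. iexp ((a, b) \<bullet> z) \<partial>std_gaussian2) =
     (\<integral>x. iexp (((a, b) \<bullet> (1, 0)) * x) \<partial>std_normal_distribution) *
     (\<integral>x. iexp (((a, b) \<bullet> (0, 1)) * x) \<partial>std_normal_distribution) * iexp ((a, b) \<bullet> (0::real \<times> real))"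
    by (subst eq) (rule char_affine_pair, auto simp: N.prob_space_axioms)
  also have "\<dots> = char std_normal_distribution a * char std_normal_distribution b"
    by (simp add: char_def)
  finally show "(\<integral>z. iexp ((a, b) \<bullet> z) \<partial>std_gaussian2) = exp (- ((a\<^sup>2 + b\<^sup>2) / 2))"
    by (simp add: char_std_normal_distribution add_divide_distrib flip: of_real_mult exp_add)
qed

section \<open>Diagonalisation of Cartesian powers\<close>

abbreviation words :: "nat \<Rightarrow> 'a set \<Rightarrow> 'a list set" where
  "words n A \<equiv> {xs. set xs \<subseteq> A \<and> length xs = n}"

lemma sum_words_Suc: "(\<Sum>xs\<in>words (Suc n) A. f xs) = (\<Sum>x\<in>A. \<Sum>xs\<in>words n A. f (x # xs))"
proof -
  have "(\<Sum>xs\<in>words (Suc n) A. f xs) = (\<Sum>(xs, x)\<in>words n A \<times> A. f (x # xs))"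
    unfolding lists_length_Suc_eq
    by (subst sum.reindex) (auto simp: inj_on_def split_beta)
  then show ?thesis
    by (simp add: sum.cartesian_product[symmetric] sum.swap[of _ A])
qed

lemma words_0: "words 0 A = {[]}"
  by auto

text \<open>Distributivity, in the role of independence: it turns the transform for the Cartesian
  power into the n-th power of the transform for one factor.\<close>

lemma sum_words_prod:
  fixes f :: "'a \<Rightarrow> 'b::comm_semiring_1"
  shows "(\<Sum>xs\<in>words n A. prod_list (map f xs)) = (\<Sum>x\<in>A. f x) ^ n"
proof (induction n)
  case 0
  then show ?case by (simp add: words_0 del: length_0_conv)
next
  case (Suc n)
  then show ?case by (simp add: sum_words_Suc sum_distrib_left[symmetric] sum_distrib_right[symmetric])
qed

lemma sum_words_sum:
  fixes \<theta> :: "'a \<Rightarrow> real"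
  assumes "finite A" "(\<Sum>x\<in>A. \<theta> x) = 0"
  shows "(\<Sum>xs\<in>words n A. sum_list (map \<theta> xs)) = 0"
proof (induction n)
  case 0
  then show ?case by (simp add: words_0 del: length_0_conv)
next
  case (Suc n)
  then show ?case
    using assms by (simp add: sum_words_Suc sum.distrib card_lists_length_eq flip: sum_distrib_left)
qed

text \<open>Variance of a sum of independent centred letters: the mixed terms vanish. The factor
  \<open>card A\<close> on the left avoids an exponent \<open>n - 1\<close>.\<close>

lemma sum_words_square:
  fixes \<theta> :: "'a \<Rightarrow> real"
  assumes "finite A" "(\<Sum>x\<in>A. \<theta> x) = 0"
  shows "real (card A) * (\<Sum>xs\<in>words n A. (sum_list (map \<theta> xs))\<^sup>2) =
    real n * real (card A) ^ n * (\<Sum>x\<in>A. (\<theta> x)\<^sup>2)"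
proof (induction n)
  case 0
  then show ?case by (simp add: words_0 del: length_0_conv)
next
  case (Suc n)
  let ?S = "\<lambda>xs. sum_list (map \<theta> xs)"
  have "(\<Sum>xs\<in>words (Suc n) A. (?S xs)\<^sup>2) =
    (\<Sum>x\<in>A. \<Sum>xs\<in>words n A. (\<theta> x)\<^sup>2 + 2 * \<theta> x * ?S xs + (?S xs)\<^sup>2)"
    by (simp add: sum_words_Suc power2_sum algebra_simps)
  also have "\<dots> = real (card A) ^ n * (\<Sum>x\<in>A. (\<theta> x)\<^sup>2) + real (card A) * (\<Sum>xs\<in>words n A. (?S xs)\<^sup>2)"
    using assms sum_words_sum[OF assms]
    by (simp add: sum.distrib card_lists_length_eq sum_distrib_left[symmetric])
  finally show ?case using Suc by (simp add: algebra_simps)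
qed

section \<open>Kronecker powers of an eigenbasis\<close>

text \<open>The n-fold Kronecker power of \<open>P\<close>, with words as row and column indices;
  \<open>map2\<close> pairs the letters at equal positions.\<close>

definition pow_matrix :: "('a \<Rightarrow> 'b \<Rightarrow> real) \<Rightarrow> 'a list \<Rightarrow> 'b list \<Rightarrow> real" where
  "pow_matrix P xs is = prod_list (map2 P xs is)"

text \<open>The columns of \<open>P\<close> form a basis, and \<open>Q\<close> is the two-sided
  inverse of \<open>P\<close>. An explicit inverse stands in for orthonormality: it yields
  coordinates and traces, and it passes to Kronecker powers.\<close>

definition biorthogonal :: "'a set \<Rightarrow> 'i set \<Rightarrow> ('a \<Rightarrow> 'i \<Rightarrow> real) \<Rightarrow> ('i \<Rightarrow> 'a \<Rightarrow> real) \<Rightarrow> bool" where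
  "biorthogonal V I P Q \<longleftrightarrow> finite V \<and> finite I \<and>
     (\<forall>x\<in>V. \<forall>y\<in>V. (\<Sum>i\<in>I. P x i * Q i y) = of_bool (x = y)) \<and>
     (\<forall>i\<in>I. \<forall>j\<in>I. (\<Sum>x\<in>V. Q i x * P x j) = of_bool (i = j))"

definition eigen_family :: "'a set \<Rightarrow> ('a \<Rightarrow> 'a \<Rightarrow> real) \<Rightarrow> 'i set \<Rightarrow> ('a \<Rightarrow> 'i \<Rightarrow> real) \<Rightarrow> ('i \<Rightarrow> real) \<Rightarrow> bool" where
  "eigen_family V A I P \<theta> \<longleftrightarrow> (\<forall>x\<in>V. \<forall>i\<in>I. (\<Sum>y\<in>V. A x y * P y i) = \<theta> i * P x i)"

text \<open>Only one of the two inverse relations, with \<open>V\<close> and \<open>I\<close> free,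
  so that exchanging \<open>P\<close> with \<open>Q\<close> gives the other one.\<close>

lemma pow_matrix_inverse:
  assumes "\<And>x y. x \<in> V \<Longrightarrow> y \<in> V \<Longrightarrow> (\<Sum>i\<in>I. P x i * Q i y) = of_bool (x = y)"
    and "xs \<in> words n V" "ys \<in> words n V"
  shows "(\<Sum>is\<in>words n I. pow_matrix P xs is * pow_matrix Q is ys) = of_bool (xs = ys)"
  using assms(2,3)
proof (induction n arbitrary: xs ys)
  case 0
  then show ?case by (simp add: pow_matrix_def words_0 del: length_0_conv)
next
  case (Suc n)
  obtain x xs' y ys' where eq: "xs = x # xs'" "ys = y # ys'"
    using Suc.prems by (cases xs; cases ys) auto
  have "(\<Sum>is\<in>words (Suc n) I. pow_matrix P xs is * pow_matrix Q is ys) =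
    (\<Sum>i\<in>I. \<Sum>is\<in>words n I. (P x i * Q i y) * (pow_matrix P xs' is * pow_matrix Q is ys'))"
    by (simp add: sum_words_Suc pow_matrix_def eq ac_simps)
  also have "\<dots> = (\<Sum>i\<in>I. P x i * Q i y) * (\<Sum>is\<in>words n I. pow_matrix P xs' is * pow_matrix Q is ys')"
    by (simp add: sum_product)
  also have "\<dots> = of_bool (xs = ys)"
    using Suc.IH[of xs' ys'] Suc.prems assms(1)[of x y] by (auto simp: eq)
  finally show ?case .
qed

lemma biorthogonal_pow:
  assumes "biorthogonal V I P Q"
  shows "biorthogonal (words n V) (words n I) (pow_matrix P) (pow_matrix Q)"
  using assms pow_matrix_inverse[where V=V and I=I and P=P and Q=Q and n=n]
    pow_matrix_inverse[where V=I and I=V and P=Q and Q=P and n=n]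
  unfolding biorthogonal_def by (simp add: finite_lists_length_eq)

lemma pverts_cart_pow: "pverts (cart_pow G n) = words n (pverts G)"
proof (induction n)
  case (Suc n)
  have "pverts (cart_pow G (Suc n)) = (\<lambda>(x, xs). x # xs) ` (pverts G \<times> pverts (cart_pow G n))"
    by (simp add: Let_def cart_prod_def)
  also have "\<dots> = (\<lambda>(xs, x). x # xs) ` (pverts (cart_pow G n) \<times> pverts G)"
    by force
  finally show ?case using Suc by (simp add: lists_length_Suc_eq)
qed (auto simp: words_0)

text \<open>The adjacency matrix of a Cartesian product is a Kronecker sum. Without loops the two
  kinds of edges exclude each other, so the two summands are never both 1.\<close>

lemma adj_matrix_cart_pow_Suc:
  assumes "\<And>x. (x, x) \<notin> parcs G" "x \<in> pverts G" "y \<in> pverts G"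
    "xs \<in> words n (pverts G)" "ys \<in> words n (pverts G)"
  shows "adj_matrix (cart_pow G (Suc n)) (x # xs) (y # ys) =
    adj_matrix G x y * of_bool (xs = ys) + of_bool (x = y) * adj_matrix (cart_pow G n) xs ys"
proof -
  have "(x # xs, y # ys) \<in> parcs (cart_pow G (Suc n)) \<longleftrightarrow>
      ((x, xs), (y, ys)) \<in> parcs (cart_prod G (cart_pow G n))"
    by (force simp: Let_def image_iff)
  also have "\<dots> \<longleftrightarrow> (x, y) \<in> parcs G \<and> xs = ys \<or> x = y \<and> (xs, ys) \<in> parcs (cart_pow G n)"
    using assms(2-) by (simp add: cart_prod_def pverts_cart_pow)
  finally show ?thesis using assms(1) by (auto simp: adj_matrix_def)
qed

text \<open>For a Kronecker sum the eigenvectors multiply and the eigenvalues add. The eigenvector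
  matrix of the power depends on \<open>P\<close> alone, so a common basis for a graph and its
  complement yields a common basis for their powers.\<close>

lemma eigen_family_cart_pow:
  assumes fin: "finite (pverts G)" and loop: "\<And>x. (x, x) \<notin> parcs G"
    and eig: "eigen_family (pverts G) (adj_matrix G) I P \<theta>"
  shows "eigen_family (words n (pverts G)) (adj_matrix (cart_pow G n)) (words n I) (pow_matrix P)
    (\<lambda>is. sum_list (map \<theta> is))"
proof -
  let ?V = "pverts G"
  have "(\<Sum>ys\<in>words n ?V. adj_matrix (cart_pow G n) xs ys * pow_matrix P ys is) =
      sum_list (map \<theta> is) * pow_matrix P xs is" if "xs \<in> words n ?V" "is \<in> words n I" for xs "is"
    using that
  proof (induction n arbitrary: xs "is")
    case 0
    then show ?case by (simp add: words_0 adj_matrix_def del: length_0_conv)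
  next
    case (Suc n)
    obtain x xs' i is' where eq: "xs = x # xs'" "is = i # is'"
      using Suc.prems by (cases xs; cases "is") auto
    have mem: "x \<in> ?V" "i \<in> I" "xs' \<in> words n ?V" "is' \<in> words n I" using Suc.prems eq by auto
    have fw: "finite (words n ?V)" using fin by (rule finite_lists_length_eq)
    have "(\<Sum>ys\<in>words (Suc n) ?V. adj_matrix (cart_pow G (Suc n)) xs ys * pow_matrix P ys is) =
      (\<Sum>y\<in>?V. \<Sum>ys\<in>words n ?V. (adj_matrix G x y * of_bool (xs' = ys) +
         of_bool (x = y) * adj_matrix (cart_pow G n) xs' ys) * (P y i * pow_matrix P ys is'))"
      unfolding eq sum_words_Suc
      by (intro sum.cong refl, subst adj_matrix_cart_pow_Suc[OF loop]) (use mem in \<open>auto simp: pow_matrix_def\<close>)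
    also have "\<dots> = (\<Sum>y\<in>?V. \<Sum>ys\<in>words n ?V. of_bool (xs' = ys) * (adj_matrix G x y * P y i * pow_matrix P ys is')) +
      (\<Sum>y\<in>?V. of_bool (x = y) * (P y i * (\<Sum>ys\<in>words n ?V. adj_matrix (cart_pow G n) xs' ys * pow_matrix P ys is')))"
      by (simp add: sum.distrib sum_distrib_left algebra_simps)
    also have "(\<Sum>y\<in>?V. \<Sum>ys\<in>words n ?V. of_bool (xs' = ys) * (adj_matrix G x y * P y i * pow_matrix P ys is')) =
      (\<Sum>y\<in>?V. adj_matrix G x y * P y i) * pow_matrix P xs' is'"
      using mem fw by (simp add: of_bool_def if_distrib[of "\<lambda>c. c * _"] sum.delta sum_distrib_right cong: if_cong)
    also have "(\<Sum>y\<in>?V. adj_matrix G x y * P y i) = \<theta> i * P x i"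
      using eig mem by (simp add: eigen_family_def)
    also have "(\<Sum>y\<in>?V. of_bool (x = y) * (P y i * (\<Sum>ys\<in>words n ?V. adj_matrix (cart_pow G n) xs' ys * pow_matrix P ys is'))) =
      P x i * (sum_list (map \<theta> is') * pow_matrix P xs' is')"
      using mem fin Suc.IH[OF mem(3,4)] by (simp add: of_bool_def if_distrib[of "\<lambda>c. c * _"] sum.delta cong: if_cong)
    finally show ?case by (simp add: eq pow_matrix_def algebra_simps)
  qed
  then show ?thesis unfolding eigen_family_def by blast
qed

section \<open>Traces, coordinates and dimensions from a biorthogonal pair\<close>

text \<open>Invariance of the trace under similarity: \<open>A P = P D\<close> with \<open>D\<close>
  diagonal and \<open>P Q = Q P = 1\<close>.\<close>

lemma eigen_trace:
  assumes "biorthogonal V I P Q" "eigen_family V A I P \<theta>"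
  shows "(\<Sum>i\<in>I. \<theta> i) = (\<Sum>x\<in>V. A x x)"
proof -
  have fin: "finite V" "finite I" using assms by (auto simp: biorthogonal_def)
  have "(\<Sum>i\<in>I. \<theta> i) = (\<Sum>i\<in>I. \<Sum>x\<in>V. Q i x * (\<theta> i * P x i))"
    using assms(1) by (intro sum.cong) (auto simp: biorthogonal_def sum_distrib_left[symmetric] mult.left_commute)
  also have "\<dots> = (\<Sum>i\<in>I. \<Sum>x\<in>V. \<Sum>y\<in>V. A x y * (P y i * Q i x))"
  proof (intro sum.cong refl)
    fix i x assume "i \<in> I" "x \<in> V"
    then have e: "\<theta> i * P x i = (\<Sum>y\<in>V. A x y * P y i)"
      using assms(2) by (simp add: eigen_family_def)
    show "Q i x * (\<theta> i * P x i) = (\<Sum>y\<in>V. A x y * (P y i * Q i x))"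
      unfolding e by (simp add: sum_distrib_left ac_simps)
  qed
  also have "\<dots> = (\<Sum>x\<in>V. \<Sum>y\<in>V. \<Sum>i\<in>I. A x y * (P y i * Q i x))"
    by (subst sum.swap) (intro sum.cong refl sum.swap)
  also have "\<dots> = (\<Sum>x\<in>V. \<Sum>y\<in>V. A x y * of_bool (y = x))"
    using assms(1) by (intro sum.cong) (auto simp: biorthogonal_def sum_distrib_left[symmetric])
  also have "\<dots> = (\<Sum>x\<in>V. A x x)"
    using fin by (simp add: of_bool_def if_distrib[of "\<lambda>c. _ * c"] sum.delta' cong: if_cong)
  finally show ?thesis .
qed

lemma eigen_family_mult:
  assumes "eigen_family V A I P \<theta>" "eigen_family V B I P \<eta>"
  shows "eigen_family V (\<lambda>x z. \<Sum>y\<in>V. A x y * B y z) I P (\<lambda>i. \<theta> i * \<eta> i)"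
  unfolding eigen_family_def
proof (intro ballI)
  fix x i assume "x \<in> V" "i \<in> I"
  have "(\<Sum>z\<in>V. (\<Sum>y\<in>V. A x y * B y z) * P z i) = (\<Sum>y\<in>V. A x y * (\<Sum>z\<in>V. B y z * P z i))"
    unfolding sum_distrib_left sum_distrib_right by (subst sum.swap) (simp add: mult.assoc)
  also have "\<dots> = (\<Sum>y\<in>V. A x y * (\<eta> i * P y i))"
    using assms(2) \<open>i \<in> I\<close> by (intro sum.cong) (auto simp: eigen_family_def)
  also have "\<dots> = \<eta> i * (\<Sum>y\<in>V. A x y * P y i)"
    by (simp add: sum_distrib_left mult.left_commute)
  also have "\<dots> = \<theta> i * \<eta> i * P x i"
    using assms(1) \<open>x \<in> V\<close> \<open>i \<in> I\<close> by (simp add: eigen_family_def)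
  finally show "(\<Sum>z\<in>V. (\<Sum>y\<in>V. A x y * B y z) * P z i) = \<theta> i * \<eta> i * P x i" .
qed

text \<open>The trace of the identity matrix counts both index sets.\<close>

lemma biorthogonal_card:
  assumes "biorthogonal V I P Q" shows "card I = card V"
proof -
  have "eigen_family V (\<lambda>x y. of_bool (x = y)) I P (\<lambda>_. 1)"
    using assms by (auto simp: eigen_family_def biorthogonal_def of_bool_def if_distrib[of "\<lambda>c. c * _"] cong: if_cong)
  from eigen_trace[OF assms this] have "real (card I) = real (card V)" by simp
  then show ?thesis by simp
qed

lemma biorthogonal_coeff_eq:
  assumes "biorthogonal V I P Q" "\<And>x. x \<in> V \<Longrightarrow> (\<Sum>j\<in>I. c j * P x j) = (\<Sum>j\<in>I. d j * P x j)" "i \<in> I"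
  shows "c i = d i"
proof -
  have *: "(\<Sum>x\<in>V. Q i x * (\<Sum>j\<in>I. c j * P x j)) = c i" for c
  proof -
    have "(\<Sum>x\<in>V. Q i x * (\<Sum>j\<in>I. c j * P x j)) = (\<Sum>j\<in>I. c j * (\<Sum>x\<in>V. Q i x * P x j))"
      by (simp add: sum_distrib_left sum.swap[of _ V I] mult.left_commute)
    also have "\<dots> = (\<Sum>j\<in>I. c j * of_bool (i = j))"
      using assms by (intro sum.cong) (auto simp: biorthogonal_def)
    also have "\<dots> = c i"
      using assms by (simp add: biorthogonal_def of_bool_def if_distrib[of "\<lambda>c. _ * c"] sum.delta cong: if_cong)
    finally show ?thesis .
  qed
  have "c i = (\<Sum>x\<in>V. Q i x * (\<Sum>j\<in>I. c j * P x j))" by (simp add: *)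
  also have "\<dots> = (\<Sum>x\<in>V. Q i x * (\<Sum>j\<in>I. d j * P x j))" using assms(2) by (intro sum.cong) auto
  finally show ?thesis by (simp add: *)
qed

lemma biorthogonal_expand:
  assumes "biorthogonal V I P Q" "x \<in> V"
  shows "f x = (\<Sum>i\<in>I. (\<Sum>y\<in>V. Q i y * f y) * P x i)"
proof -
  have "(\<Sum>i\<in>I. (\<Sum>y\<in>V. Q i y * f y) * P x i) = (\<Sum>y\<in>V. f y * (\<Sum>i\<in>I. P x i * Q i y))"
    by (simp add: sum_distrib_left sum_distrib_right sum.swap[of _ I V] ac_simps)
  also have "\<dots> = (\<Sum>y\<in>V. f y * of_bool (x = y))"
    using assms by (intro sum.cong) (auto simp: biorthogonal_def)
  also have "\<dots> = f x"
    using assms by (simp add: biorthogonal_def of_bool_def if_distrib[of "\<lambda>c. _ * c"] sum.delta cong: if_cong)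
  finally show ?thesis by simp
qed

lemma sum_fun_apply: "(\<Sum>i\<in>A. f i) x = (\<Sum>i\<in>A. f i x :: 'b::comm_monoid_add)"
  by (induction A rule: infinite_finite_induct) auto

text \<open>A common eigenvector has nonzero coordinates only at indices where both eigenvalues
  match, so the columns at those indices are a basis of the common eigenspace.\<close>

lemma dim_common_eigenspace:
  assumes bi: "biorthogonal V I P Q" and A: "eigen_family V A I P \<theta>" and B: "eigen_family V B I P \<eta>"
  shows "vector_space.dim fun_scale (eigenspace V A t \<inter> eigenspace V B u) = card {i \<in> I. \<theta> i = t \<and> \<eta> i = u}" (is ?dim)
    and "eigenspace V A t \<inter> eigenspace V B u \<noteq> {\<lambda>_. 0} \<longleftrightarrow> (\<exists>i\<in>I. \<theta> i = t \<and> \<eta> i = u)" (is ?nz)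
proof -
  interpret vector_space "fun_scale :: real \<Rightarrow> ('a \<Rightarrow> real) \<Rightarrow> _" by (rule vector_space_fun_scale)
  have fin: "finite V" "finite I" using bi by (auto simp: biorthogonal_def)
  let ?E = "eigenspace V A t \<inter> eigenspace V B u"
  define J where "J = {i \<in> I. \<theta> i = t \<and> \<eta> i = u}"
  define b where "b i = (\<lambda>x. if x \<in> V then P x i else 0)" for i
  have "finite J" "J \<subseteq> I" using fin by (auto simp: J_def)
  have zero: "c i = 0" if "\<And>x. x \<in> V \<Longrightarrow> (\<Sum>j\<in>J. c j * P x j) = 0" "i \<in> J" for c i
  proof -
    have "(if i \<in> J then c i else 0) = (0::real)"
    proof (rule biorthogonal_coeff_eq[OF bi, where c="\<lambda>i. if i \<in> J then c i else 0" and d="\<lambda>_. 0"])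
      fix x assume "x \<in> V"
      have "(\<Sum>j\<in>I. (if j \<in> J then c j else 0) * P x j) = (\<Sum>j\<in>J. c j * P x j)"
        using \<open>J \<subseteq> I\<close> fin by (intro sum.mono_neutral_cong_right) auto
      then show "(\<Sum>j\<in>I. (if j \<in> J then c j else 0) * P x j) = (\<Sum>j\<in>I. 0 * P x j)"
        using that(1)[OF \<open>x \<in> V\<close>] by simp
    qed (use \<open>J \<subseteq> I\<close> that in auto)
    then show ?thesis using that by simp
  qed
  \<comment> \<open>Two indices might carry the same column; injectivity lets \<open>J\<close>
    itself be counted instead of its image.\<close>
  have inj: "inj_on b J"
  proof (rule inj_onI, rule ccontr)
    fix i j assume ij: "i \<in> J" "j \<in> J" "b i = b j" "i \<noteq> j"
    have "of_bool (i = i) - of_bool (i = j) = (0::real)"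
    proof (rule zero[where c="\<lambda>l. of_bool (l = i) - of_bool (l = j)"])
      fix x assume "x \<in> V"
      then have "P x i = P x j" using fun_cong[OF ij(3), of x] by (simp add: b_def)
      then show "(\<Sum>l\<in>J. (of_bool (l = i) - of_bool (l = j)) * P x l) = 0"
        using ij \<open>finite J\<close> by (simp add: left_diff_distrib sum_subtractf of_bool_def if_distrib[of "\<lambda>c. c * _"] sum.delta cong: if_cong)
    qed (use ij in auto)
    then show False using ij by simp
  qed
  have indep: "independent (b ` J)"
  proof (rule independent_if_scalars_zero)
    fix f y assume 0: "(\<Sum>y\<in>b ` J. fun_scale (f y) y) = 0" and "y \<in> b ` J"
    then obtain i where i: "i \<in> J" "y = b i" by blast
    have "f (b i) = 0"
    proof (rule zero)
      fix x assume "x \<in> V"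
      have "(\<Sum>j\<in>J. fun_scale (f (b j)) (b j)) = 0" using 0 inj by (simp add: sum.reindex)
      from fun_cong[OF this, of x] show "(\<Sum>j\<in>J. f (b j) * P x j) = 0"
        using \<open>x \<in> V\<close> by (simp add: sum_fun_apply fun_scale_def b_def)
    qed fact
    then show "f y = 0" using i by simp
  qed (use \<open>finite J\<close> in auto)
  have sub: "b ` J \<subseteq> ?E"
    using A B by (auto simp: J_def b_def eigenspace_def eigen_family_def cong: sum.cong)
  have span: "?E \<subseteq> span (b ` J)"
  proof
    fix f assume f: "f \<in> ?E"
    define q where "q i = (\<Sum>y\<in>V. Q i y * f y)" for i
    have exp: "f x = (\<Sum>i\<in>I. q i * P x i)" if "x \<in> V" for x
      unfolding q_def by (rule biorthogonal_expand[OF bi that])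
    \<comment> \<open>Comparing coordinates in \<open>M f = \<tau> f\<close>: a coordinate of
      \<open>f\<close> survives only where the eigenvalue equals \<tau>.\<close>
    have coeff: "q i * \<mu> i = \<tau> * q i" if M: "eigen_family V M I P \<mu>" "f \<in> eigenspace V M \<tau>" and "i \<in> I" for M \<mu> \<tau> i
    proof (rule biorthogonal_coeff_eq[OF bi, where c="\<lambda>i. q i * \<mu> i" and d="\<lambda>i. \<tau> * q i"])
      fix x assume x: "x \<in> V"
      have "(\<Sum>j\<in>I. q j * \<mu> j * P x j) = (\<Sum>j\<in>I. q j * (\<Sum>y\<in>V. M x y * P y j))"
        using M(1) x by (intro sum.cong) (auto simp: eigen_family_def)
      also have "\<dots> = (\<Sum>y\<in>V. M x y * (\<Sum>j\<in>I. q j * P y j))"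
        by (simp add: sum_distrib_left sum.swap[of _ I V] mult.left_commute)
      also have "\<dots> = (\<Sum>y\<in>V. M x y * f y)" by (intro sum.cong refl) (simp add: exp)
      also have "\<dots> = \<tau> * f x" using M(2) x by (simp add: eigenspace_def)
      also have "\<dots> = (\<Sum>j\<in>I. \<tau> * q j * P x j)" by (simp add: exp x sum_distrib_left mult.assoc)
      finally show "(\<Sum>j\<in>I. q j * \<mu> j * P x j) = (\<Sum>j\<in>I. \<tau> * q j * P x j)" .
    qed fact
    have "q i = 0" if "i \<in> I - J" for i
      using coeff[OF A, of t i] coeff[OF B, of u i] f that by (auto simp: J_def)
    then have "f = (\<Sum>i\<in>J. fun_scale (q i) (b i))"
    proof (intro ext)
      fix x
      assume z: "\<And>i. i \<in> I - J \<Longrightarrow> q i = 0"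
      show "f x = (\<Sum>i\<in>J. fun_scale (q i) (b i)) x"
      proof (cases "x \<in> V")
        case True
        have "f x = (\<Sum>i\<in>J. q i * P x i)"
          unfolding exp[OF True] using z fin \<open>J \<subseteq> I\<close> by (intro sum.mono_neutral_right) auto
        then show ?thesis using True by (simp add: sum_fun_apply fun_scale_def b_def)
      next
        case False
        then show ?thesis using f by (simp add: sum_fun_apply fun_scale_def b_def eigenspace_def)
      qed
    qed
    then show "f \<in> span (b ` J)" by (auto intro!: span_sum span_scale intro: span_base)
  qed
  have "card (b ` J) = dim ?E" by (rule basis_card_eq_dim[OF sub span indep])
  then show ?dim using card_image[OF inj] by (simp add: J_def)
  have z: "(\<lambda>_. 0) = (0 :: 'a \<Rightarrow> real)" by (simp add: zero_fun_def)
  show ?nz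
  proof
    assume "?E \<noteq> {\<lambda>_. 0}"
    moreover have "(\<lambda>_. 0) \<in> ?E" by (auto simp: eigenspace_def)
    ultimately have "J \<noteq> {}" using span by (auto simp: z)
    then show "\<exists>i\<in>I. \<theta> i = t \<and> \<eta> i = u" by (auto simp: J_def)
  next
    assume "\<exists>i\<in>I. \<theta> i = t \<and> \<eta> i = u"
    then obtain i where "i \<in> J" by (auto simp: J_def)
    then have "b i \<in> b ` J" by blast
    then have "b i \<in> ?E" using sub by blast
    moreover have "b i \<noteq> 0" using \<open>b i \<in> b ` J\<close> indep dependent_zero[of "b ` J"] by metis
    ultimately show "?E \<noteq> {\<lambda>_. 0}" unfolding z by blast
  qed
qed

text \<open>Multiplicities count basis indices, so the distribution is the law of the eigenvalue
  pair at a uniformly random index. This replaces a measure on eigenvalues by a finite uniform space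
  on which sums over words can be used.\<close>

lemma joint_spectral_distribution_eq:
  assumes bi: "biorthogonal (pverts G) I P Q" and A: "eigen_family (pverts G) (adj_matrix G) I P \<theta>"
    and B: "eigen_family (pverts G) (adj_matrix H) I P \<eta>" and "pverts G \<noteq> {}"
  shows "joint_spectral_distribution G H d e =
    distr (measure_pmf (pmf_of_set I)) borel (\<lambda>i. (\<theta> i / sqrt (real d), \<eta> i / sqrt (real e)))"
    (is "?L = ?R")
proof -
  have fin: "finite I" "finite (pverts G)" using bi by (auto simp: biorthogonal_def)
  have card: "card I = card (pverts G)" by (rule biorthogonal_card[OF bi])
  then have "I \<noteq> {}" using assms(4) fin by auto
  define S where "S = (\<lambda>i. (\<theta> i, \<eta> i)) ` I"
  have S: "{p. common_eigenspace G H p \<noteq> {\<lambda>_. 0}} = S"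
  proof (intro set_eqI)
    fix p :: "real \<times> real"
    obtain t u where p: "p = (t, u)" by (cases p)
    have "p \<in> {p. common_eigenspace G H p \<noteq> {\<lambda>_. 0}} \<longleftrightarrow> (\<exists>i\<in>I. \<theta> i = t \<and> \<eta> i = u)"
      by (simp only: mem_Collect_eq p common_eigenspace_def prod.case dim_common_eigenspace(2)[OF bi A B])
    then show "p \<in> {p. common_eigenspace G H p \<noteq> {\<lambda>_. 0}} \<longleftrightarrow> p \<in> S"
      by (auto simp: S_def p)
  qed
  have "finite S" using fin by (simp add: S_def)
  let ?s = "\<lambda>(\<theta>, \<eta>). (\<theta> / sqrt (real d), \<eta> / sqrt (real e))"
  let ?w = "\<lambda>p. real (vector_space.dim fun_scale (common_eigenspace G H p)) / real (card (pverts G))"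
  have w: "?w p = (\<Sum>i | i \<in> I \<and> (\<theta> i, \<eta> i) = p. 1 / real (card I))" for p
  proof -
    obtain t u where p: "p = (t, u)" by (cases p)
    show ?thesis using dim_common_eigenspace(1)[OF bi A B, of t u] fin
      by (simp add: common_eigenspace_def p card)
  qed
  show ?thesis
  proof (rule measure_eqI)
    fix X assume "X \<in> sets ?L"
    then have X: "X \<in> sets borel" by (simp add: joint_spectral_distribution_def)
    have "emeasure ?L X = emeasure (point_measure S (\<lambda>p. ennreal (?w p))) (?s -` X \<inter> S)"
      unfolding joint_spectral_distribution_def S
      using X by (subst emeasure_distr) (auto simp: space_point_measure measurable_point_measure_eq1)
    also have "\<dots> = (\<Sum>p\<in>?s -` X \<inter> S. ennreal (?w p))"
      using \<open>finite S\<close> by (intro emeasure_point_measure_finite) auto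
    also have "\<dots> = ennreal (\<Sum>p\<in>?s -` X \<inter> S. ?w p)"
      by (intro sum_ennreal) auto
    also have "(\<Sum>p\<in>?s -` X \<inter> S. ?w p) =
        (\<Sum>p\<in>?s -` X \<inter> S. \<Sum>i\<in>{i \<in> {i \<in> I. ?s (\<theta> i, \<eta> i) \<in> X}. (\<theta> i, \<eta> i) = p}. 1 / real (card I))"
      unfolding w by (intro sum.cong) auto
    \<comment> \<open>Grouping by eigenvalue pair counts every index exactly once.\<close>
    also have "\<dots> = (\<Sum>i\<in>{i \<in> I. ?s (\<theta> i, \<eta> i) \<in> X}. 1 / real (card I))"
      using fin \<open>finite S\<close> by (intro sum.group) (auto simp: S_def)
    also have "\<dots> = measure (measure_pmf (pmf_of_set I)) ((\<lambda>i. ?s (\<theta> i, \<eta> i)) -` X)"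
      using fin \<open>I \<noteq> {}\<close> by (simp add: measure_pmf_of_set vimage_def Int_def)
    also have "ennreal \<dots> = emeasure ?R X"
      using X by (subst emeasure_distr) (auto simp: measure_pmf.emeasure_eq_measure)
    finally show "emeasure ?L X = emeasure ?R X" .
  qed (simp add: joint_spectral_distribution_def)
qed

section \<open>Eigenvectors of strongly regular graphs\<close>

lemma sum_of_bool_mult:
  fixes f :: "'a \<Rightarrow> real"
  assumes "finite A"
  shows "(\<Sum>y\<in>A. of_bool (x = y) * f y) = (if x \<in> A then f x else 0)"
    "(\<Sum>y\<in>A. f y * of_bool (x = y)) = (if x \<in> A then f x else 0)"
    "(\<Sum>y\<in>A. of_bool (y = x) * f y) = (if x \<in> A then f x else 0)"
    "(\<Sum>y\<in>A. f y * of_bool (y = x)) = (if x \<in> A then f x else 0)"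
  using assms by (simp_all add: of_bool_def if_distrib[of "\<lambda>c. c * _"] if_distrib[of "\<lambda>c. _ * c"]
    sum.delta sum.delta' cong: if_cong)

locale srg =
  fixes G :: "'a pair_pre_digraph" and v k l m :: nat
  assumes srg: "strongly_regular G v k l m"
begin

abbreviation "V \<equiv> pverts G"
abbreviation "a \<equiv> adj_matrix G"

sublocale pair_graph G
  using srg by (simp add: strongly_regular_def)

lemma finite_V [simp]: "finite V" by (rule pair_finite_verts)
lemma card_V: "card V = v" using srg by (simp add: strongly_regular_def)
lemma k_bounds: "0 < k" "k + 1 < v" using srg by (simp_all add: strongly_regular_def)

lemma V_nonempty: "V \<noteq> {}" using card_V k_bounds by auto

lemma no_loop: "(x, x) \<notin> parcs G" using pair_no_loops by fastforce

lemma arc_in_V: "(x, y) \<in> parcs G \<Longrightarrow> x \<in> V \<and> y \<in> V"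
  using arc_fst_in_verts arc_snd_in_verts by fastforce

lemma arc_sym: "(x, y) \<in> parcs G \<longleftrightarrow> (y, x) \<in> parcs G"
  using pair_sym_arcs by (auto simp: symmetric_def sym_def)

lemma nbrs_subset: "nbrs G x \<subseteq> V" by (auto simp: nbrs_def arc_in_V)

lemma a_sym: "a x y = a y x" using arc_sym by (simp add: adj_matrix_def)

lemma row_sum: "x \<in> V \<Longrightarrow> (\<Sum>y\<in>V. a x y) = real k"
proof -
  assume "x \<in> V"
  have "(\<Sum>y\<in>V. a x y) = (\<Sum>y\<in>nbrs G x. 1)"
    using nbrs_subset by (intro sum.mono_neutral_cong_right) (auto simp: adj_matrix_def nbrs_def)
  then show ?thesis using srg \<open>x \<in> V\<close> by (simp add: strongly_regular_def)
qed

text \<open>Entries of the square count common neighbours, so it equals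
  \<open>k I + l A + m (J - I - A)\<close>.\<close>

lemma square:
  assumes "x \<in> V" "z \<in> V"
  shows "(\<Sum>y\<in>V. a x y * a y z) = real k * of_bool (x = z) + real l * a x z + real m * (1 - of_bool (x = z) - a x z)"
proof -
  have "(\<Sum>y\<in>V. a x y * a y z) = (\<Sum>y\<in>nbrs G x \<inter> nbrs G z. 1)"
    using nbrs_subset arc_sym by (intro sum.mono_neutral_cong_right) (auto simp: adj_matrix_def nbrs_def)
  also have "\<dots> = card (nbrs G x \<inter> nbrs G z)" by simp
  finally show ?thesis
    using srg assms no_loop unfolding strongly_regular_def by (auto simp: adj_matrix_def)
qed

lemma adj_compl: "x \<in> V \<Longrightarrow> y \<in> V \<Longrightarrow> adj_matrix (compl_graph G) x y = 1 - of_bool (x = y) - a x y"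
  using no_loop by (auto simp: adj_matrix_def compl_graph_def)

text \<open>On vectors of sum zero \<open>J\<close> vanishes, and the formula for the square becomes
  a quadratic relation for \<open>A\<close>.\<close>

lemma mult_square:
  assumes "x \<in> V" "(\<Sum>y\<in>V. f y) = 0"
  shows "(\<Sum>y\<in>V. a x y * (\<Sum>z\<in>V. a y z * f z)) =
    (real l - real m) * (\<Sum>y\<in>V. a x y * f y) + (real k - real m) * f x"
proof -
  have "(\<Sum>y\<in>V. a x y * (\<Sum>z\<in>V. a y z * f z)) = (\<Sum>z\<in>V. (\<Sum>y\<in>V. a x y * a y z) * f z)"
    unfolding sum_distrib_left sum_distrib_right by (subst sum.swap) (simp add: mult.assoc)
  also have "\<dots> = (\<Sum>z\<in>V. (real k - real m) * (of_bool (x = z) * f z) + (real l - real m) * (a x z * f z) + real m * f z)"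
    using assms by (intro sum.cong refl, subst square) (auto simp: algebra_simps)
  also have "\<dots> = (real k - real m) * f x + (real l - real m) * (\<Sum>z\<in>V. a x z * f z)"
    using assms by (simp add: sum.distrib sum_distrib_left[symmetric] sum_of_bool_mult)
  finally show ?thesis by simp
qed

lemma sum_mult: "(\<Sum>x\<in>V. \<Sum>y\<in>V. a x y * f y) = real k * (\<Sum>y\<in>V. f y)"
proof -
  have "(\<Sum>x\<in>V. \<Sum>y\<in>V. a x y * f y) = (\<Sum>y\<in>V. (\<Sum>x\<in>V. a y x) * f y)"
    by (subst sum.swap) (simp add: sum_distrib_right a_sym)
  then show ?thesis by (simp add: row_sum sum_distrib_left)
qed

lemma restricted_quadratic:
  assumes "t \<in> restricted_eigenvalues G"
  shows "t\<^sup>2 = (real l - real m) * t + (real k - real m)"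
proof -
  obtain f where f: "f \<in> eigenspace V a t" "f \<noteq> (\<lambda>_. 0)" "(\<Sum>x\<in>V. f x) = 0"
    using assms by (auto simp: restricted_eigenvalues_def)
  then obtain x where x: "f x \<noteq> 0" by blast
  then have "x \<in> V" using f by (auto simp: eigenspace_def)
  have af: "(\<Sum>z\<in>V. a y z * f z) = t * f y" if "y \<in> V" for y using f that by (simp add: eigenspace_def)
  have "(\<Sum>y\<in>V. a x y * (\<Sum>z\<in>V. a y z * f z)) = t * (\<Sum>y\<in>V. a x y * f y)"
    by (simp add: af sum_distrib_left mult.left_commute)
  then have "t * (t * f x) = (real l - real m) * (t * f x) + (real k - real m) * f x"
    using mult_square[OF \<open>x \<in> V\<close> f(3)] af[OF \<open>x \<in> V\<close>] by simp
  then have "f x * t\<^sup>2 = f x * ((real l - real m) * t + (real k - real m))"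
    by (simp add: algebra_simps power2_eq_square)
  then show ?thesis using x by simp
qed

end

text \<open>Evaluating the eigenvalue equation at a vertex where the eigenvector is largest in modulus.\<close>

lemma eigenvalue_le_row_sum:
  fixes M :: "'a \<Rightarrow> 'a \<Rightarrow> real"
  assumes "finite V" and f: "\<And>x. x \<in> V \<Longrightarrow> (\<Sum>y\<in>V. M x y * f y) = t * f x" "z \<in> V" "f z \<noteq> 0"
    and M: "\<And>x y. x \<in> V \<Longrightarrow> y \<in> V \<Longrightarrow> 0 \<le> M x y" "\<And>x. x \<in> V \<Longrightarrow> (\<Sum>y\<in>V. M x y) = d"
  shows "\<bar>t\<bar> \<le> d"
proof -
  define B where "B = Max ((\<lambda>x. \<bar>f x\<bar>) ` V)"
  have "B \<in> (\<lambda>x. \<bar>f x\<bar>) ` V" unfolding B_def using assms by (intro Max_in) auto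
  then obtain x where x: "x \<in> V" "B = \<bar>f x\<bar>" by blast
  have le: "\<bar>f y\<bar> \<le> B" if "y \<in> V" for y using assms that by (auto simp: B_def)
  have "B > 0" using le[OF f(2)] f(3) by linarith
  have "\<bar>t\<bar> * B = \<bar>\<Sum>y\<in>V. M x y * f y\<bar>" using f(1)[OF x(1)] x by (simp add: abs_mult)
  also have "\<dots> \<le> (\<Sum>y\<in>V. \<bar>M x y * f y\<bar>)" by (rule sum_abs)
  also have "\<dots> \<le> (\<Sum>y\<in>V. M x y * B)"
    using M(1) x le by (intro sum_mono) (auto simp: abs_mult intro!: mult_left_mono)
  also have "\<dots> = d * B" using M(2) x by (simp add: sum_distrib_right[symmetric])
  finally show ?thesis using \<open>B > 0\<close> by simp
qed

locale srg_spectrum = srg +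
  fixes r s :: real
  assumes restricted: "restricted_eigenvalues G = {r, s}" and s_less_r: "s < r"
begin

text \<open>Vieta's formulas: \<open>r\<close> and \<open>s\<close> are two distinct roots of one
  monic quadratic.\<close>

lemma eigenvalue_sum: "r + s = real l - real m" and eigenvalue_prod: "r * s = real m - real k"
proof -
  have q: "r\<^sup>2 = (real l - real m) * r + (real k - real m)" "s\<^sup>2 = (real l - real m) * s + (real k - real m)"
    using restricted_quadratic restricted by auto
  then have "(r - s) * (r + s - (real l - real m)) = 0" by (simp add: algebra_simps power2_eq_square)
  then show 1: "r + s = real l - real m" using s_less_r by simp
  show "r * s = real m - real k" using q(1) unfolding 1[symmetric] by (simp add: algebra_simps power2_eq_square)
qed

text \<open>The second bound is the first one for the complement, whose matrix
  \<open>J - I - A\<close> acts as \<open>- 1 - t\<close> on the same eigenvector. Together they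
  keep the normalised eigenvalues bounded in both coordinates.\<close>

lemma restricted_bounds:
  assumes "t = r \<or> t = s"
  shows "\<bar>t\<bar> \<le> real k" "\<bar>1 + t\<bar> \<le> real (v - k - 1)"
proof -
  obtain f where f: "f \<in> eigenspace V a t" "f \<noteq> (\<lambda>_. 0)" "(\<Sum>x\<in>V. f x) = 0"
    using assms restricted by (auto simp: restricted_eigenvalues_def)
  then obtain x where x: "f x \<noteq> 0" by blast
  then have "x \<in> V" using f by (auto simp: eigenspace_def)
  have af: "(\<Sum>z\<in>V. a y z * f z) = t * f y" if "y \<in> V" for y using f that by (simp add: eigenspace_def)
  show "\<bar>t\<bar> \<le> real k"
    by (rule eigenvalue_le_row_sum[of V a f _ x]) (use af x \<open>x \<in> V\<close> row_sum in \<open>auto simp: adj_matrix_def\<close>)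
  have "\<bar>- 1 - t\<bar> \<le> real v - 1 - real k"
  proof (rule eigenvalue_le_row_sum[of V "\<lambda>x y. 1 - of_bool (x = y) - a x y" f _ x])
    fix y assume y: "y \<in> V"
    show "(\<Sum>z\<in>V. (1 - of_bool (y = z) - a y z) * f z) = (- 1 - t) * f y"
      using y by (simp add: left_diff_distrib sum_subtractf sum_of_bool_mult f af)
    show "(\<Sum>z\<in>V. 1 - of_bool (y = z) - a y z) = real v - 1 - real k"
      using y sum_of_bool_mult(1)[of V y "\<lambda>_. 1"] by (simp add: sum_subtractf row_sum card_V)
  qed (use x \<open>x \<in> V\<close> no_loop in \<open>auto simp: adj_matrix_def\<close>)
  then show "\<bar>1 + t\<bar> \<le> real (v - k - 1)" using k_bounds by (simp add: of_nat_diff)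
qed

text \<open>On vectors of sum zero \<open>(A - r)(A - s) = 0\<close>, so such a vector is a
  combination of its images under \<open>A - s\<close> and \<open>A - r\<close>, and these are
  eigenvectors. Hence a maximal independent set of eigenvectors that contains the all-ones vector is
  a basis. The basis vectors serve as their own indices, and \<open>i0\<close> is the all-ones
  vector.\<close>

lemma eigenbasis:
  obtains I :: "('a \<Rightarrow> real) set" and P Q \<theta> \<eta> i0 where
    "biorthogonal V I P Q" "eigen_family V a I P \<theta>" "eigen_family V (adj_matrix (compl_graph G)) I P \<eta>"
    "i0 \<in> I" "\<theta> i0 = real k" "\<eta> i0 = real (v - k - 1)" "\<And>x. x \<in> V \<Longrightarrow> P x i0 = 1"
    "\<And>i. i \<in> I - {i0} \<Longrightarrow> (\<theta> i = r \<or> \<theta> i = s) \<and> \<eta> i = - 1 - \<theta> i \<and> (\<Sum>x\<in>V. P x i) = 0"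
proof -
  interpret vs: vector_space "fun_scale :: real \<Rightarrow> ('a \<Rightarrow> real) \<Rightarrow> _" by (rule vector_space_fun_scale)
  define one :: "'a \<Rightarrow> real" where "one = (\<lambda>x. of_bool (x \<in> V))"
  define U where "U t = {f \<in> eigenspace V a t. (\<Sum>x\<in>V. f x) = 0}" for t
  define E where "E = {one} \<union> U r \<union> U s"
  have "one \<noteq> 0" using V_nonempty by (auto simp: one_def fun_eq_iff)
  then have "vs.independent {one}" by simp
  then obtain B where B: "{one} \<subseteq> B" "B \<subseteq> E" "vs.independent B" "E \<subseteq> vs.span B"
    using vs.maximal_independent_subset_extend[of "{one}" E] by (auto simp: E_def)
  have in_span: "f \<in> vs.span B" if f: "\<And>x. x \<notin> V \<Longrightarrow> f x = 0" for f
  proof -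
    \<comment> \<open>Subtracting the mean of \<open>f\<close> leaves a vector of sum zero.\<close>
    define c where "c = (\<Sum>x\<in>V. f x) / real v"
    define f0 where "f0 = f - fun_scale c one"
    have f0x: "f0 x = f x - c * of_bool (x \<in> V)" for x by (simp add: f0_def fun_scale_def one_def)
    have sum0: "(\<Sum>x\<in>V. f0 x) = 0"
      using k_bounds by (simp add: f0x sum_subtractf card_V c_def)
    have out: "f0 x = 0" if "x \<notin> V" for x using that f by (simp add: f0x)
    \<comment> \<open>This is \<open>(A - t) f0\<close>, cut off outside \<open>V\<close>. When
      \<open>t\<close> and \<open>t'\<close> are the two roots, it is an eigenvector for
      \<open>t'\<close>.\<close>
    define h where "h t = (\<lambda>x. of_bool (x \<in> V) * (\<Sum>y\<in>V. a x y * f0 y) - t * f0 x)" for t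
    have h: "h t \<in> U t'" if tt: "t + t' = real l - real m" "t * t' = real m - real k" for t t'
    proof -
      have "(\<Sum>y\<in>V. a x y * h t y) = t' * h t x" if x: "x \<in> V" for x
      proof -
        have "(\<Sum>y\<in>V. a x y * h t y) = (\<Sum>y\<in>V. a x y * (\<Sum>z\<in>V. a y z * f0 z)) - t * (\<Sum>y\<in>V. a x y * f0 y)"
          by (simp add: h_def right_diff_distrib sum_subtractf sum_distrib_left mult.left_commute)
        also have "\<dots> = (t + t') * (\<Sum>y\<in>V. a x y * f0 y) + (- (t * t')) * f0 x - t * (\<Sum>y\<in>V. a x y * f0 y)"
          using mult_square[OF x sum0] tt by simp
        also have "\<dots> = t' * h t x" using x by (simp add: h_def algebra_simps)
        finally show ?thesis .
      qed
      moreover have "(\<Sum>x\<in>V. h t x) = 0"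
        by (simp add: h_def sum_subtractf sum_mult sum0 flip: sum_distrib_left)
      ultimately show ?thesis by (auto simp: U_def eigenspace_def h_def out)
    qed
    have "h s \<in> vs.span B" "h r \<in> vs.span B"
      using h[of s r] h[of r s] eigenvalue_sum eigenvalue_prod B(4)
      by (auto simp: E_def add.commute mult.commute)
    moreover have "one \<in> vs.span B" using B by (auto intro: vs.span_base)
    moreover have "f = fun_scale c one + fun_scale (1 / (r - s)) (h s - h r)"
    proof
      fix x
      have "h s x - h r x = (r - s) * f0 x" by (simp add: h_def algebra_simps)
      then show "f x = (fun_scale c one + fun_scale (1 / (r - s)) (h s - h r)) x"
        using s_less_r by (simp add: fun_scale_def f0x one_def)
    qed
    ultimately show ?thesis by (auto intro!: vs.span_add vs.span_scale vs.span_diff)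
  qed
  define \<delta> where "\<delta> y = (\<lambda>x. of_bool (x = y) * of_bool (x \<in> V) :: real)" for y
  have \<delta>_span: "\<delta> y \<in> vs.span B" for y by (rule in_span) (simp add: \<delta>_def)
  have off: "b x = 0" if "b \<in> B" "x \<notin> V" for b x
    using B(2) that by (auto simp: E_def U_def one_def eigenspace_def)
  have \<delta>_expand: "b = (\<Sum>x\<in>V. fun_scale (b x) (\<delta> x))" if "\<And>x. x \<notin> V \<Longrightarrow> b x = 0" for b
  proof
    fix z
    have "(\<Sum>x\<in>V. fun_scale (b x) (\<delta> x)) z = (\<Sum>x\<in>V. b x * of_bool (z = x)) * of_bool (z \<in> V)"
      by (simp add: sum_fun_apply fun_scale_def \<delta>_def sum_distrib_right mult.assoc)
    then show "b z = (\<Sum>x\<in>V. fun_scale (b x) (\<delta> x)) z"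
      using that by (simp add: sum_of_bool_mult)
  qed
  have "B \<subseteq> vs.span (\<delta> ` V)"
  proof
    fix b assume "b \<in> B"
    have "(\<Sum>x\<in>V. fun_scale (b x) (\<delta> x)) \<in> vs.span (\<delta> ` V)"
      by (intro vs.span_sum vs.span_scale vs.span_base) auto
    then show "b \<in> vs.span (\<delta> ` V)" using \<delta>_expand[of b] off \<open>b \<in> B\<close> by simp
  qed
  then have "finite B" using vs.independent_span_bound[of "\<delta> ` V" B] B(3) by simp
  \<comment> \<open>Row \<open>b\<close> of the inverse matrix: the coordinate functional of
    \<open>b\<close>, evaluated at the unit vectors.\<close>
  define Q where "Q b x = vs.representation B (\<delta> x) b" for b x
  have bi: "biorthogonal V B (\<lambda>x b. b x) Q"
    unfolding biorthogonal_def
  proof (intro conjI ballI)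
    fix x y assume xy: "x \<in> V" "y \<in> V"
    have "(\<Sum>b\<in>B. fun_scale (Q b y) b) = \<delta> y"
      unfolding Q_def using B(3) \<open>finite B\<close> \<delta>_span by (intro vs.sum_representation_eq) auto
    from fun_cong[OF this, of x] show "(\<Sum>b\<in>B. b x * Q b y) = of_bool (x = y)"
      using xy by (simp add: sum_fun_apply fun_scale_def \<delta>_def mult.commute)
  next
    fix b b' assume b: "b \<in> B" "b' \<in> B"
    have "(\<Sum>x\<in>V. Q b x * b' x) = (\<Sum>x\<in>V. vs.representation B (fun_scale (b' x) (\<delta> x)) b)"
      unfolding Q_def using B(3) \<delta>_span by (simp add: vs.representation_scale mult.commute)
    also have "\<dots> = vs.representation B (\<Sum>x\<in>V. fun_scale (b' x) (\<delta> x)) b"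
      using B(3) \<delta>_span by (subst vs.representation_sum) (auto intro: vs.span_scale)
    also have "\<dots> = vs.representation B b' b"
      using \<delta>_expand[of b'] off b by simp
    also have "\<dots> = of_bool (b = b')"
      using vs.representation_basis[OF B(3) b(2)] by auto
    finally show "(\<Sum>x\<in>V. Q b x * b' x) = of_bool (b = b')" .
  qed (use \<open>finite B\<close> in auto)
  define \<theta> where "\<theta> b = (if b = one then real k else if b \<in> U r then r else s)" for b
  define \<eta> where "\<eta> b = (if b = one then real (v - k - 1) else - 1 - \<theta> b)" for b
  have other: "(\<theta> b = r \<or> \<theta> b = s) \<and> b \<in> U (\<theta> b)" if "b \<in> B - {one}" for b
    using that B(2) by (auto simp: \<theta>_def E_def)
  have eig: "(\<Sum>y\<in>V. a x y * b y) = \<theta> b * b x" if "b \<in> B" "x \<in> V" for b x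
  proof (cases "b = one")
    case True
    have "(\<Sum>y\<in>V. a x y * one y) = (\<Sum>y\<in>V. a x y)" by (intro sum.cong) (auto simp: one_def)
    then show ?thesis using that True by (simp add: \<theta>_def row_sum) (simp add: one_def)
  next
    case False
    then show ?thesis using other[of b] that by (auto simp: U_def eigenspace_def)
  qed
  have sumb: "(\<Sum>x\<in>V. b x) = 0" if "b \<in> B - {one}" for b
    using other[OF that] by (simp add: U_def)
  have sum_one: "(\<Sum>x\<in>V. one x) = real v" by (simp add: one_def card_V)
  have eig': "(\<Sum>y\<in>V. adj_matrix (compl_graph G) x y * b y) = \<eta> b * b x" if "b \<in> B" "x \<in> V" for b x
  proof -
    have "(\<Sum>y\<in>V. adj_matrix (compl_graph G) x y * b y) = (\<Sum>y\<in>V. (1 - of_bool (x = y) - a x y) * b y)"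
      using that by (intro sum.cong) (auto simp: adj_compl)
    also have "\<dots> = (\<Sum>y\<in>V. b y) - b x - \<theta> b * b x"
      using that by (simp add: left_diff_distrib sum_subtractf sum_of_bool_mult eig)
    also have "\<dots> = \<eta> b * b x"
    proof (cases "b = one")
      case True
      then show ?thesis
        using that k_bounds by (simp add: sum_one \<eta>_def \<theta>_def of_nat_diff) (simp add: one_def)
    next
      case False
      then show ?thesis using sumb[of b] that by (simp add: \<eta>_def algebra_simps)
    qed
    finally show ?thesis .
  qed
  show thesis
  proof (rule that[OF bi, of \<theta> \<eta> one])
    show "one \<in> B" using B by simp
    show "(\<theta> b = r \<or> \<theta> b = s) \<and> \<eta> b = - 1 - \<theta> b \<and> (\<Sum>x\<in>V. b x) = 0" if "b \<in> B - {one}" for b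
      using other[OF that] sumb[OF that] that by (simp add: \<eta>_def)
  qed (use eig eig' in \<open>auto simp: eigen_family_def \<theta>_def \<eta>_def one_def\<close>)
qed

end

section \<open>The spectral data of one strongly regular graph\<close>

lemma eigen_matrix_eq:
  assumes "biorthogonal V I P Q" "eigen_family V M I P \<mu>" "x \<in> V" "y \<in> V"
  shows "M x y = (\<Sum>i\<in>I. \<mu> i * P x i * Q i y)"
proof -
  have "(\<Sum>i\<in>I. \<mu> i * P x i * Q i y) = (\<Sum>i\<in>I. \<Sum>z\<in>V. M x z * (P z i * Q i y))"
  proof (intro sum.cong refl)
    fix i assume "i \<in> I"
    then have e: "\<mu> i * P x i = (\<Sum>z\<in>V. M x z * P z i)"
      using assms(2,3) by (simp add: eigen_family_def)
    show "\<mu> i * P x i * Q i y = (\<Sum>z\<in>V. M x z * (P z i * Q i y))"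
      unfolding e by (simp add: sum_distrib_right mult.assoc)
  qed
  also have "\<dots> = (\<Sum>z\<in>V. M x z * (\<Sum>i\<in>I. P z i * Q i y))"
    by (subst sum.swap) (simp add: sum_distrib_left)
  also have "\<dots> = (\<Sum>z\<in>V. M x z * of_bool (z = y))"
    using assms by (intro sum.cong) (auto simp: biorthogonal_def)
  also have "\<dots> = M x y"
    using assms by (simp add: biorthogonal_def sum_of_bool_mult)
  finally show ?thesis by simp
qed

text \<open>Chebyshev's inequality for a uniform choice from \<open>W\<close>, where
  \<open>c\<close> bounds the mean square.\<close>

lemma measure_norm_gt_le:
  fixes X :: "'a \<Rightarrow> real \<times> real"
  assumes "finite W" "W \<noteq> {}" "R > 0" "(\<Sum>w\<in>W. (norm (X w))\<^sup>2) \<le> c * real (card W)"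
  shows "measure (distr (measure_pmf (pmf_of_set W)) borel X) {z. norm z > R} \<le> c / R\<^sup>2"
proof -
  have "card W > 0" using assms by (simp add: card_gt_0_iff)
  have [simp]: "{z::real \<times> real. norm z > R} \<in> sets borel"
    by (intro borel_open open_Collect_less continuous_intros)
  have eq: "measure (distr (measure_pmf (pmf_of_set W)) borel X) {z. norm z > R} =
      real (card (W \<inter> {w. norm (X w) > R})) / real (card W)"
    using assms by (subst measure_distr) (auto simp: measure_pmf_of_set vimage_def)
  have "real (card (W \<inter> {w. norm (X w) > R})) * R\<^sup>2 \<le> (\<Sum>w\<in>W \<inter> {w. norm (X w) > R}. (norm (X w))\<^sup>2)"
    using \<open>R > 0\<close> by (intro sum_bounded_below) (auto intro!: power_mono)
  also have "\<dots> \<le> (\<Sum>w\<in>W. (norm (X w))\<^sup>2)"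
    using assms by (intro sum_mono2) auto
  also have "\<dots> \<le> c * real (card W)" by fact
  finally show ?thesis
    unfolding eq using \<open>card W > 0\<close> \<open>R > 0\<close> by (simp add: field_simps)
qed

context srg_spectrum
begin

definition power_distribution :: "nat \<Rightarrow> (real \<times> real) measure" where
  "power_distribution n = joint_spectral_distribution (cart_pow G n) (cart_pow (compl_graph G) n)
     (n * k) (n * (v - k - 1))"

text \<open>Multiplicities are obtained by an existential choice, so every fact that mentions them
  is collected here: the dimension count, the traces of \<open>A\<close> and its square, the
  transform of the joint distribution, and the bound of a coclique by the rank of the projection to
  the \<open>s\<close>-eigenspace.\<close>

definition has_multiplicities :: "nat \<Rightarrow> nat \<Rightarrow> bool" where
  "has_multiplicities f g \<longleftrightarrow> f + g + 1 = v \<and> real k + real f * r + real g * s = 0 \<and>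
     (real k)\<^sup>2 + real f * r\<^sup>2 + real g * s\<^sup>2 = real v * real k \<and>
     (\<forall>n a b. (\<integral>z. iexp ((a, b) \<bullet> z) \<partial>power_distribution n) =
       ((iexp (a * (k / sqrt (n * k)) + b * (real (v - k - 1) / sqrt (n * (v - k - 1)))) +
         f * iexp (a * (r / sqrt (n * k)) + b * ((- 1 - r) / sqrt (n * (v - k - 1)))) +
         g * iexp (a * (s / sqrt (n * k)) + b * ((- 1 - s) / sqrt (n * (v - k - 1))))) / v) ^ n) \<and>
     (\<forall>C\<subseteq>V. r > 0 \<longrightarrow> (\<forall>x\<in>C. \<forall>y\<in>C. (x, y) \<notin> parcs G) \<longrightarrow> card C \<le> g)"

text \<open>A single eigenbasis serves all the claims. The constant 2 in the tail bound is the exact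
  mean square norm, 1 for each normalised coordinate; the last claim is the clique bound from the
  quadratic form of the projection.\<close>

lemma spectral_summary:
  shows "borel_prob (power_distribution n)"
    and "n > 0 \<Longrightarrow> R > 0 \<Longrightarrow> measure (power_distribution n) {z. norm z > R} \<le> 2 / R\<^sup>2"
    and "\<exists>f g. has_multiplicities f g"
    and "C \<subseteq> V \<Longrightarrow> C \<noteq> {} \<Longrightarrow> (\<And>x y. x \<in> C \<Longrightarrow> y \<in> C \<Longrightarrow> x \<noteq> y \<Longrightarrow> (x, y) \<in> parcs G) \<Longrightarrow>
       (real (card C) - 1) * (real v - real k + r) \<le> real v * r + real k - r"
proof -
  obtain I :: "('a \<Rightarrow> real) set" and P Q \<theta> \<eta> i0 where
    bi: "biorthogonal V I P Q" and eig: "eigen_family V a I P \<theta>"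
    and eig': "eigen_family V (adj_matrix (compl_graph G)) I P \<eta>"
    and i0: "i0 \<in> I" "\<theta> i0 = real k" "\<eta> i0 = real (v - k - 1)" "\<And>x. x \<in> V \<Longrightarrow> P x i0 = 1"
    and other: "\<And>i. i \<in> I - {i0} \<Longrightarrow> (\<theta> i = r \<or> \<theta> i = s) \<and> \<eta> i = - 1 - \<theta> i \<and> (\<Sum>x\<in>V. P x i) = 0"
    by (rule eigenbasis) blast
  have "finite I" using bi by (simp add: biorthogonal_def)
  have cardI: "card I = v" using biorthogonal_card[OF bi] card_V by simp
  have "v > 0" "k > 0" and k': "v - k - 1 > 0" using k_bounds by auto
  define Jr Js where "Jr = {i \<in> I - {i0}. \<theta> i = r}" and "Js = {i \<in> I - {i0}. \<theta> i = s}"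
  define f g where "f = card Jr" and "g = card Js"
  have split: "I = insert i0 (Jr \<union> Js)" "i0 \<notin> Jr \<union> Js" "Jr \<inter> Js = {}" "finite Jr" "finite Js"
    using other i0 s_less_r \<open>finite I\<close> by (auto simp: Jr_def Js_def)
  \<comment> \<open>Spectral sums have three kinds of terms. The value type stays open, so that one
    rule covers real moments and complex exponentials.\<close>
  have sumI: "(\<Sum>i\<in>I. h (\<theta> i) (\<eta> i)) = h (real k) (real (v - k - 1)) + of_nat f * h r (- 1 - r) + of_nat g * h s (- 1 - s)"
    for h :: "real \<Rightarrow> real \<Rightarrow> 'c::{comm_semiring_1,semiring_1}"
  proof -
    have "(\<Sum>i\<in>Jr. h (\<theta> i) (\<eta> i)) = (\<Sum>i\<in>Jr. h r (- 1 - r))"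
      using other by (intro sum.cong refl) (force simp: Jr_def)
    moreover have "(\<Sum>i\<in>Js. h (\<theta> i) (\<eta> i)) = (\<Sum>i\<in>Js. h s (- 1 - s))"
      using other by (intro sum.cong refl) (force simp: Js_def)
    moreover have "(\<Sum>i\<in>I. h (\<theta> i) (\<eta> i)) = h (\<theta> i0) (\<eta> i0) + ((\<Sum>i\<in>Jr. h (\<theta> i) (\<eta> i)) + (\<Sum>i\<in>Js. h (\<theta> i) (\<eta> i)))"
      using split by (simp add: sum.union_disjoint)
    ultimately show ?thesis by (simp add: i0 f_def g_def add.assoc)
  qed
  have fg: "f + g + 1 = v"
    using cardI split by (simp add: card_Un_disjoint f_def g_def)
  have tr1: "(\<Sum>i\<in>I. \<theta> i) = 0"
    using eigen_trace[OF bi eig] no_loop by (simp add: adj_matrix_def)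
  have tr2: "(\<Sum>i\<in>I. (\<theta> i)\<^sup>2) = real v * real k"
  proof -
    have "a x x = 0" for x using no_loop by (simp add: adj_matrix_def)
    then show ?thesis
      using eigen_trace[OF bi eigen_family_mult[OF eig eig]] by (simp add: square card_V power2_eq_square)
  qed
  have 2: "real k + real f * r + real g * s = 0" using sumI[of "\<lambda>t u. t"] tr1 by simp
  have 3: "(real k)\<^sup>2 + real f * r\<^sup>2 + real g * s\<^sup>2 = real v * real k" using sumI[of "\<lambda>t u. t\<^sup>2"] tr2 by simp
  have k'r: "real (v - k - 1) = real v - real k - 1" using k_bounds by (simp add: of_nat_diff)
  have fgr: "real f + real g = real v - 1" using fg by linarith
  have tr1': "(\<Sum>i\<in>I. \<eta> i) = 0"
    using sumI[of "\<lambda>t u. u", unfolded k'r] 2 fgr by (simp add: algebra_simps)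
  have tr2': "(\<Sum>i\<in>I. (\<eta> i)\<^sup>2) = real v * real (v - k - 1)"
  proof -
    have "(\<Sum>i\<in>I. (\<eta> i)\<^sup>2) = (real v - real k - 1)\<^sup>2 + real f * (- 1 - r)\<^sup>2 + real g * (- 1 - s)\<^sup>2"
      using sumI[of "\<lambda>t u. u\<^sup>2", unfolded k'r] by simp
    also have "\<dots> = (real v - real k - 1)\<^sup>2 + (real f + real g) + 2 * (real f * r + real g * s) + (real f * r\<^sup>2 + real g * s\<^sup>2)"
      by (simp add: power2_eq_square algebra_simps)
    also have "\<dots> = (real v - real k - 1)\<^sup>2 + (real v - 1) - 2 * real k + (real v * real k - (real k)\<^sup>2)"
      using 2 3 fgr by simp
    also have "\<dots> = real v * (real v - real k - 1)" by (simp add: power2_eq_square algebra_simps)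
    finally show ?thesis unfolding k'r .
  qed
  have Vc: "pverts (compl_graph G) = V" by (simp add: compl_graph_def)
  have bin: "biorthogonal (pverts (cart_pow G n)) (words n I) (pow_matrix P) (pow_matrix Q)" for n
    unfolding pverts_cart_pow by (rule biorthogonal_pow[OF bi])
  have eigA: "eigen_family (pverts (cart_pow G n)) (adj_matrix (cart_pow G n)) (words n I) (pow_matrix P)
      (\<lambda>is. sum_list (map \<theta> is))" for n
    unfolding pverts_cart_pow by (intro eigen_family_cart_pow eig no_loop finite_V)
  have eigB: "eigen_family (pverts (cart_pow G n)) (adj_matrix (cart_pow (compl_graph G) n)) (words n I) (pow_matrix P)
      (\<lambda>is. sum_list (map \<eta> is))" for n
    unfolding pverts_cart_pow Vc[symmetric]
    by (intro eigen_family_cart_pow) (use eig' in \<open>auto simp: Vc\<close>, auto simp: compl_graph_def)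
  define X where "X n is = (sum_list (map \<theta> is) / sqrt (real (n * k)), sum_list (map \<eta> is) / sqrt (real (n * (v - k - 1))))" for n "is"
  have finW: "finite (words n I)" and cardW: "card (words n I) = v ^ n" for n
    using \<open>finite I\<close> cardI by (simp_all add: finite_lists_length_eq card_lists_length_eq)
  have neW: "words n I \<noteq> {}" for n using cardW[of n] \<open>v > 0\<close> by (metis card.empty power_not_zero less_numeral_extra(3))
  have neV: "pverts (cart_pow G n) \<noteq> {}" for n
    using V_nonempty card_lists_length_eq[OF finite_V, of n] card_V \<open>v > 0\<close> unfolding pverts_cart_pow
    by (metis card.empty power_not_zero less_numeral_extra(3))
  have distr: "power_distribution n = distr (measure_pmf (pmf_of_set (words n I))) borel (X n)" for n
    unfolding power_distribution_def X_def
    by (rule joint_spectral_distribution_eq[OF bin eigA eigB neV])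
  have prob: "borel_prob (power_distribution n)" for n
    unfolding distr by (intro borel_prob_distr) (auto simp: measure_pmf.prob_space_axioms)
  have tight: "measure (power_distribution n) {z. norm z > R} \<le> 2 / R\<^sup>2" if "n > 0" "R > 0" for n R
    unfolding distr
  proof (rule measure_norm_gt_le[OF finW neW \<open>R > 0\<close>])
    have sq: "(\<Sum>is\<in>words n I. (sum_list (map \<zeta> is))\<^sup>2) = real (n * d) * real (v ^ n)"
      if "(\<Sum>i\<in>I. \<zeta> i) = 0" "(\<Sum>i\<in>I. (\<zeta> i)\<^sup>2) = real v * real d" for \<zeta> d
      using sum_words_square[OF \<open>finite I\<close> that(1), of n] \<open>v > 0\<close> by (simp add: that(2) cardI)
    have "(\<Sum>is\<in>words n I. (norm (X n is))\<^sup>2) =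
      (\<Sum>is\<in>words n I. (sum_list (map \<theta> is))\<^sup>2) / real (n * k) + (\<Sum>is\<in>words n I. (sum_list (map \<eta> is))\<^sup>2) / real (n * (v - k - 1))"
      by (simp add: X_def norm_prod_def power_divide sum.distrib sum_divide_distrib del: of_nat_mult)
    also have "\<dots> = 2 * real (card (words n I))"
      unfolding sq[OF tr1 tr2] sq[OF tr1' tr2'] cardW using that \<open>k > 0\<close> k' by simp
    finally show "(\<Sum>is\<in>words n I. (norm (X n is))\<^sup>2) \<le> 2 * real (card (words n I))" by simp
  qed
  have char: "(\<integral>z. iexp ((a, b) \<bullet> z) \<partial>power_distribution n) =
       ((iexp (a * (k / sqrt (n * k)) + b * (real (v - k - 1) / sqrt (n * (v - k - 1)))) +
         f * iexp (a * (r / sqrt (n * k)) + b * ((- 1 - r) / sqrt (n * (v - k - 1)))) +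
         g * iexp (a * (s / sqrt (n * k)) + b * ((- 1 - s) / sqrt (n * (v - k - 1))))) / v) ^ n" for n a b
  proof -
    define e where "e i = iexp (a * (\<theta> i / sqrt (n * k)) + b * (\<eta> i / sqrt (n * (v - k - 1))))" for i
    have prod: "iexp ((a, b) \<bullet> X n is) = prod_list (map e is)" for "is"
    proof -
      define x where "x i = a * (\<theta> i / sqrt (n * k)) + b * (\<eta> i / sqrt (n * (v - k - 1)))" for i
      have "(a, b) \<bullet> X n is = sum_list (map x is)"
        by (induction "is") (simp_all add: X_def x_def add_divide_distrib distrib_left)
      moreover have "iexp (sum_list (map x is)) = prod_list (map (\<lambda>i. iexp (x i)) is)"
        by (induction "is") (simp_all add: distrib_left exp_add)
      moreover have "e = (\<lambda>i. iexp (x i))" by (rule ext) (simp only: e_def x_def)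
      ultimately show ?thesis by simp
    qed
    have "(\<integral>z. iexp ((a, b) \<bullet> z) \<partial>power_distribution n) =
        (\<integral>is. prod_list (map e is) \<partial>measure_pmf (pmf_of_set (words n I)))"
      unfolding distr by (subst integral_distr) (auto simp: prod iexp_inner_measurable)
    also have "\<dots> = (\<Sum>is\<in>words n I. (1 / real (v ^ n)) *\<^sub>R prod_list (map e is))"
      using finW neW by (subst integral_measure_pmf[where A="words n I"]) (auto simp: set_pmf_of_set cardW indicator_def)
    also have "\<dots> = (\<Sum>i\<in>I. e i) ^ n / of_nat v ^ n"
      unfolding sum_words_prod[symmetric] sum_divide_distrib
      by (intro sum.cong refl) (simp add: scaleR_conv_of_real)
    also have "(\<Sum>i\<in>I. e i) = iexp (a * (k / sqrt (n * k)) + b * (real (v - k - 1) / sqrt (n * (v - k - 1)))) +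
         f * iexp (a * (r / sqrt (n * k)) + b * ((- 1 - r) / sqrt (n * (v - k - 1)))) +
         g * iexp (a * (s / sqrt (n * k)) + b * ((- 1 - s) / sqrt (n * (v - k - 1))))"
      unfolding e_def by (rule sumI[of "\<lambda>t u. iexp (a * (t / sqrt (n * k)) + b * (u / sqrt (n * (v - k - 1))))"])
    finally show ?thesis by (simp add: power_divide)
  qed
  \<comment> \<open>This value makes \<open>N\<close> annihilate the all-ones vector, since the row
    sums of \<open>N\<close> are \<open>r - k + c * v\<close>.\<close>
  define c where "c = (real k - r) / real v"
  \<comment> \<open>\<open>r - s\<close> times the projection onto the \<open>s\<close>-eigenspace\<close>
  define N where "N x y = r * of_bool (x = y) - a x y + c" for x y
  have "c \<ge> 0" using restricted_bounds(1)[of r] by (simp add: c_def)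
  define \<mu> where "\<mu> i = (if i = i0 then 0 else r - \<theta> i)" for i
  have eigN: "eigen_family V N I P \<mu>"
    unfolding eigen_family_def
  proof (intro ballI)
    fix x i assume x: "x \<in> V" and i: "i \<in> I"
    have "(\<Sum>y\<in>V. N x y * P y i) = r * P x i - \<theta> i * P x i + c * (\<Sum>y\<in>V. P y i)"
      using x i eig by (simp add: N_def distrib_right left_diff_distrib sum.distrib sum_subtractf mult.assoc
          sum_distrib_left[symmetric] sum_of_bool_mult eigen_family_def)
    also have "\<dots> = \<mu> i * P x i"
    proof (cases "i = i0")
      case True
      then show ?thesis using x i0 \<open>v > 0\<close> by (simp add: \<mu>_def card_V c_def)
    next
      case False
      then show ?thesis using other[of i] i by (simp add: \<mu>_def algebra_simps)
    qed
    finally show "(\<Sum>y\<in>V. N x y * P y i) = \<mu> i * P x i" .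
  qed
  have \<mu>: "\<mu> i = (if i \<in> Js then r - s else 0)" if "i \<in> I" for i
    using that other[of i] s_less_r by (auto simp: \<mu>_def Js_def)
  have N_sym: "N x y = N y x" for x y by (auto simp: N_def a_sym)
  \<comment> \<open>The eigenvalues of \<open>N\<close> are 0 and \<open>r - s\<close>. As
    \<open>N\<close> is also symmetric, it is a Gram matrix up to the positive factor
    \<open>r - s\<close>.\<close>
  have Nsq: "(\<Sum>z\<in>V. N x z * N z y) = (r - s) * N x y" if "x \<in> V" "y \<in> V" for x y
  proof -
    have "(\<Sum>z\<in>V. N x z * N z y) = (\<Sum>i\<in>I. (\<mu> i * \<mu> i) * P x i * Q i y)"
      by (rule eigen_matrix_eq[OF bi eigen_family_mult[OF eigN eigN] that])
    also have "\<dots> = (\<Sum>i\<in>I. (r - s) * (\<mu> i * P x i * Q i y))"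
      by (intro sum.cong) (auto simp: \<mu>)
    also have "\<dots> = (r - s) * N x y"
      by (simp add: eigen_matrix_eq[OF bi eigN that] sum_distrib_left)
    finally show ?thesis .
  qed
  \<comment> \<open>On a coclique \<open>N\<close> restricts to \<open>r I + c J\<close>, which is
    positive definite for r > 0. So the columns of \<open>N\<close> over \<open>C\<close> are
    independent, while all of them lie in the span of \<open>g\<close> eigenvectors.\<close>
  have coclique: "card C \<le> g" if "r > 0" "C \<subseteq> V" and C: "\<And>x y. x \<in> C \<Longrightarrow> y \<in> C \<Longrightarrow> (x, y) \<notin> parcs G" for C
  proof -
    interpret vs: vector_space "fun_scale :: real \<Rightarrow> ('a \<Rightarrow> real) \<Rightarrow> _" by (rule vector_space_fun_scale)
    have "finite C" using \<open>C \<subseteq> V\<close> finite_V by (rule finite_subset)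
    define col where "col x = (\<lambda>y. of_bool (y \<in> V) * N y x)" for x
    define b where "b i = (\<lambda>y. of_bool (y \<in> V) * P y i)" for i
    have zero: "d x = 0" if 0: "\<And>y. y \<in> V \<Longrightarrow> (\<Sum>x\<in>C. d x * N y x) = 0" and "x \<in> C" for d x
    proof -
      have "0 = (\<Sum>y\<in>C. d y * (\<Sum>x\<in>C. d x * N y x))"
        using 0 \<open>C \<subseteq> V\<close> by (intro sum.neutral[symmetric]) auto
      also have "\<dots> = (\<Sum>y\<in>C. d y * (\<Sum>x\<in>C. r * (d x * of_bool (y = x)) + c * d x))"
        using C by (intro sum.cong refl arg_cong2[of _ _ _ _ "(*)"]) (auto simp: N_def adj_matrix_def algebra_simps)
      also have "\<dots> = (\<Sum>y\<in>C. d y * (r * d y + c * (\<Sum>x\<in>C. d x)))"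
        using \<open>finite C\<close> by (simp add: sum.distrib sum_distrib_left[symmetric] sum_of_bool_mult)
      also have "\<dots> = r * (\<Sum>y\<in>C. (d y)\<^sup>2) + c * (\<Sum>x\<in>C. d x)\<^sup>2"
        by (simp add: distrib_left sum.distrib sum_distrib_left sum_distrib_right power2_eq_square ac_simps)
      finally have "r * (\<Sum>y\<in>C. (d y)\<^sup>2) \<le> 0" using \<open>c \<ge> 0\<close> by (smt (verit) mult_nonneg_nonneg zero_le_power2)
      then have "(\<Sum>y\<in>C. (d y)\<^sup>2) \<le> 0" using \<open>r > 0\<close> by (simp add: mult_le_0_iff)
      then have "(\<Sum>y\<in>C. (d y)\<^sup>2) = 0" by (meson order_antisym sum_nonneg zero_le_power2)
      then show ?thesis using \<open>finite C\<close> \<open>x \<in> C\<close> by (simp add: sum_nonneg_eq_0_iff)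
    qed
    have inj: "inj_on col C"
    proof (rule inj_onI, rule ccontr)
      fix x x' assume x: "x \<in> C" "x' \<in> C" "col x = col x'" "x \<noteq> x'"
      have "of_bool (x = x) - of_bool (x = x') = (0::real)"
      proof (rule zero[of "\<lambda>z. of_bool (z = x) - of_bool (z = x')"])
        fix y assume "y \<in> V"
        then have "N y x = N y x'" using fun_cong[OF x(3), of y] by (simp add: col_def)
        then show "(\<Sum>z\<in>C. (of_bool (z = x) - of_bool (z = x')) * N y z) = 0"
          using x \<open>finite C\<close> by (simp add: left_diff_distrib sum_subtractf sum_of_bool_mult)
      qed fact
      then show False using x by simp
    qed
    have "vs.independent (col ` C)"
    proof (rule vs.independent_if_scalars_zero)
      fix h u assume 0: "(\<Sum>u\<in>col ` C. fun_scale (h u) u) = 0" and "u \<in> col ` C"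
      then obtain x where x: "x \<in> C" "u = col x" by blast
      have "h (col x) = 0"
      proof (rule zero)
        fix y assume "y \<in> V"
        have "(\<Sum>x\<in>C. fun_scale (h (col x)) (col x)) = 0" using 0 inj by (simp add: sum.reindex)
        from fun_cong[OF this, of y] show "(\<Sum>x\<in>C. h (col x) * N y x) = 0"
          using \<open>y \<in> V\<close> by (simp add: sum_fun_apply fun_scale_def col_def)
      qed fact
      then show "h u = 0" using x by simp
    qed (use \<open>finite C\<close> in auto)
    moreover have "col ` C \<subseteq> vs.span (b ` Js)"
    proof (intro image_subsetI)
      fix x assume "x \<in> C"
      then have "x \<in> V" using \<open>C \<subseteq> V\<close> by blast
      have "col x = (\<Sum>i\<in>Js. fun_scale ((r - s) * Q i x) (b i))"
      proof
        fix y
        show "col x y = (\<Sum>i\<in>Js. fun_scale ((r - s) * Q i x) (b i)) y"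
        proof (cases "y \<in> V")
          case True
          have "N y x = (\<Sum>i\<in>I. \<mu> i * P y i * Q i x)" by (rule eigen_matrix_eq[OF bi eigN True \<open>x \<in> V\<close>])
          also have "\<dots> = (\<Sum>i\<in>Js. (r - s) * P y i * Q i x)"
            using split \<open>finite I\<close> by (intro sum.mono_neutral_cong_right) (auto simp: \<mu>)
          finally show ?thesis using True by (simp add: col_def b_def sum_fun_apply fun_scale_def ac_simps)
        qed (simp add: col_def b_def sum_fun_apply fun_scale_def)
      qed
      then show "col x \<in> vs.span (b ` Js)"
        by (auto intro!: vs.span_sum vs.span_scale intro: vs.span_base)
    qed
    ultimately have "card (col ` C) \<le> card (b ` Js)"
      using vs.independent_span_bound[of "b ` Js" "col ` C"] split by simp
    also have "\<dots> \<le> g" unfolding g_def using split by (intro card_image_le) auto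
    finally show ?thesis using card_image[OF inj] by simp
  qed
  \<comment> \<open>Inside a clique every off-diagonal entry of \<open>N\<close> is
    \<open>c - 1\<close>. The quadratic form of \<open>N\<close> at the indicator of
    \<open>C\<close> is nonnegative, which limits the number of such entries.\<close>
  have clique: "(real (card C) - 1) * (real v - real k + r) \<le> real v * r + real k - r"
    if "C \<subseteq> V" "C \<noteq> {}" and C: "\<And>x y. x \<in> C \<Longrightarrow> y \<in> C \<Longrightarrow> x \<noteq> y \<Longrightarrow> (x, y) \<in> parcs G" for C
  proof -
    have "finite C" using \<open>C \<subseteq> V\<close> finite_V by (rule finite_subset)
    define q where "q = real (card C)"
    have "q > 0" using \<open>finite C\<close> \<open>C \<noteq> {}\<close> by (simp add: q_def card_gt_0_iff)
    have "(r - s) * (\<Sum>x\<in>C. \<Sum>y\<in>C. N x y) = (\<Sum>x\<in>C. \<Sum>y\<in>C. \<Sum>z\<in>V. N x z * N z y)"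
      unfolding sum_distrib_left using \<open>C \<subseteq> V\<close> by (intro sum.cong refl Nsq[symmetric]) auto
    also have "\<dots> = (\<Sum>x\<in>C. \<Sum>z\<in>V. \<Sum>y\<in>C. N x z * N z y)"
      by (intro sum.cong refl sum.swap)
    also have "\<dots> = (\<Sum>z\<in>V. \<Sum>x\<in>C. \<Sum>y\<in>C. N x z * N z y)"
      by (rule sum.swap)
    also have "\<dots> = (\<Sum>z\<in>V. (\<Sum>x\<in>C. N x z)\<^sup>2)"
      by (simp add: power2_eq_square sum_product N_sym)
    also have "\<dots> \<ge> 0" by (intro sum_nonneg) auto
    finally have "0 \<le> (\<Sum>x\<in>C. \<Sum>y\<in>C. N x y)" using s_less_r by (simp add: zero_le_mult_iff)
    also have "\<dots> = (\<Sum>x\<in>C. \<Sum>y\<in>C. (r + 1) * of_bool (x = y) + (c - 1))"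
    proof (intro sum.cong refl)
      fix x y assume "x \<in> C" "y \<in> C"
      then show "N x y = (r + 1) * of_bool (x = y) + (c - 1)"
        using C[of x y] no_loop[of x] by (cases "x = y") (auto simp: N_def adj_matrix_def)
    qed
    also have "\<dots> = q * (r + 1 + q * (c - 1))"
      using \<open>finite C\<close> by (simp add: sum.distrib sum_of_bool_mult q_def)
    finally have "0 \<le> r + 1 + q * (c - 1)" using \<open>q > 0\<close> by (simp add: zero_le_mult_iff)
    \<comment> \<open>Clears the denominator of \<open>c\<close>.\<close>
    then have "0 \<le> real v * (r + 1 + q * (c - 1))" by simp
    also have "\<dots> = real v * r + real k - r - (q - 1) * (real v - real k + r)"
      using \<open>v > 0\<close> by (simp add: c_def field_simps)
    finally show ?thesis by (simp add: q_def)
  qed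
  show "borel_prob (power_distribution n)" by (rule prob)
  show "n > 0 \<Longrightarrow> R > 0 \<Longrightarrow> measure (power_distribution n) {z. norm z > R} \<le> 2 / R\<^sup>2" by (rule tight)
  have "has_multiplicities f g"
    unfolding has_multiplicities_def using fg 2 3 char coclique by blast
  then show "\<exists>f g. has_multiplicities f g" by blast
  show "C \<subseteq> V \<Longrightarrow> C \<noteq> {} \<Longrightarrow> (\<And>x y. x \<in> C \<Longrightarrow> y \<in> C \<Longrightarrow> x \<noteq> y \<Longrightarrow> (x, y) \<in> parcs G) \<Longrightarrow>
       (real (card C) - 1) * (real v - real k + r) \<le> real v * r + real k - r" by (rule clique)
qed

end

section \<open>Complements and complete multipartite graphs\<close>

text \<open>Arcs are pairs of vertices, so a vertex bijection that respects adjacency carries its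
  own arc map.\<close>

lemma digraph_isoI_bij:
  assumes "pair_wf_digraph G" "bij_betw h (pverts G) (pverts H)" "parcs H \<subseteq> pverts H \<times> pverts H"
    and arcs: "\<And>x y. x \<in> pverts G \<Longrightarrow> y \<in> pverts G \<Longrightarrow> (x, y) \<in> parcs G \<longleftrightarrow> (h x, h y) \<in> parcs H"
  shows "digraph_iso (with_proj G) (with_proj H)"
proof -
  interpret pair_wf_digraph G by fact
  have inj: "inj_on h (pverts G)" and img: "h ` pverts G = pverts H"
    using assms(2) by (auto simp: bij_betw_def)
  have sub: "parcs G \<subseteq> pverts G \<times> pverts G"
    using arc_fst_in_verts arc_snd_in_verts by fastforce
  define hom where "hom = \<lparr>iso_verts = h, iso_arcs = map_prod h h, iso_head = snd, iso_tail = fst\<rparr>"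
  have "map_prod h h ` parcs G = parcs H"
  proof
    show "map_prod h h ` parcs G \<subseteq> parcs H" using arcs sub by fastforce
    show "parcs H \<subseteq> map_prod h h ` parcs G"
    proof
      fix e assume e: "e \<in> parcs H"
      then obtain x y where xy: "e = (h x, h y)" "x \<in> pverts G" "y \<in> pverts G"
        using assms(3) img by (cases e) blast
      then have "(x, y) \<in> parcs G" using arcs e by blast
      then show "e \<in> map_prod h h ` parcs G" using xy by force
    qed
  qed
  then have "with_proj H = app_iso hom (with_proj G)"
    by (simp add: app_iso_def hom_def img with_proj_def)
  moreover have "inj_on (map_prod h h) (parcs G)"
    by (rule inj_on_subset[OF map_prod_inj_on[OF inj inj] sub])
  then have "pre_digraph.digraph_isomorphism (with_proj G) hom"
    unfolding pre_digraph.digraph_isomorphism_def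
    using inj by (simp add: hom_def wf_digraph_wp_iff assms(1) split_beta)
  ultimately show ?thesis unfolding digraph_iso_def by blast
qed

text \<open>Ramsey's theorem for a symmetric relation in place of a set of doubletons.
  \<open>N\<close> is fixed before the vertex set and the relation, so one value serves a whole
  sequence of growing graphs.\<close>

lemma ramsey_relation:
  obtains N :: nat where "\<And>(V::'a set) A. finite V \<Longrightarrow> N \<le> card V \<Longrightarrow> (\<And>x y. (x, y) \<in> A \<longleftrightarrow> (y, x) \<in> A) \<Longrightarrow>
    \<exists>C\<subseteq>V. card C = K \<and> ((\<forall>x\<in>C. \<forall>y\<in>C. x \<noteq> y \<longrightarrow> (x, y) \<in> A) \<or> (\<forall>x\<in>C. \<forall>y\<in>C. x \<noteq> y \<longrightarrow> (x, y) \<notin> A))"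
proof -
  obtain N where N: "\<And>(V::'a set) E. finite V \<Longrightarrow> N \<le> card V \<Longrightarrow>
      \<exists>R\<subseteq>V. card R = K \<and> clique R E \<or> card R = K \<and> indep R E"
    using ramsey2[of K K, where 'a='a] by blast
  show thesis
  proof (rule that[of N])
    fix V :: "'a set" and A :: "('a \<times> 'a) set" assume V: "finite V" "N \<le> card V" and sym: "\<And>x y. (x, y) \<in> A \<longleftrightarrow> (y, x) \<in> A"
    define E where "E = {{x, y} | x y. (x, y) \<in> A}"
    have E: "{x, y} \<in> E \<longleftrightarrow> (x, y) \<in> A" for x y
      using sym by (auto simp: E_def doubleton_eq_iff)
    show "\<exists>C\<subseteq>V. card C = K \<and> ((\<forall>x\<in>C. \<forall>y\<in>C. x \<noteq> y \<longrightarrow> (x, y) \<in> A) \<or> (\<forall>x\<in>C. \<forall>y\<in>C. x \<noteq> y \<longrightarrow> (x, y) \<notin> A))"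
      using N[OF V, of E] unfolding clique_def indep_def E by blast
  qed
qed

context srg
begin

lemma nbrs_compl: "x \<in> V \<Longrightarrow> nbrs (compl_graph G) x = V - insert x (nbrs G x)"
  by (auto simp: nbrs_def compl_graph_def)

lemma card_nbrs: "x \<in> V \<Longrightarrow> card (nbrs G x) = k"
  using srg by (simp add: strongly_regular_def)

lemma finite_nbrs: "finite (nbrs G x)"
  using nbrs_subset finite_V by (rule finite_subset)

lemma exists_nonadjacent: "\<exists>x\<in>V. \<exists>y\<in>V. x \<noteq> y \<and> (x, y) \<notin> parcs G"
proof -
  obtain x where x: "x \<in> V" using V_nonempty by blast
  have "card (insert x (nbrs G x)) \<le> k + 1" using card_nbrs[OF x] card_insert_le_m1[of "k+1"] finite_nbrs
    by (simp add: card_insert_if)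
  then have "insert x (nbrs G x) \<noteq> V" using card_V k_bounds by auto
  then obtain y where y: "y \<in> V" "y \<notin> insert x (nbrs G x)" using nbrs_subset x by blast
  then have "x \<noteq> y" "(x, y) \<notin> parcs G" by (auto simp: nbrs_def)
  then show ?thesis using x y(1) by blast
qed

text \<open>Non-adjacent pairs exist because \<open>k + 1 < v\<close>, and their common neighbours
  are among the \<open>k\<close> neighbours of one of them. This settles the signs of
  \<open>r\<close> and \<open>s\<close>.\<close>

lemma m_le_k: "m \<le> k"
proof -
  obtain x y where xy: "x \<in> V" "y \<in> V" "x \<noteq> y" "(x, y) \<notin> parcs G" using exists_nonadjacent by blast
  then have "card (nbrs G x \<inter> nbrs G y) = m" using srg by (simp add: strongly_regular_def)
  moreover have "card (nbrs G x \<inter> nbrs G y) \<le> card (nbrs G x)" by (intro card_mono finite_nbrs) auto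
  ultimately show ?thesis using card_nbrs xy by simp
qed

lemma pair_graph_compl: "pair_graph (compl_graph G)"
proof -
  have "parcs (compl_graph G) \<subseteq> V \<times> V" by (auto simp: compl_graph_def)
  then have "finite (parcs (compl_graph G))" by (rule finite_subset) simp
  then show ?thesis
    using arc_sym by unfold_locales (auto simp: compl_graph_def symmetric_def sym_def)
qed

text \<open>Inclusion-exclusion: \<open>2 * k - m\<close> and \<open>2 * k - l\<close> are the sizes
  of the union of two neighbourhoods, for non-adjacent and for adjacent pairs, and the complement
  sees what lies outside. All the natural subtractions are cardinalities of set differences or
  unions.\<close>

lemma strongly_regular_compl:
  "strongly_regular (compl_graph G) v (v - k - 1) (v - 2 - (2 * k - m)) (v - (2 * k - l))"
proof -
  let ?H = "compl_graph G"
  have un: "card (nbrs G x \<union> nbrs G y) = 2 * k - card (nbrs G x \<inter> nbrs G y)" if "x \<in> V" "y \<in> V" for x y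
    using card_Un_Int[OF finite_nbrs finite_nbrs, of x y] card_nbrs that by simp
  have "card (nbrs ?H x) = v - k - 1" if "x \<in> V" for x
  proof -
    have "x \<notin> nbrs G x" by (simp add: nbrs_def no_loop)
    then show ?thesis
      using that nbrs_subset finite_nbrs
      by (subst nbrs_compl) (simp_all add: card_Diff_subset card_nbrs card_V card_insert_if)
  qed
  moreover have "card (nbrs ?H x \<inter> nbrs ?H y) = v - 2 - (2 * k - m)" if xy: "x \<in> V" "y \<in> V" "(x, y) \<in> parcs ?H" for x y
  proof -
    have ne: "x \<noteq> y" "(x, y) \<notin> parcs G" using xy by (auto simp: compl_graph_def)
    have "nbrs ?H x \<inter> nbrs ?H y = V - ({x, y} \<union> (nbrs G x \<union> nbrs G y))"
      using xy by (auto simp: nbrs_compl)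
    moreover have "card ({x, y} \<union> (nbrs G x \<union> nbrs G y)) = 2 + (2 * k - m)"
    proof -
      have "{x, y} \<inter> (nbrs G x \<union> nbrs G y) = {}"
        using ne arc_sym[of x y] by (auto simp: nbrs_def no_loop)
      moreover have "card (nbrs G x \<inter> nbrs G y) = m"
        using srg xy ne by (simp add: strongly_regular_def)
      ultimately show ?thesis
        using ne un[OF xy(1,2)] finite_nbrs by (simp add: card_Un_disjoint)
    qed
    ultimately show ?thesis
      using xy nbrs_subset finite_nbrs by (simp add: card_Diff_subset card_V)
  qed
  moreover have "card (nbrs ?H x \<inter> nbrs ?H y) = v - (2 * k - l)"
    if xy: "x \<in> V" "y \<in> V" "x \<noteq> y" "(x, y) \<notin> parcs ?H" for x y
  proof -
    have ad: "(x, y) \<in> parcs G" "(y, x) \<in> parcs G" using xy arc_sym by (auto simp: compl_graph_def)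
    have "nbrs ?H x \<inter> nbrs ?H y = V - (nbrs G x \<union> nbrs G y)"
      using xy ad by (auto simp: nbrs_compl) (auto simp: nbrs_def)
    moreover have "card (nbrs G x \<union> nbrs G y) = 2 * k - l"
      using un[OF xy(1,2)] srg xy ad by (auto simp: strongly_regular_def)
    ultimately show ?thesis
      using xy nbrs_subset finite_nbrs by (simp add: card_Diff_subset card_V)
  qed
  ultimately show ?thesis
    using pair_graph_compl card_V k_bounds unfolding strongly_regular_def
    by (auto simp: compl_graph_def)
qed

text \<open>On vectors of sum zero the matrix \<open>J - I - A\<close> acts as
  \<open>- I - A\<close>.\<close>

lemma restricted_eigenvalues_compl:
  "restricted_eigenvalues (compl_graph G) = (\<lambda>t. - 1 - t) ` restricted_eigenvalues G"
proof -
  have eig: "f \<in> eigenspace V (adj_matrix (compl_graph G)) t \<longleftrightarrow> f \<in> eigenspace V a (- 1 - t)"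
    if 0: "(\<Sum>x\<in>V. f x) = 0" for f t
  proof -
    have "(\<Sum>y\<in>V. adj_matrix (compl_graph G) x y * f y) = - f x - (\<Sum>y\<in>V. a x y * f y)" if "x \<in> V" for x
    proof -
      have "(\<Sum>y\<in>V. adj_matrix (compl_graph G) x y * f y) = (\<Sum>y\<in>V. (1 - of_bool (x = y) - a x y) * f y)"
        using that by (intro sum.cong) (auto simp: adj_compl)
      then show ?thesis
        using that 0 by (simp add: left_diff_distrib sum_subtractf sum_of_bool_mult)
    qed
    then have "(\<Sum>y\<in>V. adj_matrix (compl_graph G) x y * f y) = t * f x \<longleftrightarrow> (\<Sum>y\<in>V. a x y * f y) = (- 1 - t) * f x"
      if "x \<in> V" for x
      using that by (simp only:) (simp add: left_diff_distrib, linarith)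
    then show ?thesis by (simp add: eigenspace_def)
  qed
  have iff: "t \<in> restricted_eigenvalues (compl_graph G) \<longleftrightarrow> - 1 - t \<in> restricted_eigenvalues G" for t
    using eig[of _ t] unfolding restricted_eigenvalues_def
    by (auto simp: compl_graph_def)
  show ?thesis
  proof (intro set_eqI iffI)
    fix t assume "t \<in> restricted_eigenvalues (compl_graph G)"
    then show "t \<in> (\<lambda>t. - 1 - t) ` restricted_eigenvalues G"
      by (intro image_eqI[of _ _ "- 1 - t"]) (auto simp: iff)
  qed (auto simp: iff)
qed

text \<open>If \<open>m = k\<close>, then non-adjacent vertices have the same neighbours, so that non-adjacency is an
  equivalence relation with classes of size \<open>v - k\<close>.\<close>

lemma multipartite_bij:
  assumes "m = k"
  obtains p q h where "p \<ge> 2" "q \<ge> 2" "bij_betw h V ({..<p::nat} \<times> {..<q::nat})"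
    "\<And>x y. x \<in> V \<Longrightarrow> y \<in> V \<Longrightarrow> (x, y) \<in> parcs G \<longleftrightarrow> fst (h x) \<noteq> fst (h y)"
proof -
  have nonadj: "(x, y) \<notin> parcs G \<longleftrightarrow> nbrs G x = nbrs G y" if xy: "x \<in> V" "y \<in> V" for x y
  proof
    assume na: "(x, y) \<notin> parcs G"
    show "nbrs G x = nbrs G y"
    proof (cases "x = y")
      case False
      then have "card (nbrs G x \<inter> nbrs G y) = k" using xy na srg assms by (simp add: strongly_regular_def)
      then have "nbrs G x \<inter> nbrs G y = nbrs G x" "nbrs G x \<inter> nbrs G y = nbrs G y"
        using card_nbrs xy finite_nbrs by (metis card_subset_eq inf_le1, metis card_subset_eq inf_le2)
      then show ?thesis by simp
    qed simp
  next
    assume "nbrs G x = nbrs G y"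
    then show "(x, y) \<notin> parcs G" using no_loop[of y] by (auto simp: nbrs_def)
  qed
  define Cl where "Cl = nbrs G ` V"
  define p q where "p = card Cl" and "q = v - k"
  have "finite Cl" by (simp add: Cl_def)
  then obtain e where e: "bij_betw e Cl {..<p}"
    using ex_bij_betw_finite_nat by (auto simp: p_def atLeast0LessThan)
  \<comment> \<open>If \<open>c\<close> is the neighbourhood of some vertex, the vertices sharing it
    are exactly those not adjacent to that vertex; hence all classes have the size
    \<open>v - k\<close>.\<close>
  have fib: "{x \<in> V. nbrs G x = c} = V - c" if "c \<in> Cl" for c
    using that nonadj by (auto simp: Cl_def) (auto simp: nbrs_def)
  have "card (V - c) = q" if "c \<in> Cl" for c
    using that nbrs_subset finite_nbrs by (auto simp: Cl_def card_Diff_subset card_nbrs card_V q_def)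
  then have "\<exists>d. bij_betw d {x \<in> V. nbrs G x = c} {..<q}" if "c \<in> Cl" for c
    using that fib ex_bij_betw_finite_nat[of "V - c"] by (auto simp: atLeast0LessThan)
  \<comment> \<open>A numbering inside every class, chosen class by class; \<open>e\<close> numbers
    the classes, and the two together are the coordinates of \<open>h\<close>.\<close>
  then obtain d where d: "\<And>c. c \<in> Cl \<Longrightarrow> bij_betw (d c) {x \<in> V. nbrs G x = c} {..<q}" by metis
  define h where "h x = (e (nbrs G x), d (nbrs G x) x)" for x
  have clV: "nbrs G x \<in> Cl" if "x \<in> V" for x using that by (simp add: Cl_def)
  have e_eq: "e (nbrs G x) = e (nbrs G y) \<longleftrightarrow> nbrs G x = nbrs G y" if "x \<in> V" "y \<in> V" for x y
    using e clV that by (auto simp: bij_betw_def inj_on_def)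
  have bij: "bij_betw h V ({..<p} \<times> {..<q})"
    unfolding bij_betw_def
  proof
    show "inj_on h V"
    proof (rule inj_onI)
      fix x y assume xy: "x \<in> V" "y \<in> V" "h x = h y"
      then have "nbrs G x = nbrs G y" using e_eq by (simp add: h_def)
      then show "x = y" using xy d[OF clV[OF xy(1)]] by (auto simp: h_def bij_betw_def inj_on_def)
    qed
    show "h ` V = {..<p} \<times> {..<q}"
    proof
      show "h ` V \<subseteq> {..<p} \<times> {..<q}"
      proof
        fix z assume "z \<in> h ` V"
        then obtain x where x: "x \<in> V" "z = h x" by blast
        have "e (nbrs G x) \<in> {..<p}" using bij_betw_apply[OF e clV[OF x(1)]] .
        moreover have "d (nbrs G x) x \<in> {..<q}" using bij_betw_apply[OF d[OF clV[OF x(1)]], of x] x by simp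
        ultimately show "z \<in> {..<p} \<times> {..<q}" by (simp add: x h_def)
      qed
      show "{..<p} \<times> {..<q} \<subseteq> h ` V"
      proof
        fix z assume z: "z \<in> {..<p} \<times> {..<q}"
        then obtain i j where ij: "z = (i, j)" "i \<in> {..<p}" "j \<in> {..<q}" by blast
        then obtain c where c: "c \<in> Cl" "e c = i" using e unfolding bij_betw_def by (metis imageE)
        then have "j \<in> d c ` {x \<in> V. nbrs G x = c}" using d[OF c(1)] ij(3) by (simp add: bij_betw_def)
        then obtain x where "x \<in> V" "nbrs G x = c" "d c x = j" by blast
        then show "z \<in> h ` V" using c ij by (auto simp: h_def)
      qed
    qed
  qed
  have "p \<ge> 2"
  proof -
    obtain x where x: "x \<in> V" using V_nonempty by blast
    then have "nbrs G x \<noteq> {}" using card_nbrs k_bounds by fastforce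
    then obtain y where y: "(x, y) \<in> parcs G" by (auto simp: nbrs_def)
    then have "nbrs G x \<noteq> nbrs G y" "y \<in> V" using nonadj x arc_in_V by blast+
    then have "card {nbrs G x, nbrs G y} \<le> card Cl" using x \<open>finite Cl\<close> by (intro card_mono) (auto simp: Cl_def)
    then show ?thesis using \<open>nbrs G x \<noteq> nbrs G y\<close> by (simp add: p_def)
  qed
  moreover have "q \<ge> 2" using k_bounds by (simp add: q_def)
  moreover have "(x, y) \<in> parcs G \<longleftrightarrow> fst (h x) \<noteq> fst (h y)" if "x \<in> V" "y \<in> V" for x y
    using that nonadj e_eq by (auto simp: h_def)
  ultimately show thesis using that bij by blast
qed

lemma iso_complete_multipartite:
  assumes "m = k"
  shows "\<exists>p\<ge>2. \<exists>q\<ge>2. digraph_iso (with_proj G) (with_proj (complete_multipartite p q))"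
proof -
  obtain p q h where pq: "p \<ge> 2" "q \<ge> 2" and h: "bij_betw h V ({..<p::nat} \<times> {..<q::nat})"
    and arcs: "\<And>x y. x \<in> V \<Longrightarrow> y \<in> V \<Longrightarrow> (x, y) \<in> parcs G \<longleftrightarrow> fst (h x) \<noteq> fst (h y)"
    using multipartite_bij[OF assms] by blast
  have "digraph_iso (with_proj G) (with_proj (complete_multipartite p q))"
  proof (rule digraph_isoI_bij[of _ h])
    fix x y assume xy: "x \<in> V" "y \<in> V"
    then have "h x \<in> {..<p} \<times> {..<q}" "h y \<in> {..<p} \<times> {..<q}" using bij_betw_apply[OF h] by auto
    then show "(x, y) \<in> parcs G \<longleftrightarrow> (h x, h y) \<in> parcs (complete_multipartite p q)"
      using arcs[OF xy]
      by (cases "h x"; cases "h y") (auto simp: complete_multipartite_def compl_graph_def disjoint_cliques_def)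
  qed (use h in \<open>auto simp: complete_multipartite_def compl_graph_def disjoint_cliques_def pair_wf_digraph_axioms\<close>)
  then show ?thesis using pq by blast
qed

text \<open>The hypothesis is the equality of \<open>m\<close> and \<open>k\<close> for the
  complement; the parts of the complement are the cliques of \<open>G\<close>.\<close>

lemma iso_disjoint_cliques:
  assumes "v - (2 * k - l) = v - k - 1"
  shows "\<exists>p\<ge>2. \<exists>q\<ge>2. digraph_iso (with_proj G) (with_proj (disjoint_cliques p q))"
proof -
  interpret H: srg "compl_graph G" v "v - k - 1" "v - 2 - (2 * k - m)" "v - (2 * k - l)"
    by unfold_locales (rule strongly_regular_compl)
  obtain p q h where pq: "p \<ge> 2" "q \<ge> 2" and h: "bij_betw h H.V ({..<p::nat} \<times> {..<q::nat})"
    and arcs: "\<And>x y. x \<in> H.V \<Longrightarrow> y \<in> H.V \<Longrightarrow> (x, y) \<in> parcs (compl_graph G) \<longleftrightarrow> fst (h x) \<noteq> fst (h y)"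
    using H.multipartite_bij[OF assms] by blast
  have HV: "H.V = V" by (simp add: compl_graph_def)
  have "digraph_iso (with_proj G) (with_proj (disjoint_cliques p q))"
  proof (rule digraph_isoI_bij[of _ h])
    fix x y assume xy: "x \<in> V" "y \<in> V"
    have "h x \<in> {..<p} \<times> {..<q}" "h y \<in> {..<p} \<times> {..<q}" using bij_betw_apply[OF h] xy HV by auto
    moreover have "h x = h y \<longleftrightarrow> x = y" using h xy HV by (auto simp: bij_betw_def inj_on_def)
    moreover have "(x, y) \<in> parcs G \<longleftrightarrow> x \<noteq> y \<and> (x, y) \<notin> parcs (compl_graph G)"
      using xy no_loop by (auto simp: compl_graph_def)
    ultimately show "(x, y) \<in> parcs G \<longleftrightarrow> (h x, h y) \<in> parcs (disjoint_cliques p q)"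
      using arcs[of x y] xy HV by (cases "h x"; cases "h y") (auto simp: disjoint_cliques_def)
  qed (use h in \<open>auto simp: compl_graph_def disjoint_cliques_def pair_wf_digraph_axioms\<close>)
  then show ?thesis using pq by blast
qed

end

section \<open>Limits of the characteristic functions\<close>

text \<open>The part of a wave beyond its linear term. The spectrum is centred, so linear terms
  cancel in the sum and only this part is left.\<close>

definition iexp_rem :: "real \<Rightarrow> complex" where
  "iexp_rem x = iexp x - 1 - \<i> * x"

lemma norm_iexp_rem_le: "norm (iexp_rem x) \<le> x\<^sup>2 / 2"
  using iexp_approx1[of x 1] by (simp add: iexp_rem_def algebra_simps power2_eq_square)

text \<open>Taylor bound of third order, weakened to the shape
  \<open>x\<^sup>2 * \<bar>x\<bar>\<close> so that weighted sums are at most the variance times the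
  largest modulus.\<close>

lemma norm_iexp_rem_square_le: "norm (iexp_rem x + x\<^sup>2 / 2) \<le> x\<^sup>2 * \<bar>x\<bar>"
proof -
  have "iexp_rem x + x\<^sup>2 / 2 = iexp x - (\<Sum>k\<le>2. (\<i> * x) ^ k / fact k)"
    by (simp add: iexp_rem_def eval_nat_numeral algebra_simps)
  then have "norm (iexp_rem x + x\<^sup>2 / 2) \<le> \<bar>x\<bar> ^ 3 / 6"
    using iexp_approx1[of x 2] by (simp add: eval_nat_numeral)
  also have "\<bar>x\<bar> ^ 3 / 6 \<le> \<bar>x\<bar> ^ 3" by simp
  also have "\<bar>x\<bar> ^ 3 = x\<^sup>2 * \<bar>x\<bar>" by (simp add: power3_eq_cube power2_eq_square abs_mult[symmetric])
  finally show ?thesis .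
qed

lemma tendsto_iexp_rem: "(x \<longlongrightarrow> c) F \<Longrightarrow> ((\<lambda>n. iexp_rem (x n)) \<longlongrightarrow> iexp_rem c) F"
  unfolding iexp_rem_def by (intro tendsto_intros)

text \<open>For \<kappa> > 0 numerator and denominator are divided by n. For \<kappa> = 0 the bound
  by \<open>k n\<close> makes the quotient at most \<open>sqrt (k n / n)\<close>, which tends to 0,
  and \<open>c / sqrt 0\<close> is 0 by convention.\<close>

lemma tendsto_div_sqrt:
  fixes x :: "nat \<Rightarrow> real" and k :: "nat \<Rightarrow> nat"
  assumes x: "((\<lambda>n. x n / real n) \<longlongrightarrow> c) F" and k: "((\<lambda>n. real (k n) / real n) \<longlongrightarrow> \<kappa>) F"
    and "\<kappa> \<ge> 0" and ev: "\<forall>\<^sub>F n in F. \<bar>x n\<bar> \<le> real (k n) \<and> n > 0 \<and> k n > 0"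
  shows "((\<lambda>n. x n / sqrt (real (n * k n))) \<longlongrightarrow> c / sqrt \<kappa>) F"
proof (cases "\<kappa> = 0")
  case True
  have "((\<lambda>n. sqrt (real (k n) / real n)) \<longlongrightarrow> sqrt 0) F"
    using k True by (intro tendsto_real_sqrt) simp
  then have "((\<lambda>n. sqrt (real (k n) / real n)) \<longlongrightarrow> 0) F" by simp
  moreover have "\<forall>\<^sub>F n in F. norm (x n / sqrt (real (n * k n))) \<le> sqrt (real (k n) / real n)"
    using ev
  proof eventually_elim
    case (elim n)
    have "norm (x n / sqrt (real (n * k n))) \<le> real (k n) / sqrt (real (n * k n))"
      using elim by (simp add: divide_right_mono)
    also have "\<dots> = sqrt (real (k n) / real n)"
      using elim by (simp add: real_sqrt_divide real_sqrt_mult field_simps)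
    finally show ?case .
  qed
  ultimately show ?thesis using True by (auto intro: Lim_null_comparison)
next
  case False
  have "((\<lambda>n. (x n / real n) / sqrt (real (k n) / real n)) \<longlongrightarrow> c / sqrt \<kappa>) F"
    using False \<open>\<kappa> \<ge> 0\<close> by (intro tendsto_intros x k) auto
  moreover have "\<forall>\<^sub>F n in F. (x n / real n) / sqrt (real (k n) / real n) = x n / sqrt (real (n * k n))"
    using ev by eventually_elim (simp add: real_sqrt_divide real_sqrt_mult field_simps)
  ultimately show ?thesis by (rule Lim_transform_eventually)
qed

section \<open>Limits computed from numerical spectral data\<close>

text \<open>Sequences of numbers in place of graphs, so that the complement is a second instance
  with the roles of \<open>r\<close> and \<open>s\<close>, \<open>f\<close> and \<open>g\<close>
  exchanged. Conditions hold eventually along \<open>F\<close>, since the data are meaningful only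
  on the index set.\<close>

locale spectral_limit =
  fixes F :: "nat filter" and v k k' f g :: "nat \<Rightarrow> nat" and r s :: "nat \<Rightarrow> real" and \<kappa> \<kappa>' \<rho> \<sigma> :: real
  assumes F: "F \<noteq> bot" "filterlim real at_top F"
    and params: "\<forall>\<^sub>F n in F. n > 0 \<and> k n > 0 \<and> k' n > 0 \<and> k n + k' n + 1 = v n"
    and multiplicities: "\<forall>\<^sub>F n in F. f n + g n + 1 = v n \<and>
        real (k n) + real (f n) * r n + real (g n) * s n = 0 \<and>
        (real (k n))\<^sup>2 + real (f n) * (r n)\<^sup>2 + real (g n) * (s n)\<^sup>2 = real (v n) * real (k n)"
    and bounds: "\<forall>\<^sub>F n in F. \<bar>r n\<bar> \<le> real (k n) \<and> \<bar>s n\<bar> \<le> real (k n) \<and>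
        \<bar>1 + r n\<bar> \<le> real (k' n) \<and> \<bar>1 + s n\<bar> \<le> real (k' n)"
    and lims: "((\<lambda>n. real (k n) / real n) \<longlongrightarrow> \<kappa>) F" "((\<lambda>n. real (k' n) / real n) \<longlongrightarrow> \<kappa>') F"
      "((\<lambda>n. r n / real n) \<longlongrightarrow> \<rho>) F" "((\<lambda>n. s n / real n) \<longlongrightarrow> \<sigma>) F"
begin

text \<open>Inner product of (a, b) with the normalised spectral point (t, u). The function
  \<open>\<phi>\<close> below is the transform of one of the n independent summands.\<close>

definition \<xi> :: "real \<Rightarrow> real \<Rightarrow> nat \<Rightarrow> real \<Rightarrow> real \<Rightarrow> real" where
  "\<xi> a b n t u = a * (t / sqrt (real (n * k n))) + b * (u / sqrt (real (n * (k' n))))"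

abbreviation "\<xi>\<^sub>0 a b n \<equiv> \<xi> a b n (real (k n)) (real (k' n))"
abbreviation "\<xi>\<^sub>r a b n \<equiv> \<xi> a b n (r n) (- 1 - r n)"
abbreviation "\<xi>\<^sub>s a b n \<equiv> \<xi> a b n (s n) (- 1 - s n)"

definition \<phi> :: "real \<Rightarrow> real \<Rightarrow> nat \<Rightarrow> complex" where
  "\<phi> a b n = (iexp (\<xi>\<^sub>0 a b n) + f n * iexp (\<xi>\<^sub>r a b n) +
     g n * iexp (\<xi>\<^sub>s a b n)) / v n"

lemma inverse_tendsto_0: "((\<lambda>n. 1 / real n) \<longlongrightarrow> 0) F"
  using F(2) by (intro tendsto_divide_0[OF tendsto_const] filterlim_at_top_imp_at_infinity)

lemma \<kappa>_nonneg: "\<kappa> \<ge> 0" "\<kappa>' \<ge> 0"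
  by (rule tendsto_lowerbound[OF lims(1) _ F(1)], simp)
     (rule tendsto_lowerbound[OF lims(2) _ F(1)], simp)

lemma v_limit: "((\<lambda>n. real (v n) / real n) \<longlongrightarrow> \<kappa> + \<kappa>') F"
proof -
  have "((\<lambda>n. real (k n) / real n + real (k' n) / real n + 1 / real n) \<longlongrightarrow> \<kappa> + \<kappa>' + 0) F"
    by (intro tendsto_add lims inverse_tendsto_0)
  moreover have "\<forall>\<^sub>F n in F. real (k n) / real n + real (k' n) / real n + 1 / real n = real (v n) / real n"
    using params by eventually_elim (simp flip: add_divide_distrib)
  ultimately show ?thesis using Lim_transform_eventually by fastforce
qed

lemma \<xi>_limits:
  shows "((\<lambda>n. \<xi>\<^sub>0 a b n) \<longlongrightarrow> a * sqrt \<kappa> + b * sqrt \<kappa>') F"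
    and "((\<lambda>n. \<xi>\<^sub>r a b n) \<longlongrightarrow> a * (\<rho> / sqrt \<kappa>) + b * (- \<rho> / sqrt \<kappa>')) F"
    and "((\<lambda>n. \<xi>\<^sub>s a b n) \<longlongrightarrow> a * (\<sigma> / sqrt \<kappa>) + b * (- \<sigma> / sqrt \<kappa>')) F"
proof -
  have "((\<lambda>n. real (k n) / sqrt (real (n * k n))) \<longlongrightarrow> \<kappa> / sqrt \<kappa>) F"
    by (intro tendsto_div_sqrt lims \<kappa>_nonneg) (use params in eventually_elim, auto)
  moreover have "((\<lambda>n. real (k' n) / sqrt (real (n * (k' n)))) \<longlongrightarrow> \<kappa>' / sqrt \<kappa>') F"
    by (intro tendsto_div_sqrt lims \<kappa>_nonneg) (use params in eventually_elim, auto)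
  ultimately show "((\<lambda>n. \<xi>\<^sub>0 a b n) \<longlongrightarrow> a * sqrt \<kappa> + b * sqrt \<kappa>') F"
    unfolding \<xi>_def real_div_sqrt[OF \<kappa>_nonneg(1)] real_div_sqrt[OF \<kappa>_nonneg(2)]
    by (intro tendsto_add tendsto_mult tendsto_const)
  have neg: "((\<lambda>n. (- 1 - t n) / real n) \<longlongrightarrow> - \<tau>) F" if "((\<lambda>n. t n / real n) \<longlongrightarrow> \<tau>) F" for t \<tau>
    using tendsto_diff[OF tendsto_minus[OF inverse_tendsto_0] that] by (simp add: diff_divide_distrib)
  show "((\<lambda>n. \<xi>\<^sub>r a b n) \<longlongrightarrow> a * (\<rho> / sqrt \<kappa>) + b * (- \<rho> / sqrt \<kappa>')) F"
    unfolding \<xi>_def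
  proof (intro tendsto_add tendsto_mult tendsto_const)
    show "((\<lambda>n. r n / sqrt (real (n * k n))) \<longlongrightarrow> \<rho> / sqrt \<kappa>) F"
      by (intro tendsto_div_sqrt lims \<kappa>_nonneg) (use params bounds in eventually_elim, auto)
    show "((\<lambda>n. (- 1 - r n) / sqrt (real (n * (k' n)))) \<longlongrightarrow> - \<rho> / sqrt \<kappa>') F"
      by (intro tendsto_div_sqrt lims \<kappa>_nonneg neg) (use params bounds in eventually_elim, auto)
  qed
  show "((\<lambda>n. \<xi>\<^sub>s a b n) \<longlongrightarrow> a * (\<sigma> / sqrt \<kappa>) + b * (- \<sigma> / sqrt \<kappa>')) F"
    unfolding \<xi>_def
  proof (intro tendsto_add tendsto_mult tendsto_const)
    show "((\<lambda>n. s n / sqrt (real (n * k n))) \<longlongrightarrow> \<sigma> / sqrt \<kappa>) F"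
      by (intro tendsto_div_sqrt lims \<kappa>_nonneg) (use params bounds in eventually_elim, auto)
    show "((\<lambda>n. (- 1 - s n) / sqrt (real (n * (k' n)))) \<longlongrightarrow> - \<sigma> / sqrt \<kappa>') F"
      by (intro tendsto_div_sqrt lims \<kappa>_nonneg neg) (use params bounds in eventually_elim, auto)
  qed
qed

text \<open>Numerical form of three traces: of the complement, of its square, and of the product of
  the two matrices. The last vanishes, which makes the two coordinates uncorrelated.\<close>

lemma compl_multiplicities:
  "\<forall>\<^sub>F n in F. real (k' n) + real (g n) * (- 1 - s n) + real (f n) * (- 1 - r n) = 0 \<and>
     (real (k' n))\<^sup>2 + real (g n) * (- 1 - s n)\<^sup>2 + real (f n) * (- 1 - r n)\<^sup>2 = real (v n) * real (k' n) \<and>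
     real (k n) * real (k' n) + real (f n) * (r n * (- 1 - r n)) + real (g n) * (s n * (- 1 - s n)) = 0"
  using params multiplicities
proof eventually_elim
  case (elim n)
  have v: "real (v n) = real (k n) + real (k' n) + 1" using elim(1) by linarith
  have fg: "real (f n) + real (g n) + 1 = real (v n)" using elim(2) by linarith
  have 1: "real (k n) + real (f n) * r n + real (g n) * s n = 0"
    and 2: "(real (k n))\<^sup>2 + real (f n) * (r n)\<^sup>2 + real (g n) * (s n)\<^sup>2 = real (v n) * real (k n)"
    using elim(2) by blast+
  show ?case
  proof (intro conjI)
    show "real (k' n) + real (g n) * (- 1 - s n) + real (f n) * (- 1 - r n) = 0"
      using v fg 1 by algebra
    show "(real (k' n))\<^sup>2 + real (g n) * (- 1 - s n)\<^sup>2 + real (f n) * (- 1 - r n)\<^sup>2 = real (v n) * real (k' n)"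
      using v fg 1 2 by algebra
    show "real (k n) * real (k' n) + real (f n) * (r n * (- 1 - r n)) + real (g n) * (s n * (- 1 - s n)) = 0"
      using v fg 1 2 by algebra
  qed
qed

text \<open>Mean and variance of one summand: it is centred, and because the coordinates are
  uncorrelated and normalised, n times its variance is exactly
  \<open>a\<^sup>2 + b\<^sup>2\<close>.\<close>

lemma \<xi>_sums:
  "\<forall>\<^sub>F n in F. \<xi>\<^sub>0 a b n + f n * \<xi>\<^sub>r a b n + g n * \<xi>\<^sub>s a b n = 0 \<and>
     real n / real (v n) * ((\<xi>\<^sub>0 a b n)\<^sup>2 + f n * (\<xi>\<^sub>r a b n)\<^sup>2 +
       g n * (\<xi>\<^sub>s a b n)\<^sup>2) = a\<^sup>2 + b\<^sup>2"
  using params multiplicities compl_multiplicities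
proof eventually_elim
  case (elim n)
  define A B where "A = a / sqrt (real (n * k n))" and "B = b / sqrt (real (n * (k' n)))"
  note m = elim(2)[THEN conjunct2, THEN conjunct1] elim(2)[THEN conjunct2, THEN conjunct2]
  note c = elim(3)[THEN conjunct1] elim(3)[THEN conjunct2, THEN conjunct1] elim(3)[THEN conjunct2, THEN conjunct2]
  have \<xi>: "\<xi> a b n t u = A * t + B * u" for t u by (simp add: \<xi>_def A_def B_def)
  have pos: "real n > 0" "real (k n) > 0" "real (k' n) > 0" "real (v n) > 0" using elim by auto
  have A2: "A\<^sup>2 = a\<^sup>2 / (real n * real (k n))" and B2: "B\<^sup>2 = b\<^sup>2 / (real n * real (k' n))"
    by (simp_all add: A_def B_def power_divide)
  have 1: "\<xi>\<^sub>0 a b n + f n * \<xi>\<^sub>r a b n + g n * \<xi>\<^sub>s a b n =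
      A * (real (k n) + real (f n) * r n + real (g n) * s n) + B * (real (k' n) + real (g n) * (- 1 - s n) + real (f n) * (- 1 - r n))"
    unfolding \<xi> by (simp add: algebra_simps)
  have "(\<xi>\<^sub>0 a b n)\<^sup>2 + f n * (\<xi>\<^sub>r a b n)\<^sup>2 + g n * (\<xi>\<^sub>s a b n)\<^sup>2 =
      A\<^sup>2 * ((real (k n))\<^sup>2 + real (f n) * (r n)\<^sup>2 + real (g n) * (s n)\<^sup>2) +
      B\<^sup>2 * ((real (k' n))\<^sup>2 + real (g n) * (- 1 - s n)\<^sup>2 + real (f n) * (- 1 - r n)\<^sup>2) +
      2 * A * B * (real (k n) * real (k' n) + real (f n) * (r n * (- 1 - r n)) + real (g n) * (s n * (- 1 - s n)))"
    unfolding \<xi> by (simp add: power2_eq_square algebra_simps)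
  also have "\<dots> = A\<^sup>2 * (real (v n) * real (k n)) + B\<^sup>2 * (real (v n) * real (k' n))"
    unfolding m c by simp
  also have "\<dots> = real (v n) / real n * (a\<^sup>2 + b\<^sup>2)"
    unfolding A2 B2 using pos by (simp add: field_simps)
  finally have 2: "(\<xi>\<^sub>0 a b n)\<^sup>2 + f n * (\<xi>\<^sub>r a b n)\<^sup>2 +
      g n * (\<xi>\<^sub>s a b n)\<^sup>2 = real (v n) / real n * (a\<^sup>2 + b\<^sup>2)" .
  show ?case
    unfolding 2 unfolding 1 m c using pos by simp
qed

text \<open>Subtracting the vanishing mean replaces \<open>iexp - 1\<close> by a remainder of second
  order, which is what the factor n can absorb.\<close>

lemma \<phi>_rem:
  "\<forall>\<^sub>F n in F. of_nat n * (\<phi> a b n - 1) = (real n / real (v n)) *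
     (iexp_rem (\<xi>\<^sub>0 a b n) + f n * iexp_rem (\<xi>\<^sub>r a b n) +
      g n * iexp_rem (\<xi>\<^sub>s a b n))"
  using params multiplicities \<xi>_sums[of a b]
proof eventually_elim
  case (elim n)
  define x y z where "x = \<xi>\<^sub>0 a b n" and "y = \<xi>\<^sub>r a b n"
    and "z = \<xi>\<^sub>s a b n"
  have "x + real (f n) * y + real (g n) * z = 0" using elim by (simp add: x_def y_def z_def)
  then have "complex_of_real (x + real (f n) * y + real (g n) * z) = 0" by simp
  then have 0: "of_real x + of_nat (f n) * of_real y + of_nat (g n) * of_real z = (0::complex)" by simp
  have "of_nat (f n) + of_nat (g n) + 1 = (of_nat (v n) :: complex)"
    using elim by (metis of_nat_1 of_nat_add)
  moreover have "iexp_rem x + f n * iexp_rem y + g n * iexp_rem z =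
      iexp x + f n * iexp y + g n * iexp z - (of_nat (f n) + of_nat (g n) + 1)
        - \<i> * (of_real x + of_nat (f n) * of_real y + of_nat (g n) * of_real z)"
    by (simp add: iexp_rem_def algebra_simps)
  ultimately have T: "iexp_rem x + f n * iexp_rem y + g n * iexp_rem z = iexp x + f n * iexp y + g n * iexp z - of_nat (v n)"
    using 0 by simp
  have "v n > 0" using elim(1) by linarith
  then have "of_nat n * (S / of_nat (v n) - 1) = of_real (real n / real (v n)) * (S - of_nat (v n))" for S :: complex
    by (simp add: field_simps)
  then show ?case
    unfolding \<phi>_def x_def[symmetric] y_def[symmetric] z_def[symmetric] T by blast
qed

lemma \<phi>_le_1: "\<forall>\<^sub>F n in F. norm (\<phi> a b n) \<le> 1"
  using params multiplicities
proof eventually_elim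
  case (elim n)
  have "norm (iexp x + f n * iexp y + g n * iexp z) \<le> 1 + real (f n) + real (g n)" for x y z :: real
  proof -
    have "norm (iexp x + f n * iexp y + g n * iexp z) \<le> norm (iexp x) + norm (f n * iexp y) + norm (g n * iexp z)"
      by (intro norm_triangle_mono order_refl)
    then show ?thesis by (simp add: norm_mult)
  qed
  moreover have "1 + real (f n) + real (g n) = real (v n)" using elim by linarith
  ultimately have "norm (iexp x + f n * iexp y + g n * iexp z) \<le> real (v n)" for x y z :: real by simp
  moreover have "v n > 0" using elim(1) by linarith
  ultimately show ?case unfolding \<phi>_def by (simp add: norm_divide)
qed

lemma char_limit:
  assumes "((\<lambda>n. of_nat n * (\<phi> a b n - 1)) \<longlongrightarrow> z) F"
  shows "((\<lambda>n. \<phi> a b n ^ n) \<longlongrightarrow> exp z) F"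
  by (rule tendsto_power_exp[OF F(2) \<phi>_le_1 assms])

text \<open>Nearly \<open>v\<close> terms are added, so smallness of each is not enough. The cubic
  bound releases one factor that tends to 0, and the squares that remain sum to at most the
  variance.\<close>

lemma small_remainder:
  assumes "((\<lambda>n. \<xi>\<^sub>r a b n) \<longlongrightarrow> 0) F" "((\<lambda>n. \<xi>\<^sub>s a b n) \<longlongrightarrow> 0) F"
  shows "((\<lambda>n. complex_of_real (real n / real (v n)) *
     (f n * (iexp_rem (\<xi>\<^sub>r a b n) + (\<xi>\<^sub>r a b n)\<^sup>2 / 2) +
      g n * (iexp_rem (\<xi>\<^sub>s a b n) + (\<xi>\<^sub>s a b n)\<^sup>2 / 2))) \<longlongrightarrow> 0) F"
proof (rule Lim_null_comparison)
  let ?y = "\<lambda>n. \<xi>\<^sub>r a b n" and ?z = "\<lambda>n. \<xi>\<^sub>s a b n"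
  show "((\<lambda>n. (a\<^sup>2 + b\<^sup>2) * (\<bar>?y n\<bar> + \<bar>?z n\<bar>)) \<longlongrightarrow> 0) F"
    using assms by (auto intro!: tendsto_eq_intros)
  show "\<forall>\<^sub>F n in F. norm (complex_of_real (real n / real (v n)) *
     (f n * (iexp_rem (?y n) + (?y n)\<^sup>2 / 2) + g n * (iexp_rem (?z n) + (?z n)\<^sup>2 / 2))) \<le> (a\<^sup>2 + b\<^sup>2) * (\<bar>?y n\<bar> + \<bar>?z n\<bar>)"
    using \<xi>_sums[of a b]
  proof eventually_elim
    case (elim n)
    define x y z where "x = \<xi>\<^sub>0 a b n" and "y = ?y n" and "z = ?z n"
    define c where "c = real n / real (v n)"
    have c: "c \<ge> 0" "c * (x\<^sup>2 + f n * y\<^sup>2 + g n * z\<^sup>2) = a\<^sup>2 + b\<^sup>2" using elim by (simp_all add: x_def y_def z_def c_def)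
    have "norm (complex_of_nat (f n) * (iexp_rem y + y\<^sup>2 / 2) + complex_of_nat (g n) * (iexp_rem z + z\<^sup>2 / 2)) \<le>
      f n * (y\<^sup>2 * \<bar>y\<bar>) + g n * (z\<^sup>2 * \<bar>z\<bar>)"
      using norm_iexp_rem_square_le[of y] norm_iexp_rem_square_le[of z]
      by (intro norm_triangle_mono) (auto simp: norm_mult intro!: mult_left_mono)
    also have "\<dots> \<le> (x\<^sup>2 + f n * y\<^sup>2 + g n * z\<^sup>2) * \<bar>y\<bar> + (x\<^sup>2 + f n * y\<^sup>2 + g n * z\<^sup>2) * \<bar>z\<bar>"
      unfolding mult.assoc[symmetric] by (intro add_mono mult_right_mono) auto
    finally have le: "norm (complex_of_nat (f n) * (iexp_rem y + y\<^sup>2 / 2) + complex_of_nat (g n) * (iexp_rem z + z\<^sup>2 / 2)) \<le>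
      (x\<^sup>2 + f n * y\<^sup>2 + g n * z\<^sup>2) * (\<bar>y\<bar> + \<bar>z\<bar>)" by (simp add: distrib_left)
    have "norm (complex_of_real c * (f n * (iexp_rem y + y\<^sup>2 / 2) + g n * (iexp_rem z + z\<^sup>2 / 2))) \<le>
        c * ((x\<^sup>2 + f n * y\<^sup>2 + g n * z\<^sup>2) * (\<bar>y\<bar> + \<bar>z\<bar>))"
      using c mult_left_mono[OF le c(1)] by (simp add: norm_mult)
    also have "\<dots> = (a\<^sup>2 + b\<^sup>2) * (\<bar>y\<bar> + \<bar>z\<bar>)" by (simp only: mult.assoc[symmetric] c(2))
    finally show ?case unfolding c_def y_def z_def .
  qed
qed

text \<open>Half of every square is added and their exact total subtracted. This isolates the
  exponent of the standard Gaussian; the corrected terms disappear for values that tend to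
  0.\<close>

lemma \<phi>_split:
  "\<forall>\<^sub>F n in F. of_nat n * (\<phi> a b n - 1) =
     complex_of_real (real n / real (v n)) *
     (iexp_rem (\<xi>\<^sub>0 a b n) + (\<xi>\<^sub>0 a b n)\<^sup>2 / 2) +
     complex_of_real (real n / real (v n)) *
     (f n * (iexp_rem (\<xi>\<^sub>r a b n) + (\<xi>\<^sub>r a b n)\<^sup>2 / 2) +
      g n * (iexp_rem (\<xi>\<^sub>s a b n) + (\<xi>\<^sub>s a b n)\<^sup>2 / 2)) - complex_of_real ((a\<^sup>2 + b\<^sup>2) / 2)"
  using \<phi>_rem[of a b] \<xi>_sums[of a b]
proof eventually_elim
  case (elim n)
  define x y z c where "x = \<xi>\<^sub>0 a b n" and "y = \<xi>\<^sub>r a b n"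
    and "z = \<xi>\<^sub>s a b n" and "c = real n / real (v n)"
  have "complex_of_real (a\<^sup>2 + b\<^sup>2) = of_real (c * (x\<^sup>2 + f n * y\<^sup>2 + g n * z\<^sup>2))"
    using elim(2) by (simp add: x_def y_def z_def c_def)
  then have s: "(of_real a)\<^sup>2 + (of_real b)\<^sup>2 = (of_real c * (of_real x ^ 2 + f n * of_real y ^ 2 + g n * of_real z ^ 2) :: complex)"
    by simp
  show ?case
    unfolding elim(1) x_def[symmetric] y_def[symmetric] z_def[symmetric] c_def[symmetric]
    by (simp add: s algebra_simps)
qed

section \<open>The limit of the transforms in each regime\<close>

text \<open>Only the valency can stay away from 0. It contributes a Poisson exponent of intensity
  1/\<omega>, and its share of the variance is taken back from the Gaussian.\<close>

lemma limit_mixed: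
  assumes "\<rho> = 0" "\<sigma> = 0" "\<kappa> + \<kappa>' > 0"
  shows "((\<lambda>n. \<phi> a b n ^ n) \<longlongrightarrow>
       mixed_char \<kappa> \<kappa>' a b) F"
proof -
  define \<omega> where "\<omega> = \<kappa> + \<kappa>'"
  define X where "X = a * sqrt \<kappa> + b * sqrt \<kappa>'"
  have "\<omega> > 0" using assms by (simp add: \<omega>_def)
  have nv: "((\<lambda>n. real n / real (v n)) \<longlongrightarrow> 1 / \<omega>) F"
    using tendsto_inverse[OF v_limit] assms by (simp add: \<omega>_def inverse_eq_divide)
  have 0: "((\<lambda>n. \<xi>\<^sub>r a b n) \<longlongrightarrow> 0) F" "((\<lambda>n. \<xi>\<^sub>s a b n) \<longlongrightarrow> 0) F"
    using \<xi>_limits(2,3)[of a b] assms by simp_all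
  have x: "((\<lambda>n. \<xi>\<^sub>0 a b n) \<longlongrightarrow> X) F" unfolding X_def by (rule \<xi>_limits)
  have "((\<lambda>n. of_nat n * (\<phi> a b n - 1)) \<longlongrightarrow>
      complex_of_real (1 / \<omega>) * (iexp_rem X + X\<^sup>2 / 2) + 0 - complex_of_real ((a\<^sup>2 + b\<^sup>2) / 2)) F"
    unfolding tendsto_cong[OF \<phi>_split[of a b]]
    by (intro tendsto_add tendsto_diff tendsto_mult tendsto_const small_remainder[OF 0] tendsto_of_real
         tendsto_iexp_rem nv x tendsto_divide tendsto_power) simp
  also have "complex_of_real (1 / \<omega>) * (iexp_rem X + X\<^sup>2 / 2) + 0 - complex_of_real ((a\<^sup>2 + b\<^sup>2) / 2) =
     (1 / \<omega>) * (iexp X - 1) - (a * sqrt \<kappa>' - b * sqrt \<kappa>)\<^sup>2 / (2 * \<omega>) - \<i> * (X / \<omega>)"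
  proof -
    have "\<omega> * (a\<^sup>2 + b\<^sup>2) - X\<^sup>2 = (a * sqrt \<kappa>' - b * sqrt \<kappa>)\<^sup>2"
      using \<kappa>_nonneg by (simp add: X_def \<omega>_def power2_sum power2_diff power_mult_distrib algebra_simps)
    then have "X\<^sup>2 / (2 * \<omega>) - (a\<^sup>2 + b\<^sup>2) / 2 = - ((a * sqrt \<kappa>' - b * sqrt \<kappa>)\<^sup>2 / (2 * \<omega>))"
      using \<open>\<omega> > 0\<close> by (simp add: field_simps)
    then have "complex_of_real (X\<^sup>2 / (2 * \<omega>) - (a\<^sup>2 + b\<^sup>2) / 2) = of_real (- ((a * sqrt \<kappa>' - b * sqrt \<kappa>)\<^sup>2 / (2 * \<omega>)))"
      by (rule arg_cong)
    moreover have "complex_of_real (1 / \<omega>) * (iexp_rem X + X\<^sup>2 / 2) + 0 - complex_of_real ((a\<^sup>2 + b\<^sup>2) / 2) =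
        (1 / \<omega>) * (iexp X - 1) + complex_of_real (X\<^sup>2 / (2 * \<omega>) - (a\<^sup>2 + b\<^sup>2) / 2) - \<i> * (X / \<omega>)"
      using \<open>\<omega> > 0\<close> by (simp add: iexp_rem_def field_simps)
    ultimately show ?thesis by simp
  qed
  finally have "((\<lambda>n. of_nat n * (\<phi> a b n - 1)) \<longlongrightarrow> \<dots>) F" .
  from char_limit[OF this] show ?thesis by (simp add: mixed_char_def X_def \<omega>_def)
qed

text \<open>Here \<open>v / n\<close> tends to 0, so \<open>n / v\<close> has no finite limit, and
  the term of the valency must be controlled through the variance too.\<close>

lemma limit_gaussian:
  assumes "\<rho> = 0" "\<sigma> = 0" "\<kappa> = 0" "\<kappa>' = 0"
  shows "((\<lambda>n. \<phi> a b n ^ n) \<longlongrightarrow> exp (- ((a\<^sup>2 + b\<^sup>2) / 2))) F"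
  unfolding exp_of_real[symmetric]
proof (rule char_limit)
  let ?x = "\<lambda>n. \<xi>\<^sub>0 a b n"
  have 0: "(?x \<longlongrightarrow> 0) F" "((\<lambda>n. \<xi>\<^sub>r a b n) \<longlongrightarrow> 0) F" "((\<lambda>n. \<xi>\<^sub>s a b n) \<longlongrightarrow> 0) F"
    using \<xi>_limits[of a b] assms by simp_all
  have "((\<lambda>n. complex_of_real (real n / real (v n)) * (iexp_rem (?x n) + (?x n)\<^sup>2 / 2)) \<longlongrightarrow> 0) F"
  proof (rule Lim_null_comparison)
    show "((\<lambda>n. (a\<^sup>2 + b\<^sup>2) * \<bar>?x n\<bar>) \<longlongrightarrow> 0) F" using 0 by (auto intro!: tendsto_eq_intros)
    show "\<forall>\<^sub>F n in F. norm (complex_of_real (real n / real (v n)) * (iexp_rem (?x n) + (?x n)\<^sup>2 / 2)) \<le> (a\<^sup>2 + b\<^sup>2) * \<bar>?x n\<bar>"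
      using \<xi>_sums[of a b]
    proof eventually_elim
      case (elim n)
      have "norm (complex_of_real (real n / real (v n)) * (iexp_rem (?x n) + (?x n)\<^sup>2 / 2)) \<le>
          real n / real (v n) * ((?x n)\<^sup>2 * \<bar>?x n\<bar>)"
        unfolding norm_mult norm_of_real by (intro mult_mono norm_iexp_rem_square_le) auto
      also have "\<dots> = (real n / real (v n) * (?x n)\<^sup>2) * \<bar>?x n\<bar>" by simp
      also have "\<dots> \<le> (a\<^sup>2 + b\<^sup>2) * \<bar>?x n\<bar>"
        unfolding elim[THEN conjunct2, symmetric] by (intro mult_right_mono mult_left_mono) auto
      finally show ?case .
    qed
  qed
  then have "((\<lambda>n. of_nat n * (\<phi> a b n - 1)) \<longlongrightarrow> 0 + 0 - complex_of_real ((a\<^sup>2 + b\<^sup>2) / 2)) F"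
    unfolding tendsto_cong[OF \<phi>_split[of a b]]
    by (intro tendsto_add tendsto_diff tendsto_const small_remainder 0)
  then show "((\<lambda>n. of_nat n * (\<phi> a b n - 1)) \<longlongrightarrow> of_real (- ((a\<^sup>2 + b\<^sup>2) / 2))) F" by simp
qed

text \<open>The valency and \<open>s\<close> supply the two Poisson exponents, with weights
  \<open>n / v\<close> and \<open>g * n / v\<close>. At r = 0 the value is
  \<open>- b / sqrt (n * k')\<close>, whose square is of order \<open>1 / n\<^sup>2\<close>; the
  total weight of that term is at most n, so it vanishes.\<close>

lemma limit_multipartite:
  assumes "\<kappa> > 0" "\<kappa>' > 0" "\<sigma> = - \<kappa>'" and r0: "\<forall>\<^sub>F n in F. r n = 0"
    and g: "((\<lambda>n. real (g n)) \<longlongrightarrow> \<kappa> / \<kappa>') F"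
  shows "((\<lambda>n. \<phi> a b n ^ n) \<longlongrightarrow>
       multipartite_char \<kappa> \<kappa>' a b) F"
proof -
  define \<omega> where "\<omega> = \<kappa> + \<kappa>'"
  define X Z where "X = a * sqrt \<kappa> + b * sqrt \<kappa>'" and "Z = b * sqrt \<kappa>' - a * \<kappa>' / sqrt \<kappa>"
  let ?x = "\<lambda>n. \<xi>\<^sub>0 a b n" and ?y = "\<lambda>n. \<xi>\<^sub>r a b n"
    and ?z = "\<lambda>n. \<xi>\<^sub>s a b n"
  have "\<omega> > 0" using assms by (simp add: \<omega>_def)
  have nv: "((\<lambda>n. real n / real (v n)) \<longlongrightarrow> 1 / \<omega>) F"
    using tendsto_inverse[OF v_limit] assms by (simp add: \<omega>_def inverse_eq_divide)
  have x: "(?x \<longlongrightarrow> X) F" unfolding X_def by (rule \<xi>_limits)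
  have "a * (\<sigma> / sqrt \<kappa>) + b * (- \<sigma> / sqrt \<kappa>') = Z"
    using assms by (simp add: Z_def real_div_sqrt)
  then have z: "(?z \<longlongrightarrow> Z) F" using \<xi>_limits(3)[of a b] by simp
  have y: "((\<lambda>n. complex_of_real (real n / real (v n)) * (f n * iexp_rem (?y n))) \<longlongrightarrow> 0) F"
  proof (rule Lim_null_comparison)
    have "((\<lambda>n. (b\<^sup>2 / 2) * ((1 / real n) / (real (k' n) / real n))) \<longlongrightarrow> (b\<^sup>2 / 2) * (0 / \<kappa>')) F"
      using assms by (intro tendsto_intros inverse_tendsto_0 lims) auto
    then show "((\<lambda>n. (b\<^sup>2 / 2) * ((1 / real n) / (real (k' n) / real n))) \<longlongrightarrow> 0) F" by simp
    show "\<forall>\<^sub>F n in F. norm (complex_of_real (real n / real (v n)) * (f n * iexp_rem (?y n))) \<le>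
        (b\<^sup>2 / 2) * ((1 / real n) / (real (k' n) / real n))"
      using params multiplicities r0
    proof eventually_elim
      case (elim n)
      have y2: "(?y n)\<^sup>2 = b\<^sup>2 / (real n * real (k' n))" using elim by (simp add: \<xi>_def power_divide)
      have "norm (complex_of_real (real n / real (v n)) * (f n * iexp_rem (?y n))) = real n * (real (f n) / real (v n)) * norm (iexp_rem (?y n))"
        by (simp add: norm_mult norm_divide)
      also have "\<dots> \<le> real n * 1 * ((?y n)\<^sup>2 / 2)"
        using elim norm_iexp_rem_le by (intro mult_mono) auto
      also have "\<dots> = (b\<^sup>2 / 2) * ((1 / real n) / (real (k' n) / real n))"
        unfolding y2 using elim by simp
      finally show ?case .
    qed
  qed
  have "((\<lambda>n. complex_of_real (real n / real (v n)) * iexp_rem (?x n) +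
      complex_of_real (real n / real (v n)) * (f n * iexp_rem (?y n)) +
      complex_of_real (real n / real (v n)) * (complex_of_real (real (g n)) * iexp_rem (?z n))) \<longlongrightarrow>
      complex_of_real (1 / \<omega>) * iexp_rem X + 0 + complex_of_real (1 / \<omega>) * (complex_of_real (\<kappa> / \<kappa>') * iexp_rem Z)) F"
    by (intro tendsto_add tendsto_mult tendsto_of_real tendsto_iexp_rem nv x y z g)
  then have "((\<lambda>n. of_nat n * (\<phi> a b n - 1)) \<longlongrightarrow>
      complex_of_real (1 / \<omega>) * iexp_rem X + 0 + complex_of_real (1 / \<omega>) * (complex_of_real (\<kappa> / \<kappa>') * iexp_rem Z)) F"
    by (rule Lim_transform_eventually)
       (use \<phi>_rem[of a b] in eventually_elim, simp add: algebra_simps)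
  also have "complex_of_real (1 / \<omega>) * iexp_rem X + 0 + complex_of_real (1 / \<omega>) * (complex_of_real (\<kappa> / \<kappa>') * iexp_rem Z) =
     (1 / \<omega>) * (iexp X - 1) + (\<kappa> / (\<omega> * \<kappa>')) * (iexp Z - 1) - \<i> * (b / sqrt \<kappa>')"
  proof -
    \<comment> \<open>The linear corrections of both Poisson parts combine to the shift of the
      second coordinate; the terms in \<open>a\<close> cancel.\<close>
    have "X + \<kappa> / \<kappa>' * Z = \<omega> * b / sqrt \<kappa>'"
    proof -
      have "\<kappa> = sqrt \<kappa> * sqrt \<kappa>" "\<kappa>' = sqrt \<kappa>' * sqrt \<kappa>'" using assms by simp_all
      then show ?thesis
        using assms unfolding X_def Z_def \<omega>_def
        by (simp add: field_simps)
    qed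
    then have "b / sqrt \<kappa>' = (X + \<kappa> / \<kappa>' * Z) / \<omega>" using \<open>\<omega> > 0\<close> by simp
    then have "complex_of_real (b / sqrt \<kappa>') = (of_real X + of_real \<kappa> / of_real \<kappa>' * of_real Z) / of_real \<omega>"
      by simp
    moreover have "complex_of_real (1 / \<omega>) * iexp_rem X + 0 + complex_of_real (1 / \<omega>) * (complex_of_real (\<kappa> / \<kappa>') * iexp_rem Z) =
      (1 / \<omega>) * (iexp X - 1) + (\<kappa> / (\<omega> * \<kappa>')) * (iexp Z - 1) -
      \<i> * ((of_real X + of_real \<kappa> / of_real \<kappa>' * of_real Z) / of_real \<omega>)"
      using \<open>\<omega> > 0\<close> assms(2) by (simp add: iexp_rem_def field_simps)
    ultimately show ?thesis by (simp only:)
  qed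
  finally have "((\<lambda>n. of_nat n * (\<phi> a b n - 1)) \<longlongrightarrow> \<dots>) F" .
  from char_limit[OF this] show ?thesis by (simp add: multipartite_char_def X_def Z_def \<omega>_def)
qed

section \<open>Consequences of a negative limit \<sigma>, and complementation\<close>

text \<open>The modulus of \<open>s\<close> is at most \<open>k\<close> and at most
  \<open>k' + 1\<close>, so linear growth of \<open>s\<close> forces linear growth of both
  valencies.\<close>

lemma s_negative:
  assumes "\<sigma> < 0"
  shows "\<kappa> > 0" "\<kappa>' > 0" "\<forall>\<^sub>F n in F. s n < 0"
proof -
  have "- \<sigma> \<le> \<kappa>"
  proof (rule tendsto_le[OF F(1) lims(1) tendsto_minus[OF lims(4)]])
    show "\<forall>\<^sub>F n in F. - (s n / real n) \<le> real (k n) / real n"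
      using bounds
    proof eventually_elim
      case (elim n)
      then have "- s n \<le> real (k n)" by linarith
      from divide_right_mono[OF this, of "real n"] show ?case by simp
    qed
  qed
  then show "\<kappa> > 0" using assms by simp
  have "((\<lambda>n. real (k' n) / real n + 1 / real n) \<longlongrightarrow> \<kappa>' + 0) F"
    by (intro tendsto_add lims inverse_tendsto_0)
  then have "- \<sigma> \<le> \<kappa>' + 0"
  proof (rule tendsto_le[OF F(1) _ tendsto_minus[OF lims(4)]])
    show "\<forall>\<^sub>F n in F. - (s n / real n) \<le> real (k' n) / real n + 1 / real n"
      using bounds
    proof eventually_elim
      case (elim n)
      then have "- s n \<le> real (k' n) + 1" by linarith
      from divide_right_mono[OF this, of "real n"] show ?case by (simp add: add_divide_distrib)
    qed
  qed
  then show "\<kappa>' > 0" using assms by simp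
  show "\<forall>\<^sub>F n in F. s n < 0"
    using order_tendstoD(2)[OF lims(4) assms] params by eventually_elim (simp add: divide_less_0_iff)
qed

text \<open>The trace of the square bounds \<open>g\<close> by \<open>v * k / s\<^sup>2\<close>,
  which converges. So \<open>f\<close> is nearly \<open>v\<close>, and the trace relation
  \<open>f * r = - g * s - k\<close> bounds \<open>r\<close>. \<open>K\<close> is large enough to
  forbid both cocliques and cliques of size \<open>K + 1\<close>.\<close>

lemma bounded_multiplicity:
  assumes "\<sigma> < 0" and r: "\<forall>\<^sub>F n in F. r n \<ge> 0"
  obtains K :: nat where "\<forall>\<^sub>F n in F. g n \<le> K \<and> (real (v n) * r n + real (k n) - r n) < real K * (real (v n) - real (k n) + r n)"
    and "\<rho> = 0"
proof -
  define \<omega> where "\<omega> = \<kappa> + \<kappa>'"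
  have pos: "\<kappa> > 0" "\<kappa>' > 0" and s: "\<forall>\<^sub>F n in F. s n < 0" using s_negative[OF assms(1)] by auto
  have "\<omega> > 0" using pos by (simp add: \<omega>_def)
  have vl: "((\<lambda>n. real (v n) / real n) \<longlongrightarrow> \<omega>) F" unfolding \<omega>_def by (rule v_limit)
  define q where "q n = real (v n) * real (k n) / (s n)\<^sup>2" for n
  have "((\<lambda>n. (real (v n) / real n) * (real (k n) / real n) / (s n / real n)\<^sup>2) \<longlongrightarrow> \<omega> * \<kappa> / \<sigma>\<^sup>2) F"
    using assms by (intro tendsto_intros vl lims) auto
  then have "(q \<longlongrightarrow> \<omega> * \<kappa> / \<sigma>\<^sup>2) F"
    by (rule Lim_transform_eventually) (use params in eventually_elim, simp add: q_def power_divide power2_eq_square)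
  then have "\<forall>\<^sub>F n in F. q n < \<omega> * \<kappa> / \<sigma>\<^sup>2 + 1" by (rule order_tendstoD) simp
  then have gq: "\<forall>\<^sub>F n in F. real (g n) \<le> \<omega> * \<kappa> / \<sigma>\<^sup>2 + 1"
    using s multiplicities
  proof eventually_elim
    case (elim n)
    have "real (g n) * (s n)\<^sup>2 \<le> (real (k n))\<^sup>2 + real (f n) * (r n)\<^sup>2 + real (g n) * (s n)\<^sup>2" by simp
    also have "\<dots> = real (v n) * real (k n)" using elim(3) by blast
    finally have "real (g n) \<le> q n" using elim by (simp add: q_def field_simps)
    then show ?case using elim by simp
  qed
  define C where "C = \<omega> * \<kappa> / \<sigma>\<^sup>2 + 1"
  have "C > 0" using pos \<open>\<omega> > 0\<close> by (auto simp: C_def intro!: add_nonneg_pos)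
  \<comment> \<open>The expression is \<open>(v - 1 - C) / n\<close>, a lower bound for
    \<open>f / n\<close>; since its limit is \<omega>, it eventually exceeds \<omega>/2.\<close>
  have "((\<lambda>n. real (v n) / real n - 1 / real n - C * (1 / real n)) \<longlongrightarrow> \<omega> - 0 - C * 0) F"
    by (intro tendsto_intros vl inverse_tendsto_0)
  then have "\<forall>\<^sub>F n in F. real (v n) / real n - 1 / real n - C * (1 / real n) > \<omega> / 2"
    by (rule order_tendstoD) (use \<open>\<omega> > 0\<close> in simp)
  moreover have "\<forall>\<^sub>F n in F. s n / real n > \<sigma> - 1" by (rule order_tendstoD[OF lims(4)]) simp
  ultimately have rb: "\<forall>\<^sub>F n in F. r n \<le> 2 * C * (1 - \<sigma>) / \<omega>"
    using gq params multiplicities s r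
  proof eventually_elim
    case (elim n)
    have n: "real n > 0" using elim by simp
    have "real (f n) = real (v n) - 1 - real (g n)" using elim(5) by linarith
    moreover have "real n * (real (v n) / real n - 1 / real n - C * (1 / real n)) = real (v n) - 1 - C"
      using n by (simp add: right_diff_distrib)
    ultimately have "real (f n) \<ge> real n * (real (v n) / real n - 1 / real n - C * (1 / real n))"
      using elim(3) by (simp add: C_def)
    moreover have "real n * (real (v n) / real n - 1 / real n - C * (1 / real n)) \<ge> real n * (\<omega> / 2)"
      using elim n by (intro mult_left_mono) auto
    ultimately have f: "real (f n) \<ge> real n * (\<omega> / 2)" by linarith
    have "real n * (\<omega> / 2) * r n \<le> real (f n) * r n" using f elim by (intro mult_right_mono) auto
    also have "\<dots> \<le> real (g n) * (- s n)" using elim(5) by simp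
    also have "\<dots> \<le> C * (real n * (1 - \<sigma>))"
      using elim n \<open>C > 0\<close> by (intro mult_mono) (auto simp: C_def field_simps)
    finally have "real n * (\<omega> * r n) \<le> real n * (2 * C * (1 - \<sigma>))" by (simp add: algebra_simps)
    then have "\<omega> * r n \<le> 2 * C * (1 - \<sigma>)" using n by (rule mult_left_le_imp_le)
    then show ?case using \<open>\<omega> > 0\<close> by (simp add: pos_le_divide_eq mult.commute)
  qed
  define D where "D = 2 * C * (1 - \<sigma>) / \<omega>"
  have "((\<lambda>n. r n / real n) \<longlongrightarrow> 0) F"
  proof (rule Lim_null_comparison)
    show "((\<lambda>n. D * (1 / real n)) \<longlongrightarrow> 0) F" using tendsto_mult[OF tendsto_const inverse_tendsto_0] by simp
    show "\<forall>\<^sub>F n in F. norm (r n / real n) \<le> D * (1 / real n)"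
      using rb[folded D_def] r by eventually_elim (simp add: divide_right_mono)
  qed
  then have "\<rho> = 0" using tendsto_unique[OF F(1) lims(3)] by blast
  \<comment> \<open>The quotient of the clique bound with \<open>r\<close> replaced by its bound
    \<open>D\<close> in the numerator and by 0 in the denominator. The denominator tends to \<omega>
    - \<kappa> = \<kappa>' > 0.\<close>
  define h where "h n = (real (v n) / real n * D + real (k n) / real n) / (real (v n) / real n - real (k n) / real n)" for n
  have "(h \<longlongrightarrow> (\<omega> * D + \<kappa>) / (\<omega> - \<kappa>)) F"
    unfolding h_def[abs_def] using pos by (intro tendsto_intros vl lims) (auto simp: \<omega>_def)
  then have "\<forall>\<^sub>F n in F. h n < (\<omega> * D + \<kappa>) / (\<omega> - \<kappa>) + 1" by (rule order_tendstoD) simp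
  define K where "K = nat \<lceil>max C ((\<omega> * D + \<kappa>) / (\<omega> - \<kappa>) + 1)\<rceil>"
  have K: "C \<le> real K" "(\<omega> * D + \<kappa>) / (\<omega> - \<kappa>) + 1 \<le> real K"
    unfolding K_def using real_nat_ceiling_ge by (meson max.bounded_iff)+
  have "\<forall>\<^sub>F n in F. g n \<le> K \<and> (real (v n) * r n + real (k n) - r n) < real K * (real (v n) - real (k n) + r n)"
    using \<open>\<forall>\<^sub>F n in F. h n < _\<close> gq rb r params
  proof eventually_elim
    case (elim n)
    have "real (g n) \<le> real K" using elim(2) K(1) by (simp add: C_def)
    moreover have "h n = ((real (v n) * D + real (k n)) / real n) / ((real (v n) - real (k n)) / real n)"
      by (simp add: h_def add_divide_distrib diff_divide_distrib)
    then have "(real (v n) * D + real (k n)) / (real (v n) - real (k n)) = h n"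
      using elim(5) by simp
    then have "(real (v n) * D + real (k n)) / (real (v n) - real (k n)) < real K" using elim(1) K(2) by linarith
    then have "real (v n) * D + real (k n) < real K * (real (v n) - real (k n))"
      using elim(5) by (simp add: divide_less_eq)
    moreover have "real (v n) * r n \<le> real (v n) * D" using elim(3) by (intro mult_left_mono) (auto simp: D_def)
    moreover have "real K * (real (v n) - real (k n)) \<le> real K * (real (v n) - real (k n) + r n)"
      using elim(4) by (intro mult_left_mono) auto
    ultimately show ?case using elim(4) by simp
  qed
  then show thesis using that \<open>\<rho> = 0\<close> by blast
qed

text \<open>With r = 0 the traces read \<open>g * s = - k\<close> and
  \<open>g * s\<^sup>2 = k * (v - k)\<close>, hence \<open>s = - (v - k)\<close> and
  \<open>g = k / (v - k)\<close>.\<close>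

lemma multipartite_parameters:
  assumes "\<sigma> < 0" and r0: "\<forall>\<^sub>F n in F. r n = 0"
  shows "\<sigma> = - \<kappa>'" "((\<lambda>n. real (g n)) \<longlongrightarrow> \<kappa> / \<kappa>') F"
proof -
  have pos: "\<kappa> > 0" "\<kappa>' > 0" using s_negative[OF assms(1)] by auto
  have eq: "\<forall>\<^sub>F n in F. s n = - (real (k' n) + 1) \<and> real (g n) = real (k n) / (real (k' n) + 1)"
    using params multiplicities r0
  proof eventually_elim
    case (elim n)
    have k': "real (k' n) + 1 = real (v n) - real (k n)" using elim by simp
    have gs: "real (g n) * s n = - real (k n)" using elim by simp
    have "real (g n) * s n * s n = real (k n) * (real (v n) - real (k n))"
      using elim by (simp add: power2_eq_square algebra_simps)
    then have "real (k n) * (- s n) = real (k n) * (real (v n) - real (k n))" unfolding gs by simp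
    moreover have "real (k n) \<noteq> 0" using elim(1) by simp
    ultimately have s: "- s n = real (v n) - real (k n)" by (metis mult_cancel_left)
    then have "real (g n) * (real (v n) - real (k n)) = real (k n)" using gs by (simp flip: s)
    then show ?case using s elim unfolding k' by (simp add: field_simps)
  qed
  have l: "((\<lambda>n. real (k' n) / real n + 1 / real n) \<longlongrightarrow> \<kappa>') F"
    using tendsto_add[OF lims(2) inverse_tendsto_0] by simp
  have "((\<lambda>n. s n / real n) \<longlongrightarrow> - \<kappa>') F"
    by (rule Lim_transform_eventually[OF tendsto_minus[OF l]]) (use eq in eventually_elim, simp add: diff_divide_distrib)
  then show "\<sigma> = - \<kappa>'" using tendsto_unique[OF F(1) lims(4)] by blast
  have "((\<lambda>n. (real (k n) / real n) / (real (k' n) / real n + 1 / real n)) \<longlongrightarrow> \<kappa> / \<kappa>') F"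
    using pos by (intro tendsto_divide lims l) auto
  then show "((\<lambda>n. real (g n)) \<longlongrightarrow> \<kappa> / \<kappa>') F"
    by (rule Lim_transform_eventually)
       (use eq params in eventually_elim, simp flip: add_divide_distrib)
qed

text \<open>The map from \<open>t\<close> to \<open>- 1 - t\<close> reverses order, so
  \<open>- 1 - s\<close> with multiplicity \<open>g\<close> takes the place of the larger
  eigenvalue.\<close>

lemma spectral_limit_compl:
  "spectral_limit F v k' k g f (\<lambda>n. - 1 - s n) (\<lambda>n. - 1 - r n) \<kappa>' \<kappa> (- \<sigma>) (- \<rho>)"
proof
  show "\<forall>\<^sub>F n in F. n > 0 \<and> k' n > 0 \<and> k n > 0 \<and> k' n + k n + 1 = v n"
    using params by eventually_elim auto
  show "\<forall>\<^sub>F n in F. g n + f n + 1 = v n \<and>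
      real (k' n) + real (g n) * (- 1 - s n) + real (f n) * (- 1 - r n) = 0 \<and>
      (real (k' n))\<^sup>2 + real (g n) * (- 1 - s n)\<^sup>2 + real (f n) * (- 1 - r n)\<^sup>2 = real (v n) * real (k' n)"
    using multiplicities compl_multiplicities by eventually_elim auto
  show "\<forall>\<^sub>F n in F. \<bar>- 1 - s n\<bar> \<le> real (k' n) \<and> \<bar>- 1 - r n\<bar> \<le> real (k' n) \<and>
      \<bar>1 + (- 1 - s n)\<bar> \<le> real (k n) \<and> \<bar>1 + (- 1 - r n)\<bar> \<le> real (k n)"
    using bounds by eventually_elim auto
  have neg: "((\<lambda>n. (- 1 - t n) / real n) \<longlongrightarrow> - \<tau>) F" if "((\<lambda>n. t n / real n) \<longlongrightarrow> \<tau>) F" for t \<tau>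
    using tendsto_diff[OF tendsto_minus[OF inverse_tendsto_0] that] by (simp add: diff_divide_distrib)
  show "((\<lambda>n. (- 1 - s n) / real n) \<longlongrightarrow> - \<sigma>) F" "((\<lambda>n. (- 1 - r n) / real n) \<longlongrightarrow> - \<rho>) F"
    by (intro neg lims)+
qed (use F lims in auto)

lemma \<phi>_compl:
  "\<forall>\<^sub>F n in F. spectral_limit.\<phi> v k' k g f (\<lambda>n. - 1 - s n) (\<lambda>n. - 1 - r n) b a n = \<phi> a b n"
proof -
  interpret C: spectral_limit F v k' k g f "\<lambda>n. - 1 - s n" "\<lambda>n. - 1 - r n" \<kappa>' \<kappa> "- \<sigma>" "- \<rho>"
    by (rule spectral_limit_compl)
  show ?thesis
    using params
  proof eventually_elim
    case (elim n)
    have \<xi>: "C.\<xi> b a n t u = \<xi> a b n u t" for t u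
      unfolding C.\<xi>_def \<xi>_def by simp
    show ?case unfolding C.\<phi>_def \<phi>_def \<xi> by (simp add: add.commute add.left_commute)
  qed
qed

end

section \<open>The limit theorem\<close>

context srg_spectrum
begin

text \<open>The product \<open>r * s = m - k\<close> is not positive.\<close>

lemma signs: "s \<le> 0" "0 \<le> r"
proof -
  have "r * s \<le> 0" using eigenvalue_prod m_le_k by simp
  then show "s \<le> 0" "0 \<le> r" using s_less_r by (auto simp: mult_le_0_iff)
qed

lemma srg_spectrum_compl:
  "srg_spectrum (compl_graph G) v (v - k - 1) (v - 2 - (2 * k - m)) (v - (2 * k - l)) (- 1 - s) (- 1 - r)"
  by unfold_locales (use strongly_regular_compl restricted_eigenvalues_compl restricted s_less_r in auto)

end

text \<open>For large \<open>v\<close> Ramsey's theorem yields a clique or coclique of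
  \<open>K + 1\<close> vertices. The clique contradicts the choice of \<open>K\<close>; the coclique
  contradicts \<open>g \<le> K\<close> as soon as r > 0. So r = 0, and then
  \<open>m - k = r * s = 0\<close>.\<close>

lemma (in spectral_limit) eventually_complete_multipartite:
  fixes G :: "nat \<Rightarrow> 'a pair_pre_digraph"
  assumes spec: "\<forall>\<^sub>F n in F. srg_spectrum (G n) (v n) (k n) (l n) (m n) (r n) (s n) \<and>
      srg_spectrum.has_multiplicities (G n) (v n) (k n) (r n) (s n) (f n) (g n)"
    and "\<sigma> < 0"
  shows "\<forall>\<^sub>F n in F. r n = 0 \<and> m n = k n" "\<rho> = 0"
proof -
  have r: "\<forall>\<^sub>F n in F. r n \<ge> 0" using spec by eventually_elim (auto intro: srg_spectrum.signs)
  obtain K where K: "\<forall>\<^sub>F n in F. g n \<le> K \<and> (real (v n) * r n + real (k n) - r n) < real K * (real (v n) - real (k n) + r n)"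
    and "\<rho> = 0" using bounded_multiplicity[OF \<open>\<sigma> < 0\<close> r] by blast
  show "\<rho> = 0" by fact
  obtain N where N: "\<And>(V::'a set) A. finite V \<Longrightarrow> N \<le> card V \<Longrightarrow> (\<And>x y. (x, y) \<in> A \<longleftrightarrow> (y, x) \<in> A) \<Longrightarrow>
    \<exists>C\<subseteq>V. card C = K + 1 \<and> ((\<forall>x\<in>C. \<forall>y\<in>C. x \<noteq> y \<longrightarrow> (x, y) \<in> A) \<or> (\<forall>x\<in>C. \<forall>y\<in>C. x \<noteq> y \<longrightarrow> (x, y) \<notin> A))"
    using ramsey_relation[where K="K + 1" and 'a='a] by blast
  have "\<kappa> + \<kappa>' > 0" using s_negative[OF \<open>\<sigma> < 0\<close>] by simp
  \<comment> \<open>\<open>v\<close> grows like (\<kappa> + \<kappa>') n and so eventually exceeds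
    the Ramsey number.\<close>
  have "filterlim (\<lambda>n. real (v n) / real n * real n) at_top F"
    by (rule filterlim_tendsto_pos_mult_at_top[OF v_limit \<open>\<kappa> + \<kappa>' > 0\<close> F(2)])
  then have "\<forall>\<^sub>F n in F. real (v n) / real n * real n \<ge> real N" by (auto simp: filterlim_at_top)
  then show "\<forall>\<^sub>F n in F. r n = 0 \<and> m n = k n"
    using spec K r params
  proof eventually_elim
    case (elim n)
    interpret srg_spectrum "G n" "v n" "k n" "l n" "m n" "r n" "s n" using elim(2) by blast
    have "N \<le> v n" using elim(1,5) by simp
    have "r n = 0"
    proof (rule ccontr)
      assume "r n \<noteq> 0"
      then have "r n > 0" using signs by simp
      have "\<exists>C\<subseteq>V. card C = K + 1 \<and>
        ((\<forall>x\<in>C. \<forall>y\<in>C. x \<noteq> y \<longrightarrow> (x, y) \<in> parcs (G n)) \<or> (\<forall>x\<in>C. \<forall>y\<in>C. x \<noteq> y \<longrightarrow> (x, y) \<notin> parcs (G n)))"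
        by (rule N) (use \<open>N \<le> v n\<close> card_V arc_sym in auto)
      then obtain C where C: "C \<subseteq> V" "card C = K + 1" and
        *: "(\<forall>x\<in>C. \<forall>y\<in>C. x \<noteq> y \<longrightarrow> (x, y) \<in> parcs (G n)) \<or> (\<forall>x\<in>C. \<forall>y\<in>C. x \<noteq> y \<longrightarrow> (x, y) \<notin> parcs (G n))"
        by auto
      from * consider (clique) "\<And>x y. x \<in> C \<Longrightarrow> y \<in> C \<Longrightarrow> x \<noteq> y \<Longrightarrow> (x, y) \<in> parcs (G n)"
        | (coclique) "\<And>x y. x \<in> C \<Longrightarrow> y \<in> C \<Longrightarrow> x \<noteq> y \<Longrightarrow> (x, y) \<notin> parcs (G n)" by metis
      then show False
      proof cases
        case clique
        have "C \<noteq> {}" using C(2) by auto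
        then have "(real (card C) - 1) * (real (v n) - real (k n) + r n) \<le> real (v n) * r n + real (k n) - r n"
          using spectral_summary(4)[OF C(1) _ clique] by simp
        then show False using C(2) elim(3) by simp
      next
        case coclique
        have "(x, y) \<notin> parcs (G n)" if "x \<in> C" "y \<in> C" for x y
          using coclique[OF that] no_loop[of x] by (cases "x = y") simp_all
        then have "card C \<le> g n" using elim(2) \<open>r n > 0\<close> C(1) unfolding has_multiplicities_def by simp
        then show False using C(2) elim(3) by simp
      qed
    qed
    then show ?case using eigenvalue_prod by simp
  qed
qed

text \<open>On the naturals \<open>sequentially\<close> is the cofinite filter, and restricting it
  to \<open>N\<close> expresses "all but finitely many members of \<open>N\<close>".\<close>

lemma finite_exceptions_iff:
  "finite {n \<in> N. \<not> P n} \<longleftrightarrow> (\<forall>\<^sub>F n in inf sequentially (principal N). P n)"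
  by (simp add: eventually_inf_principal cofinite_eq_sequentially[symmetric] eventually_cofinite)

lemma exactly_oneI:
  shows "a \<Longrightarrow> \<not> b \<Longrightarrow> \<not> c \<Longrightarrow> \<not> d \<Longrightarrow> exactly_one [a, b, c, d]"
    and "\<not> a \<Longrightarrow> b \<Longrightarrow> \<not> c \<Longrightarrow> \<not> d \<Longrightarrow> exactly_one [a, b, c, d]"
    and "\<not> a \<Longrightarrow> \<not> b \<Longrightarrow> c \<Longrightarrow> \<not> d \<Longrightarrow> exactly_one [a, b, c, d]"
    and "\<not> a \<Longrightarrow> \<not> b \<Longrightarrow> \<not> c \<Longrightarrow> d \<Longrightarrow> exactly_one [a, b, c, d]"
proof -
  have *: "exactly_one [a, b, c, d]" if "i < 4" "\<And>j. j < 4 \<Longrightarrow> [a, b, c, d] ! j \<longleftrightarrow> j = i" for i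
    unfolding exactly_one_def using that by (intro ex1I[of _ i]) auto
  have less4: "j < 4 \<longleftrightarrow> j = 0 \<or> j = 1 \<or> j = 2 \<or> j = 3" for j :: nat by auto
  show "a \<Longrightarrow> \<not> b \<Longrightarrow> \<not> c \<Longrightarrow> \<not> d \<Longrightarrow> exactly_one [a, b, c, d]" by (rule *[of 0]) (auto simp: less4)
  show "\<not> a \<Longrightarrow> b \<Longrightarrow> \<not> c \<Longrightarrow> \<not> d \<Longrightarrow> exactly_one [a, b, c, d]" by (rule *[of 1]) (auto simp: less4)
  show "\<not> a \<Longrightarrow> \<not> b \<Longrightarrow> c \<Longrightarrow> \<not> d \<Longrightarrow> exactly_one [a, b, c, d]" by (rule *[of 2]) (auto simp: less4)
  show "\<not> a \<Longrightarrow> \<not> b \<Longrightarrow> \<not> c \<Longrightarrow> d \<Longrightarrow> exactly_one [a, b, c, d]" by (rule *[of 3]) (auto simp: less4)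
qed

text \<open>The numbers alone separate the four cases: \<sigma> < 0, \<rho> > 0, and, when both
  vanish, whether \<kappa> + \<kappa>' is positive. The limit law and the convergence are
  established only in the case that occurs.\<close>

theorem theorem1:
  fixes N :: "nat set"
    and G :: "nat \<Rightarrow> 'a pair_pre_digraph"
    and v k l m k' :: "nat \<Rightarrow> nat"
    and r s :: "nat \<Rightarrow> real"
    and \<kappa> \<kappa>' \<rho> \<sigma> :: real
    and F :: "nat filter"
    and \<nu> :: "nat \<Rightarrow> (real \<times> real) measure"
  assumes "infinite N" and "\<And>n. n \<in> N \<Longrightarrow> 0 < n"
    and "\<And>n. n \<in> N \<Longrightarrow> strongly_regular (G n) (v n) (k n) (l n) (m n)"
    and "\<And>n. n \<in> N \<Longrightarrow> k' n = v n - k n - 1"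
    and "\<And>n. n \<in> N \<Longrightarrow> restricted_eigenvalues (G n) = {r n, s n}"
    and "\<And>n. n \<in> N \<Longrightarrow> s n < r n"
    and "F = inf sequentially (principal N)"
    and "((\<lambda>n. real (k n) / real n) \<longlongrightarrow> \<kappa>) F"
    and "((\<lambda>n. real (k' n) / real n) \<longlongrightarrow> \<kappa>') F"
    and "((\<lambda>n. r n / real n) \<longlongrightarrow> \<rho>) F"
    and "((\<lambda>n. s n / real n) \<longlongrightarrow> \<sigma>) F"
    and "\<And>n. n \<in> N \<Longrightarrow>
           \<nu> n = joint_spectral_distribution (cart_pow (G n) n) (cart_pow (compl_graph (G n)) n)
                   (n * k n) (n * k' n)"
  shows "(\<rho> = 0 \<or> \<sigma> = 0) \<and>
    exactly_one
      [\<kappa> > 0 \<and> \<kappa>' = - \<sigma> \<and> - \<sigma> > 0 \<and> \<rho> = 0 \<and>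
         (\<exists>L. law_multipartite \<kappa> \<kappa>' L \<and> weak_conv_along \<nu> L F) \<and>
         finite {n \<in> N. \<not> (\<exists>p\<ge>2. \<exists>q\<ge>2. digraph_iso (G n) (complete_multipartite p q))},
       \<kappa> = \<rho> \<and> \<rho> > 0 \<and> \<kappa>' > 0 \<and> \<sigma> = 0 \<and>
         (\<exists>L. law_cliques \<kappa> \<kappa>' L \<and> weak_conv_along \<nu> L F) \<and>
         finite {n \<in> N. \<not> (\<exists>p\<ge>2. \<exists>q\<ge>2. digraph_iso (G n) (disjoint_cliques p q))},
       (\<kappa> > 0 \<or> \<kappa>' > 0) \<and> \<rho> = 0 \<and> \<sigma> = 0 \<and>
         (\<exists>L. law_mixed \<kappa> \<kappa>' L \<and> weak_conv_along \<nu> L F),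
       \<kappa> = 0 \<and> \<kappa>' = 0 \<and> \<rho> = 0 \<and> \<sigma> = 0 \<and> weak_conv_along \<nu> std_gaussian2 F]"
proof -
  have inN: "\<forall>\<^sub>F n in F. n \<in> N" using assms(7) by (simp add: eventually_inf_principal)
  have F: "F \<noteq> bot"
    using assms(1) finite_exceptions_iff[of N "\<lambda>_. False"] by (auto simp: assms(7) trivial_limit_def)
  have F': "filterlim real at_top F"
    unfolding assms(7) by (rule filterlim_mono[OF filterlim_real_sequentially order_refl inf_le1])
  have spec: "srg_spectrum (G n) (v n) (k n) (l n) (m n) (r n) (s n)" if "n \<in> N" for n
    using assms(3,5,6) that by unfold_locales auto
  have "\<exists>f g. \<forall>n\<in>N. srg_spectrum.has_multiplicities (G n) (v n) (k n) (r n) (s n) (f n) (g n)"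
    using srg_spectrum.spectral_summary(3)[OF spec] by metis
  then obtain f g where mult: "\<And>n. n \<in> N \<Longrightarrow> srg_spectrum.has_multiplicities (G n) (v n) (k n) (r n) (s n) (f n) (g n)"
    by blast
  have v: "v n = k n + k' n + 1" "k n > 0" "k' n > 0" if "n \<in> N" for n
    using srg.k_bounds[OF srg_spectrum.axioms(1)[OF spec[OF that]]] assms(4)[OF that] by auto
  interpret S: spectral_limit F v k k' f g r s \<kappa> \<kappa>' \<rho> \<sigma>
  proof
    show "\<forall>\<^sub>F n in F. n > 0 \<and> k n > 0 \<and> k' n > 0 \<and> k n + k' n + 1 = v n"
      using inN by eventually_elim (simp add: v assms(2))
    show "\<forall>\<^sub>F n in F. f n + g n + 1 = v n \<and>
        real (k n) + real (f n) * r n + real (g n) * s n = 0 \<and>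
        (real (k n))\<^sup>2 + real (f n) * (r n)\<^sup>2 + real (g n) * (s n)\<^sup>2 = real (v n) * real (k n)"
      using inN
    proof eventually_elim
      case (elim n)
      then show ?case using mult[OF elim] unfolding srg_spectrum.has_multiplicities_def[OF spec[OF elim]] by blast
    qed
    show "\<forall>\<^sub>F n in F. \<bar>r n\<bar> \<le> real (k n) \<and> \<bar>s n\<bar> \<le> real (k n) \<and> \<bar>1 + r n\<bar> \<le> real (k' n) \<and> \<bar>1 + s n\<bar> \<le> real (k' n)"
      using inN
    proof eventually_elim
      case (elim n)
      show ?case
        using srg_spectrum.restricted_bounds[OF spec[OF elim]] unfolding assms(4)[OF elim] by blast
    qed
  qed (use F F' assms in auto)
  \<comment> \<open>The continuity theorem specialised to the spectral distributions; what remains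
    for each case is a limit of n-th powers of \<open>S.\<phi>\<close>.\<close>
  have conv: "weak_conv_along \<nu> L F"
    if L: "borel_prob L" and lim: "\<And>a b. ((\<lambda>n. S.\<phi> a b n ^ n) \<longlongrightarrow> (\<integral>z. iexp ((a, b) \<bullet> z) \<partial>L)) F" for L
  proof (rule weak_conv_alongI_char[OF _ L])
    have \<nu>: "\<nu> n = srg_spectrum.power_distribution (G n) (v n) (k n) n" if "n \<in> N" for n
      using assms(12)[OF that] unfolding srg_spectrum.power_distribution_def[OF spec[OF that]] assms(4)[OF that] .
    show "\<forall>\<^sub>F n in F. borel_prob (\<nu> n)"
      using inN by eventually_elim (simp add: \<nu> srg_spectrum.spectral_summary(1)[OF spec])
    \<comment> \<open>The radius \<open>sqrt (2 / e)\<close> is the one for which the Chebyshev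
      bound equals \<open>e\<close>.\<close>
    show "\<exists>R. \<forall>\<^sub>F n in F. measure (\<nu> n) {z. norm z > R} \<le> e" if "e > 0" for e
    proof (intro exI)
      have "sqrt (2 / e) > 0" using that by simp
      then have le: "measure (\<nu> n) {z. norm z > sqrt (2 / e)} \<le> 2 / (sqrt (2 / e))\<^sup>2" if "n \<in> N" for n
        unfolding \<nu>[OF that] using that assms(2) by (intro srg_spectrum.spectral_summary(2)[OF spec]) auto
      have "2 / (sqrt (2 / e))\<^sup>2 = e" using that by simp
      then show "\<forall>\<^sub>F n in F. measure (\<nu> n) {z. norm z > sqrt (2 / e)} \<le> e"
        using inN le by (auto elim!: eventually_mono)
    qed
    fix w :: "real \<times> real"
    obtain a b where w: "w = (a, b)" by (cases w)
    have "\<forall>\<^sub>F n in F. S.\<phi> a b n ^ n = (\<integral>z. iexp ((a, b) \<bullet> z) \<partial>\<nu> n)"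
      using inN
    proof eventually_elim
      case (elim n)
      then show ?case
        using mult[OF elim] unfolding srg_spectrum.has_multiplicities_def[OF spec[OF elim]] \<nu>[OF elim]
          S.\<phi>_def S.\<xi>_def assms(4)[OF elim] by metis
    qed
    then show "((\<lambda>n. \<integral>z. iexp (w \<bullet> z) \<partial>\<nu> n) \<longlongrightarrow> (\<integral>z. iexp (w \<bullet> z) \<partial>L)) F"
      unfolding w using lim[of a b] by (rule Lim_transform_eventually[rotated])
  qed
  have specF: "\<forall>\<^sub>F n in F. srg_spectrum (G n) (v n) (k n) (l n) (m n) (r n) (s n) \<and>
      srg_spectrum.has_multiplicities (G n) (v n) (k n) (r n) (s n) (f n) (g n)"
    using inN by eventually_elim (simp add: spec mult)
  have "\<sigma> \<le> 0"
    by (rule tendsto_upperbound[OF assms(11) _ F])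
       (use inN in eventually_elim, use srg_spectrum.signs(1)[OF spec] in \<open>auto simp: divide_nonpos_nonneg\<close>)
  have "\<rho> \<ge> 0"
    by (rule tendsto_lowerbound[OF assms(10) _ F])
       (use inN in eventually_elim, use srg_spectrum.signs(2)[OF spec] in auto)
  interpret C: spectral_limit F v k' k g f "\<lambda>n. - 1 - s n" "\<lambda>n. - 1 - r n" \<kappa>' \<kappa> "- \<sigma>" "- \<rho>"
    by (rule S.spectral_limit_compl)
  \<comment> \<open>The Ramsey argument for the complements, where - \<rho> < 0 plays the part of
    \<sigma>. Their graph-theoretic facts come with multiplicities of their own, \<open>f'\<close>
    and \<open>g'\<close>, hence a second numerical instance beside the one with \<open>g\<close>
    and \<open>f\<close> exchanged.\<close>
  have compl: "(\<forall>\<^sub>F n in F. - 1 - s n = 0 \<and> v n - (2 * k n - l n) = v n - k n - 1) \<and> - \<sigma> = 0" if "\<rho> > 0"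
  proof -
    let ?l = "\<lambda>n. v n - 2 - (2 * k n - m n)" and ?m = "\<lambda>n. v n - (2 * k n - l n)"
    have specC: "srg_spectrum (compl_graph (G n)) (v n) (k' n) (?l n) (?m n) (- 1 - s n) (- 1 - r n)" if "n \<in> N" for n
      unfolding assms(4)[OF that] by (rule srg_spectrum.srg_spectrum_compl[OF spec[OF that]])
    have "\<exists>f g. \<forall>n\<in>N. srg_spectrum.has_multiplicities (compl_graph (G n)) (v n) (k' n) (- 1 - s n) (- 1 - r n) (f n) (g n)"
      using srg_spectrum.spectral_summary(3)[OF specC] by metis
    then obtain f' g' where mult': "\<And>n. n \<in> N \<Longrightarrow>
        srg_spectrum.has_multiplicities (compl_graph (G n)) (v n) (k' n) (- 1 - s n) (- 1 - r n) (f' n) (g' n)"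
      by blast
    interpret C': spectral_limit F v k' k f' g' "\<lambda>n. - 1 - s n" "\<lambda>n. - 1 - r n" \<kappa>' \<kappa> "- \<sigma>" "- \<rho>"
    proof
      show "\<forall>\<^sub>F n in F. f' n + g' n + 1 = v n \<and>
          real (k' n) + real (f' n) * (- 1 - s n) + real (g' n) * (- 1 - r n) = 0 \<and>
          (real (k' n))\<^sup>2 + real (f' n) * (- 1 - s n)\<^sup>2 + real (g' n) * (- 1 - r n)\<^sup>2 = real (v n) * real (k' n)"
        using inN
      proof eventually_elim
        case (elim n)
        then show ?case using mult'[OF elim] unfolding srg_spectrum.has_multiplicities_def[OF specC[OF elim]] by blast
      qed
    qed (rule C.F C.params C.bounds C.lims)+
    have "\<forall>\<^sub>F n in F. srg_spectrum (compl_graph (G n)) (v n) (k' n) (?l n) (?m n) (- 1 - s n) (- 1 - r n) \<and>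
        srg_spectrum.has_multiplicities (compl_graph (G n)) (v n) (k' n) (- 1 - s n) (- 1 - r n) (f' n) (g' n)"
      using inN by eventually_elim (use specC mult' in blast)
    then have "\<forall>\<^sub>F n in F. - 1 - s n = 0 \<and> ?m n = k' n" "- \<sigma> = 0"
      using C'.eventually_complete_multipartite[of "\<lambda>n. compl_graph (G n)" ?l ?m] that by auto
    moreover from this(1) inN have "\<forall>\<^sub>F n in F. - 1 - s n = 0 \<and> ?m n = v n - k n - 1"
      by eventually_elim (simp add: assms(4))
    ultimately show ?thesis by blast
  qed
  consider (i) "\<sigma> < 0" | (ii) "\<sigma> = 0" "\<rho> > 0" | (iii) "\<sigma> = 0" "\<rho> = 0" "\<kappa> + \<kappa>' > 0"
    | (iv) "\<sigma> = 0" "\<rho> = 0" "\<kappa> = 0" "\<kappa>' = 0"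
    using \<open>\<sigma> \<le> 0\<close> \<open>\<rho> \<ge> 0\<close> S.\<kappa>_nonneg by linarith
  then show ?thesis
  proof cases
    case i
    note ev = S.eventually_complete_multipartite[OF specF i]
    have r0: "\<forall>\<^sub>F n in F. r n = 0" using ev(1) by eventually_elim simp
    note pos = S.s_negative(1,2)[OF i] and par = S.multipartite_parameters[OF i r0]
    obtain L where L: "law_multipartite \<kappa> \<kappa>' L"
      "\<And>a b. (\<integral>z. iexp ((a, b) \<bullet> z) \<partial>L) = multipartite_char \<kappa> \<kappa>' a b"
      using multipartite_law_exists[OF pos] by blast
    have "weak_conv_along \<nu> L F"
    proof (rule conv)
      show "borel_prob L" using L(1) by (simp add: law_multipartite_def)
      show "((\<lambda>n. S.\<phi> a b n ^ n) \<longlongrightarrow> (\<integral>z. iexp ((a, b) \<bullet> z) \<partial>L)) F" for a b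
        unfolding L(2) by (rule S.limit_multipartite[OF pos par(1) r0 par(2)])
    qed
    moreover have "\<forall>\<^sub>F n in F. \<exists>p\<ge>2. \<exists>q\<ge>2. digraph_iso (G n) (complete_multipartite p q)"
      using ev(1) inN
    proof eventually_elim
      case (elim n)
      then show ?case
        by (intro srg.iso_complete_multipartite[OF srg_spectrum.axioms(1)[OF spec]]) auto
    qed
    then have "finite {n \<in> N. \<not> (\<exists>p\<ge>2. \<exists>q\<ge>2. digraph_iso (G n) (complete_multipartite p q))}"
      unfolding finite_exceptions_iff assms(7) .
    ultimately show ?thesis
      using i pos par(1) ev(2) L(1) by (intro conjI exactly_oneI(1)) auto
  next
    case ii
    have ev: "\<forall>\<^sub>F n in F. - 1 - s n = 0" "\<forall>\<^sub>F n in F. v n - (2 * k n - l n) = v n - k n - 1"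
      using compl[OF ii(2)] by (auto elim: eventually_mono)
    have neg: "- \<rho> < 0" using ii by simp
    note pos = C.s_negative(1,2)[OF neg] and par = C.multipartite_parameters[OF neg ev(1)]
    obtain L where L: "law_cliques \<kappa> \<kappa>' L"
      "\<And>a b. (\<integral>z. iexp ((a, b) \<bullet> z) \<partial>L) = multipartite_char \<kappa>' \<kappa> b a"
      using cliques_law_exists[OF pos(2,1)] by blast
    have "weak_conv_along \<nu> L F"
    proof (rule conv)
      show "borel_prob L" using L(1) by (simp add: law_cliques_def)
      show "((\<lambda>n. S.\<phi> a b n ^ n) \<longlongrightarrow> (\<integral>z. iexp ((a, b) \<bullet> z) \<partial>L)) F" for a b
      proof (rule Lim_transform_eventually)
        show "((\<lambda>n. C.\<phi> b a n ^ n) \<longlongrightarrow> (\<integral>z. iexp ((a, b) \<bullet> z) \<partial>L)) F"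
          using C.limit_multipartite[OF pos par(1) ev(1) par(2), of b a] unfolding L(2) .
        show "\<forall>\<^sub>F n in F. C.\<phi> b a n ^ n = S.\<phi> a b n ^ n"
          using S.\<phi>_compl[of b a] by eventually_elim simp
      qed
    qed
    moreover have "\<forall>\<^sub>F n in F. \<exists>p\<ge>2. \<exists>q\<ge>2. digraph_iso (G n) (disjoint_cliques p q)"
      using ev(2) inN
    proof eventually_elim
      case (elim n)
      then show ?case
        by (intro srg.iso_disjoint_cliques[OF srg_spectrum.axioms(1)[OF spec]]) auto
    qed
    then have "finite {n \<in> N. \<not> (\<exists>p\<ge>2. \<exists>q\<ge>2. digraph_iso (G n) (disjoint_cliques p q))}"
      unfolding finite_exceptions_iff assms(7) .
    ultimately show ?thesis
      using ii pos par(1) L(1) by (intro conjI exactly_oneI(2)) auto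
  next
    case iii
    obtain L where L: "law_mixed \<kappa> \<kappa>' L"
      "\<And>a b. (\<integral>z. iexp ((a, b) \<bullet> z) \<partial>L) = mixed_char \<kappa> \<kappa>' a b"
      using mixed_law_exists[OF S.\<kappa>_nonneg iii(3)] by blast
    have "weak_conv_along \<nu> L F"
    proof (rule conv)
      show "borel_prob L" using L(1) by (simp add: law_mixed_def)
      show "((\<lambda>n. S.\<phi> a b n ^ n) \<longlongrightarrow> (\<integral>z. iexp ((a, b) \<bullet> z) \<partial>L)) F" for a b
        unfolding L(2) by (rule S.limit_mixed[OF iii(2,1,3)])
    qed
    then show ?thesis
      using iii S.\<kappa>_nonneg L(1) by (intro conjI exactly_oneI(3)) auto
  next
    case iv
    have "weak_conv_along \<nu> std_gaussian2 F"
    proof (rule conv[OF borel_prob_std_gaussian2])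
      show "((\<lambda>n. S.\<phi> a b n ^ n) \<longlongrightarrow> (\<integral>z. iexp ((a, b) \<bullet> z) \<partial>std_gaussian2)) F" for a b
        unfolding char_std_gaussian2 by (rule S.limit_gaussian[OF iv(2,1,3,4)])
    qed
    then show ?thesis
      using iv by (intro conjI exactly_oneI(4)) auto
  qed
qed

end
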